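(* Let $\varphi$ be a function in $\mathcal{F}_1$ such that $\lambda_1(\varphi)\neq 0$, with associated first-coordinate discontinuities $\beta^1_0,\dots,\beta^1_{r_1}$. Let $\alpha=(\alpha_1,\alpha_2)$ be totally irrational. Suppose that $$\beta^1_j-\beta^1_{j'}\in \mathrm{Bad}_{\mathbb{Z}}(\alpha_1)\quad\text{for all } j,j'\in\{1,\dots,r_1\}.$$ Then the $\mathbb{R}$-valued cocycle $(\varphi_{n,\alpha})$ over the rotation $T_\alpha$ on $\mathbb{T}^2$ is ergodic.
   Context: $\mathbb{T}^2=\mathbb{R}^2/\mathbb{Z}^2$ with Haar probability measure $\mu$ (also $dx$); $T_\alpha x=x+\alpha$. $\alpha$ is totally irrational if $1,\alpha_1,\alpha_2$ are linearly independent over $\mathbb{Q}$. Class $\mathcal{F}_1$: centered functions $\varphi:\mathbb{T}^2\to\mathbb{R}$ (i.e. $\int\varphi\,d\mu=0$) such that, for two finite sets depending on $\varphi$, $J_i=\{\beta^i_0=0\le\beta^i_1<\dots<\beta^i_{r_i-1}\le\beta^i_{r_i}=1\}$, $r_i\ge1$, $i=1,2$, the partial derivative $\frac{\partial\varphi}{\partial x_1}$ exists on the open rectangles $P_{j,j'}=\,]\beta^1_j,\beta^1_{j+1}[\times]\beta^2_{j'},\beta^2_{j'+1}[$, $0\le j\le r_1-1$, $0\le j'\le r_2-1$, and $\varphi$ and $\frac{\partial\varphi}{\partial x_1}$ are continuous on each $P_{j,j'}$ and can be continuously extended to its closure. $\lambda_1(\varphi)=\int_{\mathbb{T}^2}\frac{\partial\varphi}{\partial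 x_1}\,dx$. For an irrational $\theta$, $\mathrm{Bad}_{\mathbb{Z}}(\theta)$ is the set of real $x$ for which there is $c(x)>0$ with $\|q\theta-x\|\ge c(x)/|q|$ for all $q\in\mathbb{Z}\setminus\{0\}$, where $\|u\|$ is the distance from $u$ to $\mathbb{Z}$. (Thus $0\in\mathrm{Bad}_{\mathbb{Z}}(\theta)$ means $\theta$ is badly approximable.) Cocycle: $\varphi_{n,\alpha}(x)=\sum_{k=0}^{n-1}\varphi(x+k\alpha)$. It is ergodic if the map $(x,z)\mapsto(x+\alpha,z+\varphi(x))$ on $\mathbb{T}^2\times\mathbb{R}$, with the product of $\mu$ and Lebesgue measure, is ergodic. *)

theory Defs
  imports "HOL-Analysis.Analysis"
begin

text \<open>
  The torus \<open>\<real>\<^sup>2/\<int>\<^sup>2\<close> is modelled on its fundamental domain \<open>[0,1)\<^sup>2\<close>, with addition modulo 1 in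
  each coordinate; only the values of a function \<open>\<phi>\<close> on this domain matter. The Haar measure is
  taken complete, because functions of the class below are arbitrary on finitely many
  segments, hence Lebesgue but in general not Borel measurable.
\<close>

definition torus_domain :: "(real \<times> real) set" where
  "torus_domain = {0..<1} \<times> {0..<1}"

definition torus :: "(real \<times> real) measure" where
  "torus = lebesgue_on torus_domain"

definition rotation :: "real \<times> real \<Rightarrow> real \<times> real \<Rightarrow> real \<times> real" where
  "rotation \<alpha> x = (frac (fst x + fst \<alpha>), frac (snd x + snd \<alpha>))"

definition totally_irrational :: "real \<times> real \<Rightarrow> bool" where
  "totally_irrational \<alpha> \<longleftrightarrow>
     (\<forall>a b c :: rat. of_rat a + of_rat b * fst \<alpha> + of_rat c * snd \<alpha> = 0 \<longrightarrow> a = 0 \<and> b = 0 \<and> c = 0)"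

definition Bad_Z :: "real \<Rightarrow> real set" where
  "Bad_Z \<theta> = {x. \<exists>c>0. \<forall>q :: int. q \<noteq> 0 \<longrightarrow>
      infdist (of_int q * \<theta> - x) \<int> \<ge> c / of_int \<bar>q\<bar>}"

text \<open>
  Subdivisions \<open>0 = \<beta>\<^sub>0 \<le> \<beta>\<^sub>1 < \<dots> < \<beta>\<^bsub>r-1\<^esub> \<le> \<beta>\<^sub>r = 1\<close>; only the two extreme inequalities may be
  equalities, in which case the corresponding rectangles are empty.
\<close>

definition subdivision :: "nat \<Rightarrow> (nat \<Rightarrow> real) \<Rightarrow> bool" where
  "subdivision r \<beta> \<longleftrightarrow> r \<ge> 1 \<and> \<beta> 0 = 0 \<and> \<beta> r = 1 \<and>
     \<beta> 0 \<le> \<beta> 1 \<and> strict_mono_on {1..r-1} \<beta> \<and> \<beta> (r-1) \<le> \<beta> r"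

definition rectangle :: "(nat \<Rightarrow> real) \<Rightarrow> (nat \<Rightarrow> real) \<Rightarrow> nat \<Rightarrow> nat \<Rightarrow> (real \<times> real) set" where
  "rectangle \<beta>1 \<beta>2 j j' = {\<beta>1 j<..<\<beta>1 (Suc j)} \<times> {\<beta>2 j'<..<\<beta>2 (Suc j')}"

definition partial1 :: "(real \<times> real \<Rightarrow> real) \<Rightarrow> real \<times> real \<Rightarrow> real" where
  "partial1 \<phi> p = deriv (\<lambda>t. \<phi> (t, snd p)) (fst p)"

text \<open>
  The closure is the closed rectangle in the plane, not the closure in the torus: for instance
  \<open>\<phi>(x) = x\<^sub>1 - 1/2\<close> on \<open>[0,1)\<^sup>2\<close> is admissible with the trivial subdivisions.
\<close>

definition continuous_up_to_closure :: "(real \<times> real) set \<Rightarrow> (real \<times> real \<Rightarrow> real) \<Rightarrow> bool" where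
  "continuous_up_to_closure P f \<longleftrightarrow> continuous_on P f \<and>
     (\<exists>g. continuous_on (closure P) g \<and> (\<forall>p\<in>P. g p = f p))"

definition F1_with ::
  "nat \<Rightarrow> (nat \<Rightarrow> real) \<Rightarrow> nat \<Rightarrow> (nat \<Rightarrow> real) \<Rightarrow> (real \<times> real \<Rightarrow> real) set" where
  "F1_with r1 \<beta>1 r2 \<beta>2 = {\<phi>.
     subdivision r1 \<beta>1 \<and> subdivision r2 \<beta>2 \<and>
     integrable torus \<phi> \<and> (\<integral>x. \<phi> x \<partial>torus) = 0 \<and>
     (\<forall>j<r1. \<forall>j'<r2.
        (\<forall>p \<in> rectangle \<beta>1 \<beta>2 j j'. (\<lambda>t. \<phi> (t, snd p)) field_differentiable at (fst p)) \<and>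
        continuous_up_to_closure (rectangle \<beta>1 \<beta>2 j j') \<phi> \<and>
        continuous_up_to_closure (rectangle \<beta>1 \<beta>2 j j') (partial1 \<phi>))}"

definition lambda1 :: "(real \<times> real \<Rightarrow> real) \<Rightarrow> real" where
  "lambda1 \<phi> = (\<integral>x. partial1 \<phi> x \<partial>torus)"

definition measure_preserving :: "'a measure \<Rightarrow> ('a \<Rightarrow> 'a) \<Rightarrow> bool" where
  "measure_preserving M T \<longleftrightarrow> T \<in> measurable M M \<and>
     (\<forall>A\<in>sets M. emeasure M (T -` A \<inter> space M) = emeasure M A)"

text \<open>The measure may be infinite.\<close>

definition ergodic :: "'a measure \<Rightarrow> ('a \<Rightarrow> 'a) \<Rightarrow> bool" where
  "ergodic M T \<longleftrightarrow> measure_preserving M T \<and>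
     (\<forall>A\<in>sets M. T -` A \<inter> space M = A \<longrightarrow> A \<in> null_sets M \<or> space M - A \<in> null_sets M)"

definition cocycle :: "(real \<times> real \<Rightarrow> real) \<Rightarrow> real \<times> real \<Rightarrow> nat \<Rightarrow> real \<times> real \<Rightarrow> real" where
  "cocycle \<phi> \<alpha> n x = (\<Sum>k<n. \<phi> (rotation (real k *\<^sub>R \<alpha>) x))"

definition skew_product ::
  "(real \<times> real \<Rightarrow> real) \<Rightarrow> real \<times> real \<Rightarrow> (real \<times> real) \<times> real \<Rightarrow> (real \<times> real) \<times> real" where
  "skew_product \<phi> \<alpha> = (\<lambda>(x, z). (rotation \<alpha> x, z + \<phi> x))"

lemma rotation_rotation: "rotation a (rotation b x) = rotation (b + a) x"
proof -
  have "frac (frac u + v) = frac (u + v)" for u v :: real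
  proof -
    have eq: "u + v = (frac u + v) + of_int \<lfloor>u\<rfloor>" by (simp add: frac_def)
    have "\<lfloor>(frac u + v) + of_int \<lfloor>u\<rfloor>\<rfloor> = \<lfloor>frac u + v\<rfloor> + \<lfloor>u\<rfloor>" by simp
    then show ?thesis unfolding eq frac_def by simp
  qed
  then show ?thesis by (simp add: rotation_def algebra_simps)
qed

text \<open>The cocycle is the fibre component of the iterates of the skew product.\<close>

lemma skew_product_iterate:
  assumes "x \<in> torus_domain"
  shows "(skew_product \<phi> \<alpha> ^^ n) (x, z) = (rotation (real n *\<^sub>R \<alpha>) x, z + cocycle \<phi> \<alpha> n x)"
proof (induction n)
  case 0
  then show ?case using assms
    by (cases x) (simp add: cocycle_def rotation_def torus_domain_def frac_eq)
next
  case (Suc n)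
  then show ?case
    by (simp add: skew_product_def cocycle_def rotation_rotation algebra_simps)
qed

definition ergodic_cocycle :: "(real \<times> real \<Rightarrow> real) \<Rightarrow> real \<times> real \<Rightarrow> bool" where
  "ergodic_cocycle \<phi> \<alpha> \<longleftrightarrow>
     ergodic (completion (torus \<Otimes>\<^sub>M lborel)) (skew_product \<phi> \<alpha>)"

end

theory Submission
  imports Defs
begin

text \<open>
  The skew product shears. Along a horizontal line, the derivative of
  the \<open>n\<close>-th Birkhoff sum \<open>\<phi>\<^sub>n\<close> is the Birkhoff sum of \<open>\<partial>\<phi>/\<partial>x\<^sub>1\<close>, which by equidistribution is
  uniformly close to \<open>n \<lambda>\<^sub>1(\<phi>)\<close>. The jumps of \<open>\<phi>\<^sub>n\<close> on the line lie at the points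
  \<open>\<beta>\<^sub>j - k \<alpha>\<^sub>1\<close> modulo 1 with \<open>k < n\<close>, and the Diophantine hypothesis keeps any two of them at
  distance at least \<open>c/n\<close> (lemma \<open>Bad_Z_separated\<close>). So every horizontal segment of length \<open>c/n\<close>
  contains one of length \<open>c/(2n)\<close> without jumps, and there \<open>\<phi>\<^sub>n\<close> is nearly affine and sweeps out an
  interval whose length \<open>c \<bar>\<lambda>\<^sub>1(\<phi>)\<bar>/2\<close> does not depend on \<open>n\<close> (\<open>free_half\<close>, \<open>birkhoff_shear\<close>): the
  \<open>n\<close>-th iterate turns tiny horizontal segments into nearly vertical segments of fixed height.

  Let \<open>F(x,z)\<close> be a bounded invariant function. Averaging over a short interval of the fibre commutes
  with the skew product, so \<open>F\<close> may be taken Lipschitz in \<open>z\<close>. By Lebesgue's density theorem \<open>F(\<cdot>,z)\<close>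
  is nearly constant on most of a short horizontal segment at almost every \<open>x\<close>
  (\<open>approximate_continuity\<close>). If this holds at \<open>x\<close> and at \<open>x + n\<alpha>\<close> on the scale \<open>c/n\<close>, then
  transporting \<open>F\<close> along the orbit from \<open>x\<close>, from \<open>x + u\<^sub>1\<close> and from \<open>x + u\<^sub>2\<close>, with
  \<open>u\<^sub>2 - u\<^sub>1 = \<tau>/n\<close>, shows that \<open>F(x,z)\<close> and \<open>F(x,z + \<tau> \<lambda>\<^sub>1(\<phi>))\<close> nearly agree
  (\<open>approximate_period\<close>). Letting \<open>n\<close> grow, all small numbers of one sign are periods of \<open>F(x,\<cdot>)\<close>,
  which is therefore constant (\<open>AE_constant_fibre\<close>).

  The scale from which the approximation is good depends on \<open>x\<close>, and it is uniform only for \<open>z\<close> in a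
  bounded window. Hence infinitely many \<open>n\<close> are needed for which \<open>x + n\<alpha>\<close> lies in the same good set
  as \<open>x\<close> and \<open>\<phi>\<^sub>n(x)\<close> is bounded. They come from the theorem \<open>recurrence\<close>, a consequence of
  \<open>\<phi>\<^sub>n = o(n)\<close>: if they were missing on a set of positive measure, that set would produce linearly
  many values of Birkhoff sums, pairwise more than 1 apart, in an interval of sublinear length.

  An invariant function is thus a function of \<open>x\<close> alone, invariant under a rotation with dense orbits;
  its integrals over translates of a cube do not depend on the cube, and Lebesgue's differentiation
  theorem makes it constant (\<open>invariant_function_constant\<close>).

  Functions on the torus are treated as periodic functions on the plane throughout.
\<close>

section \<open>The torus as a quotient of the plane\<close>

(* Statements quantify over points of the plane and of the skew product; they are kept as single
   variables instead of being split into coordinates. *)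
declare split_paired_All [simp del] split_paired_Ex [simp del]

definition fract2 :: "real \<times> real \<Rightarrow> real \<times> real" where
  "fract2 x = (frac (fst x), frac (snd x))"

definition periodic :: "(real \<times> real \<Rightarrow> 'a) \<Rightarrow> bool" where
  "periodic f \<longleftrightarrow> (\<forall>x. f (fract2 x) = f x)"

text \<open>The Borel version of the torus measure; \<open>torus\<close> is its completion. Almost everything is done
  with Borel functions, for which Fubini's theorem and measurability are unproblematic.\<close>

definition borel_torus :: "(real \<times> real) measure" where
  "borel_torus = restrict_space lborel torus_domain"

definition birkhoff :: "real \<times> real \<Rightarrow> (real \<times> real \<Rightarrow> real) \<Rightarrow> nat \<Rightarrow> real \<times> real \<Rightarrow> real" where
  "birkhoff a f n x = (\<Sum>k<n. f (x + real k *\<^sub>R a))"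

lemma frac_frac_add: "frac (frac u + v) = frac (u + v)" for u v :: real
proof -
  have eq: "u + v = (frac u + v) + of_int \<lfloor>u\<rfloor>" by (simp add: frac_def)
  have "\<lfloor>(frac u + v) + of_int \<lfloor>u\<rfloor>\<rfloor> = \<lfloor>frac u + v\<rfloor> + \<lfloor>u\<rfloor>" by simp
  then show ?thesis unfolding eq frac_def by simp
qed

lemma fract2_in_domain [simp]: "fract2 x \<in> torus_domain"
  by (simp add: fract2_def torus_domain_def frac_lt_1)

lemma fract2_id: "x \<in> torus_domain \<Longrightarrow> fract2 x = x"
  by (cases x) (auto simp: fract2_def torus_domain_def frac_eq)

lemma rotation_eq: "rotation a x = fract2 (x + a)"
  by (simp add: rotation_def fract2_def)

lemma fract2_add: "fract2 (fract2 x + a) = fract2 (x + a)"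
  by (simp add: fract2_def frac_frac_add)

lemma fract2_add_int: "fract2 (x + (of_int m, of_int n)) = fract2 x"
  by (simp add: fract2_def)

lemma fract2_measurable [measurable]: "fract2 \<in> borel_measurable borel"
  unfolding fract2_def frac_def by (simp add: borel_prod[symmetric])

lemma torus_domain_borel [measurable, simp]: "torus_domain \<in> sets borel"
  unfolding torus_domain_def by (simp add: borel_prod[symmetric])

lemma periodic_shift: "periodic f \<Longrightarrow> periodic (\<lambda>x. f (x + a))"
  unfolding periodic_def by (metis fract2_add)

lemma periodic_int: "periodic f \<Longrightarrow> f (x + (of_int m, of_int n)) = f x"
  unfolding periodic_def by (metis fract2_add_int)

lemma periodic_rotation: "periodic f \<Longrightarrow> f (rotation a x) = f (x + a)"
  by (metis periodic_def rotation_eq)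

lemma periodicI_int:
  assumes "\<And>x m n. f (x + (of_int m, of_int n)) = f x"
  shows "periodic f"
proof -
  have "fract2 x = x + (of_int (- \<lfloor>fst x\<rfloor>), of_int (- \<lfloor>snd x\<rfloor>))" for x :: "real \<times> real"
    by (cases x) (simp add: fract2_def frac_def)
  then show ?thesis unfolding periodic_def using assms by metis
qed

lemma emeasure_torus_domain: "emeasure lborel torus_domain = 1"
proof -
  have "emeasure (lborel \<Otimes>\<^sub>M lborel) ({0..<1::real} \<times> {0..<1::real}) = 1"
    by (subst lborel.emeasure_pair_measure_Times) auto
  then show ?thesis unfolding torus_domain_def lborel_prod .
qed

lemma space_borel_torus [simp]: "space borel_torus = torus_domain"
  by (simp add: borel_torus_def)

lemma emeasure_borel_torus: "emeasure borel_torus torus_domain = 1"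
  by (simp add: borel_torus_def emeasure_restrict_space emeasure_torus_domain)

interpretation borel_torus: finite_measure borel_torus
  by (rule finite_measureI) (simp add: emeasure_borel_torus)

lemma measure_borel_torus: "measure borel_torus torus_domain = 1"
  by (simp add: measure_def emeasure_borel_torus)

lemma measurable_borel_torus [measurable (raw)]: "f \<in> measurable borel M \<Longrightarrow> f \<in> measurable borel_torus M"
  unfolding borel_torus_def by (rule measurable_restrict_space1) simp

text \<open>A shifted fundamental domain is cut by the integer lattice into at most four pieces, which
  reassemble to the original domain; periodicity identifies the integrand on the pieces.\<close>

lemma nn_integral_shift_fract2:
  assumes [measurable]: "f \<in> borel_measurable borel" and f: "periodic (f :: _ \<Rightarrow> ennreal)"
  shows "(\<integral>\<^sup>+x. f (x + a) * indicator torus_domain x \<partial>lborel) = (\<integral>\<^sup>+x. f x * indicator torus_domain x \<partial>lborel)"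
proof -
  obtain a1 a2 where a: "a = (a1, a2)" by (cases a)
  \<comment> \<open>With the shift reduced to the fundamental domain, only the lattice points 0 and 1 in each coordinate matter.\<close>
  define b where "b = fract2 a"
  have fab: "f (x + a) = f (x + b)" for x
    using f unfolding periodic_def b_def by (metis add.commute fract2_add)
  have b: "b \<in> torus_domain" by (simp add: b_def)
  define I :: "(real\<times>real) set" where "I = {0,1} \<times> {0,1}"
  have fI: "finite I" by (simp add: I_def)
  have If: "f (x + p) = f x" if "p \<in> I" for p x
    using that periodic_int[OF f, of x] unfolding I_def
    by (auto simp: zero_prod_def dest: spec[of _ "1::int"])
      (metis of_int_0 of_int_1)+
  have sI: "sum g I = g (0,0) + g (0,1) + g (1,0) + g (1,1)" for g :: "real \<times> real \<Rightarrow> ennreal"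
    by (simp add: I_def insert_Times_insert add_ac)
  have s1: "(\<Sum>p\<in>I. indicator torus_domain (x - p) :: ennreal) = 1" if "x - b \<in> torus_domain" for x
    using that b unfolding sI torus_domain_def indicator_def
    by (cases x; cases b) auto
  have s2: "(\<Sum>p\<in>I. indicator torus_domain (x + p - b) :: ennreal) = 1" if "x \<in> torus_domain" for x
    using that b unfolding sI torus_domain_def indicator_def
    by (cases x; cases b) auto
  have shift: "(\<integral>\<^sup>+x. g (x + c) \<partial>lborel) = (\<integral>\<^sup>+x. g x \<partial>lborel)" if [measurable]: "g \<in> borel_measurable borel" 
    for g :: "real \<times> real \<Rightarrow> ennreal" and c
    by (subst (2) lborel_distr_plus[of c, symmetric]) (simp add: nn_integral_distr add.commute)
  have "(\<integral>\<^sup>+x. f (x + a) * indicator torus_domain x \<partial>lborel)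
      = (\<integral>\<^sup>+x. f (x + b) * indicator torus_domain (x + b - b) \<partial>lborel)"
    by (simp add: fab)
  also have "\<dots> = (\<integral>\<^sup>+x. f x * indicator torus_domain (x - b) \<partial>lborel)"
    by (rule shift[where g="\<lambda>x. f x * indicator torus_domain (x - b)"]) measurable
  also have "\<dots> = (\<integral>\<^sup>+x. (\<Sum>p\<in>I. f x * indicator torus_domain (x - b) * indicator torus_domain (x - p)) \<partial>lborel)"
    by (rule nn_integral_cong, subst sum_distrib_left[symmetric])
       (auto simp: indicator_def s1[unfolded indicator_def])
  also have "\<dots> = (\<Sum>p\<in>I. \<integral>\<^sup>+x. f x * indicator torus_domain (x - b) * indicator torus_domain (x - p) \<partial>lborel)"
    by (rule nn_integral_sum) measurable
  also have "\<dots> = (\<Sum>p\<in>I. \<integral>\<^sup>+x. f (x + p) * indicator torus_domain (x + p - b) * indicator torus_domain (x + p - p) \<partial>lborel)"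
    by (rule sum.cong, simp, rule shift[where g="\<lambda>x. f x * indicator torus_domain (x - b) * indicator torus_domain (x - p)" for p, symmetric]) measurable
  also have "\<dots> = (\<Sum>p\<in>I. \<integral>\<^sup>+x. f x * indicator torus_domain (x + p - b) * indicator torus_domain x \<partial>lborel)"
    by (rule sum.cong) (simp_all add: If)
  also have "\<dots> = (\<integral>\<^sup>+x. (\<Sum>p\<in>I. f x * indicator torus_domain (x + p - b) * indicator torus_domain x) \<partial>lborel)"
    by (rule nn_integral_sum[symmetric]) measurable
  also have "\<dots> = (\<integral>\<^sup>+x. f x * indicator torus_domain x \<partial>lborel)"
    by (rule nn_integral_cong, subst sum_distrib_right[symmetric], subst sum_distrib_left[symmetric])
       (auto simp: indicator_def s2[unfolded indicator_def])
  finally show ?thesis .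
qed

lemma rotation_measurable [measurable]: "rotation a \<in> measurable borel borel"
  unfolding rotation_eq[abs_def] by measurable

lemma rotation_measurable_borel_torus: "rotation a \<in> measurable borel_torus borel_torus"
  unfolding borel_torus_def
  by (rule measurable_restrict_space3) (auto simp: rotation_eq)

lemma distr_rotation: "distr borel_torus borel_torus (rotation a) = borel_torus"
proof (rule measure_eqI)
  fix A assume "A \<in> sets (distr borel_torus borel_torus (rotation a))"
  then have A: "A \<in> sets borel" "A \<subseteq> torus_domain" 
    by (auto simp: borel_torus_def sets_restrict_space)
  note [measurable] = A(1)
  have p: "periodic (\<lambda>x. indicator A (fract2 x) :: ennreal)"
    by (simp add: periodic_def fract2_id)
  have "emeasure (distr borel_torus borel_torus (rotation a)) A = (\<integral>\<^sup>+x. indicator A x \<partial>distr borel_torus borel_torus (rotation a))"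
    using A by (simp add: borel_torus_def sets_restrict_space_iff)
  also have "\<dots> = (\<integral>\<^sup>+x. indicator A (rotation a x) \<partial>borel_torus)"
    by (rule nn_integral_distr[OF rotation_measurable_borel_torus])
       (simp add: measurable_borel_torus)
  also have "\<dots> = (\<integral>\<^sup>+x. indicator A (fract2 (x + a)) * indicator torus_domain x \<partial>lborel)"
    unfolding borel_torus_def rotation_eq by (subst nn_integral_restrict_space) auto
  also have "\<dots> = (\<integral>\<^sup>+x. indicator A (fract2 x) * indicator torus_domain x \<partial>lborel)"
    by (rule nn_integral_shift_fract2[OF _ p]) measurable
  also have "\<dots> = (\<integral>\<^sup>+x. indicator A x \<partial>lborel)"
    by (rule nn_integral_cong) (use A in \<open>auto simp: indicator_def fract2_id\<close>)
  also have "\<dots> = emeasure borel_torus A"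
    using A by (simp add: borel_torus_def emeasure_restrict_space)
  finally show "emeasure (distr borel_torus borel_torus (rotation a)) A = emeasure borel_torus A" .
qed simp

lemma integral_shift:
  fixes f :: "real \<times> real \<Rightarrow> real"
  assumes [measurable]: "f \<in> borel_measurable borel" and "periodic f"
  shows "(\<integral>x. f (x + a) \<partial>borel_torus) = (\<integral>x. f x \<partial>borel_torus)"
proof -
  have "(\<integral>x. f x \<partial>distr borel_torus borel_torus (rotation a)) = (\<integral>x. f (rotation a x) \<partial>borel_torus)"
    by (rule integral_distr[OF rotation_measurable_borel_torus]) measurable
  then show ?thesis by (simp add: distr_rotation periodic_rotation[OF assms(2)])
qed

lemma AE_shift:
  assumes "AE x in lborel. P x"
  shows "AE x in lborel. P (x + a :: 'a :: euclidean_space)"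
proof -
  have "AE x in distr lborel borel ((+) a). P x" 
    unfolding lborel_distr_plus by (rule assms)
  then have "AE x in lborel. P (a + x)"
    by (rule AE_distrD[rotated]) simp
  then show ?thesis by (simp add: add.commute)
qed

lemma AE_coordinate_neq:
  fixes v :: real
  shows "AE x :: real \<times> real in lborel. fst x \<noteq> v" "AE x :: real \<times> real in lborel. snd x \<noteq> v"
proof -
  have *: "AE x in lborel. x \<bullet> k \<noteq> v" if "k \<in> Basis" for k :: "real \<times> real"
  proof -
    have "AE x in lebesgue. x \<notin> {x. x \<bullet> k = v}"
      using negligible_standard_hyperplane[OF that] by (intro AE_not_in) (simp add: negligible_iff_null_sets)
    then show ?thesis by (subst (asm) AE_completion_iff) simp
  qed
  show "AE x :: real \<times> real in lborel. fst x \<noteq> v" "AE x :: real \<times> real in lborel. snd x \<noteq> v"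
    using *[of "(1, 0)"] *[of "(0, 1)"] by (simp_all add: Basis_prod_def inner_prod_def)
qed

lemma AE_frac_notin:
  assumes "finite E"
  shows "AE x :: real \<times> real in lborel. frac (fst x + s) \<notin> E"
    and "AE x :: real \<times> real in lborel. frac (snd x + s) \<notin> E"
proof -
  have *: "AE x in lborel. frac (p x + s) \<notin> E"
    if p: "\<And>v. AE x in lborel. p x \<noteq> v" for p :: "real \<times> real \<Rightarrow> real"
  proof -
    have "AE x in lborel. \<forall>m::int. \<forall>e\<in>E. p x \<noteq> e + of_int m - s"
      unfolding AE_all_countable by (intro allI AE_finite_allI assms p)
    then show ?thesis
    proof eventually_elim
      case (elim x)
      have "frac (p x + s) \<noteq> e" if "e \<in> E" for e
        using elim[rule_format, OF that, of "\<lfloor>p x + s\<rfloor>"] by (auto simp: frac_def)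
      then show ?case by blast
    qed
  qed
  show "AE x :: real \<times> real in lborel. frac (fst x + s) \<notin> E"
    "AE x :: real \<times> real in lborel. frac (snd x + s) \<notin> E"
    by (intro * AE_coordinate_neq)+
qed

lemma AE_borel_torus_iff: "(AE x in borel_torus. P x) \<longleftrightarrow> (AE x in lborel. x \<in> torus_domain \<longrightarrow> P x)"
  unfolding borel_torus_def by (subst AE_restrict_space_iff) auto

lemma AE_borel_torus: "AE x in lborel. P x \<Longrightarrow> AE x in borel_torus. P x"
  unfolding AE_borel_torus_iff by (rule eventually_mono) auto

text \<open>A property of the point of the torus that holds almost everywhere there holds almost
  everywhere in the plane, the plane being a countable union of translates of the domain.\<close>

lemma AE_lborel_fract2:
  assumes "AE x in borel_torus. P x"
  shows "AE x in lborel. P (fract2 x)"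
proof -
  have "AE x in lborel. x \<in> torus_domain \<longrightarrow> P x" using assms by (simp add: AE_borel_torus_iff)
  then have "AE x in lborel. x + (of_int m, of_int n) \<in> torus_domain \<longrightarrow> P (x + (of_int m, of_int n))" for m n
    by (rule AE_shift)
  then have "AE x in lborel. \<forall>m n::int. x + (of_int m, of_int n) \<in> torus_domain \<longrightarrow> P (x + (of_int m, of_int n))"
    by (simp add: AE_all_countable)
  then show ?thesis
  proof eventually_elim
    case (elim x)
    have "fract2 x = x + (of_int (- \<lfloor>fst x\<rfloor>), of_int (- \<lfloor>snd x\<rfloor>))"
      by (cases x) (simp add: fract2_def frac_def)
    then show ?case using elim fract2_in_domain[of x] by metis
  qed
qed

lemma AE_lborel_periodic:
  assumes "AE x in borel_torus. P x" "periodic P"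
  shows "AE x in lborel. P x"
  by (rule eventually_mono[OF AE_lborel_fract2[OF assms(1)]]) (use assms(2) in \<open>metis periodic_def\<close>)

section \<open>Uniform equidistribution\<close>

definition dense_orbit :: "real \<times> real \<Rightarrow> bool" where
  "dense_orbit a \<longleftrightarrow> (\<forall>v. \<forall>\<delta>>0. \<exists>k m n :: int. dist (of_int k *\<^sub>R a + (of_int m, of_int n)) v < \<delta>)"

text \<open>By compactness of the torus, boundedly many steps of the rotation suffice to come close to any
  prescribed point.\<close>

lemma dense_orbit_uniform:
  assumes "dense_orbit a" "\<delta> > 0"
  obtains K :: nat where "\<And>v. \<exists>k m n :: int. \<bar>k\<bar> \<le> int K \<and> dist (of_int k *\<^sub>R a + (of_int m, of_int n)) v < \<delta>"
proof -
  define c where "c = (\<lambda>(k,m,n). of_int k *\<^sub>R a + (of_int m, of_int n) :: real \<times> real)"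
  have cov: "cbox (0,0) (1,1) \<subseteq> (\<Union>p\<in>UNIV. ball (c p) \<delta>)"
  proof
    fix v
    obtain k m n :: int where "dist (of_int k *\<^sub>R a + (of_int m, of_int n)) v < \<delta>"
      using assms unfolding dense_orbit_def by blast
    then show "v \<in> (\<Union>p\<in>UNIV. ball (c p) \<delta>)"
      by (intro UN_I[of "(k,m,n)"]) (auto simp: c_def)
  qed
  obtain P where P: "finite P" "cbox (0,0) (1,1) \<subseteq> (\<Union>p\<in>P. ball (c p) \<delta>)"
    by (rule compactE_image[OF compact_cbox, of UNIV "\<lambda>p. ball (c p) \<delta>" "(0,0)" "(1,1)"])
       (use cov in auto)
  define K where "K = Max (insert 0 ((\<lambda>(k,m,n). nat \<bar>k\<bar>) ` P))"
  have K: "nat \<bar>k\<bar> \<le> K" if "(k,m,n) \<in> P" for k m n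
    unfolding K_def using that P(1) by (intro Max_ge) (auto intro: image_eqI[of _ _ "(k,m,n)"])
  show ?thesis
  proof (rule that[of K])
    fix v :: "real \<times> real"
    have "fract2 v \<in> cbox (0,0) (1,1)"
      by (simp add: fract2_def cbox_Pair_eq frac_lt_1 less_imp_le)
    with P(2) obtain k m n where p: "(k,m,n) \<in> P" "dist (c (k,m,n)) (fract2 v) < \<delta>"
      by auto
    have "dist (of_int k *\<^sub>R a + (of_int (m + \<lfloor>fst v\<rfloor>), of_int (n + \<lfloor>snd v\<rfloor>))) v = dist (c (k,m,n)) (fract2 v)"
      unfolding dist_norm c_def by (rule arg_cong[of _ _ norm]) (cases v; cases a; simp add: fract2_def frac_def)
    then show "\<exists>k m n :: int. \<bar>k\<bar> \<le> int K \<and> dist (of_int k *\<^sub>R a + (of_int m, of_int n)) v < \<delta>"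
      using p K[OF p(1)] by (metis nat_le_iff)
  qed
qed

lemma birkhoff_Suc_shift: "birkhoff a f n (x + a) + f x = birkhoff a f n x + f (x + real n *\<^sub>R a)"
  by (induction n) (simp_all add: birkhoff_def algebra_simps)

lemma birkhoff_add: "birkhoff a f (m + n) x = birkhoff a f m x + birkhoff a f n (x + real m *\<^sub>R a)"
  by (induction n) (simp_all add: birkhoff_def algebra_simps)

text \<open>Birkhoff sums along the same orbit with different starting times share all but boundedly many
  summands.\<close>

lemma birkhoff_shift_nat:
  assumes "\<And>x. \<bar>f x\<bar> \<le> M"
  shows "\<bar>birkhoff a f n (x + real k *\<^sub>R a) - birkhoff a f n x\<bar> \<le> 2 * M * k"
proof (induction k)
  case (Suc k)
  have "birkhoff a f n (x + real (Suc k) *\<^sub>R a) - birkhoff a f n (x + real k *\<^sub>R a)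
      = f (x + real k *\<^sub>R a + real n *\<^sub>R a) - f (x + real k *\<^sub>R a)"
    using birkhoff_Suc_shift[of a f n "x + real k *\<^sub>R a"] by (simp add: algebra_simps)
  moreover have "\<bar>f (x + real k *\<^sub>R a + real n *\<^sub>R a) - f (x + real k *\<^sub>R a)\<bar> \<le> 2 * M"
    using assms[of "x + real k *\<^sub>R a + real n *\<^sub>R a"] assms[of "x + real k *\<^sub>R a"] by linarith
  ultimately show ?case using Suc by (simp add: algebra_simps)
qed simp

lemma birkhoff_shift_int:
  assumes "\<And>x. \<bar>f x\<bar> \<le> M" "\<bar>k\<bar> \<le> int K"
  shows "\<bar>birkhoff a f n (x + of_int k *\<^sub>R a) - birkhoff a f n x\<bar> \<le> 2 * M * K"
proof -
  have M: "M \<ge> 0" using assms(1)[of 0] by linarith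
  have "\<bar>birkhoff a f n (x + of_int k *\<^sub>R a) - birkhoff a f n x\<bar> \<le> 2 * M * nat \<bar>k\<bar>"
  proof (cases "k \<ge> 0")
    case True
    then show ?thesis using birkhoff_shift_nat[where f=f and M=M and a=a and n=n and x=x and k="nat k"] assms(1) by simp
  next
    case False
    then show ?thesis using birkhoff_shift_nat[where f=f and M=M and a=a and n=n and x="x + of_int k *\<^sub>R a" and k="nat (-k)"] assms(1)
      by (simp add: abs_minus_commute)
  qed
  also have "\<dots> \<le> 2 * M * K" using M assms(2) by (intro mult_left_mono) auto
  finally show ?thesis .
qed

lemma periodic_birkhoff: "periodic f \<Longrightarrow> periodic (birkhoff a f n)"
  unfolding periodic_def birkhoff_def 
  by (intro allI sum.cong refl) (metis periodic_def periodic_shift)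

lemma shift_measurable:
  "f \<in> measurable borel M \<Longrightarrow> (\<lambda>x. f (x + a :: 'a :: real_normed_vector)) \<in> measurable borel M"
  by (rule measurable_compose[rotated], assumption)
     (intro borel_measurable_continuous_onI continuous_intros)

lemma birkhoff_measurable [measurable]:
  "f \<in> borel_measurable borel \<Longrightarrow> birkhoff a f n \<in> borel_measurable borel"
  unfolding birkhoff_def by (intro borel_measurable_sum shift_measurable)

lemma integrable_borel_torus_bounded:
  assumes "f \<in> borel_measurable borel" "\<And>x. \<bar>f x :: real\<bar> \<le> M"
  shows "integrable borel_torus f"
  by (rule borel_torus.integrable_const_bound[of _ M]) (use assms in auto)

lemma integral_birkhoff:
  fixes f :: "real \<times> real \<Rightarrow> real"
  assumes [measurable]: "f \<in> borel_measurable borel" and "periodic f" "\<And>x. \<bar>f x\<bar> \<le> M"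
  shows "(\<integral>x. birkhoff a f n x \<partial>borel_torus) = real n * (\<integral>x. f x \<partial>borel_torus)"
proof -
  have "(\<integral>x. birkhoff a f n x \<partial>borel_torus) = (\<Sum>k<n. \<integral>x. f (x + real k *\<^sub>R a) \<partial>borel_torus)"
    unfolding birkhoff_def
    by (rule Bochner_Integration.integral_sum) (rule integrable_borel_torus_bounded[of _ M], use assms(3) shift_measurable[OF assms(1)] in auto)
  then show ?thesis using integral_shift[OF assms(1,2)] by simp
qed

text \<open>The supremum over open balls is lower semicontinuous, hence Borel, for every bounded function,
  and it decreases to the function at points of continuity.\<close>

definition upper_envelope :: "real \<Rightarrow> (real \<times> real \<Rightarrow> real) \<Rightarrow> real \<times> real \<Rightarrow> real" where
  "upper_envelope \<delta> f x = (SUP y\<in>ball x \<delta>. f y)"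

context
  fixes f :: "real \<times> real \<Rightarrow> real" and M
  assumes bounded: "\<And>x. \<bar>f x\<bar> \<le> M"
begin

lemma bdd_above_image: "bdd_above (f ` S)"
  by (rule bdd_aboveI[of _ M]) (use bounded in \<open>auto simp: abs_le_iff\<close>)

lemma upper_envelope_ge: "dist x y < \<delta> \<Longrightarrow> f y \<le> upper_envelope \<delta> f x"
  unfolding upper_envelope_def by (rule cSUP_upper[OF _ bdd_above_image]) auto

lemma upper_envelope_le: "\<delta> > 0 \<Longrightarrow> (\<And>y. dist x y < \<delta> \<Longrightarrow> f y \<le> c) \<Longrightarrow> upper_envelope \<delta> f x \<le> c"
  unfolding upper_envelope_def by (rule cSUP_least) auto

lemma upper_envelope_bounded: "\<delta> > 0 \<Longrightarrow> \<bar>upper_envelope \<delta> f x\<bar> \<le> M"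
  using upper_envelope_ge[of x x \<delta>] upper_envelope_le[of \<delta> x M] bounded
  by (smt (verit) dist_self)

lemma upper_envelope_measurable [measurable]:
  assumes "\<delta> > 0" shows "upper_envelope \<delta> f \<in> borel_measurable borel"
proof (rule borel_measurableI_greater)
  fix c
  have "open {x. c < upper_envelope \<delta> f x}"
  proof -
    have "{x. c < upper_envelope \<delta> f x} = (\<Union>y\<in>{y. c < f y}. ball y \<delta>)"
      using assms unfolding upper_envelope_def 
      by (auto simp: less_cSUP_iff[OF _ bdd_above_image] dist_commute)
    then show ?thesis by auto
  qed
  then show "{x \<in> space borel. c < upper_envelope \<delta> f x} \<in> sets borel" by simp
qed

lemma upper_envelope_periodic:
  assumes "periodic f" shows "periodic (upper_envelope \<delta> f)"
proof (rule periodicI_int)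
  fix x m n
  define p :: "real \<times> real" where "p = (of_int m, of_int n)"
  have "ball (x + p) \<delta> = (+) p ` ball x \<delta>"
    using ball_translation[of p x \<delta>] by (simp only: add.commute)
  then have "f ` ball (x + p) \<delta> = f ` ball x \<delta>"
    using periodic_int[OF assms, of _ m n] by (auto simp: image_image p_def add.commute[of "(_,_)"])
  then show "upper_envelope \<delta> f (x + (of_int m, of_int n)) = upper_envelope \<delta> f x"
    unfolding upper_envelope_def p_def by simp
qed

lemma upper_envelope_tendsto:
  assumes "isCont f x"
  shows "(\<lambda>i. upper_envelope (1 / Suc i) f x) \<longlonglongrightarrow> f x"
proof (rule LIMSEQ_I)
  fix r :: real assume "r > 0"
  then obtain d where d: "d > 0" "\<And>y. dist x y < d \<Longrightarrow> \<bar>f y - f x\<bar> < r/2"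
    using assms unfolding continuous_at_eps_delta
    by (metis dist_commute dist_real_def half_gt_zero)
  obtain N where N: "1 / Suc N < d" using d(1) nat_approx_posE by blast
  have "norm (upper_envelope (1 / Suc i) f x - f x) < r" if "i \<ge> N" for i
  proof -
    have "1 / Suc i \<le> 1 / real (Suc N)" using that by (simp add: frac_le)
    with N have "1 / Suc i < d" by simp
    have "f y \<le> f x + r/2" if "dist x y < 1 / Suc i" for y
      using d(2)[of y] that \<open>1 / Suc i < d\<close> by linarith
    then have "upper_envelope (1 / Suc i) f x \<le> f x + r/2"
      by (intro upper_envelope_le) auto
    moreover have "upper_envelope (1 / Suc i) f x \<ge> f x" by (rule upper_envelope_ge) simp
    ultimately show ?thesis using \<open>r > 0\<close> by simp
  qed
  then show "\<exists>no. \<forall>n\<ge>no. norm (upper_envelope (1 / real (Suc n)) f x - f x) < r" by blast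
qed

text \<open>The heart of equidistribution. From any \<open>x\<close>, boundedly many steps of the rotation lead
  \<open>\<delta>\<close>-close to \<open>y\<close>, so the Birkhoff sum of \<open>f\<close> at \<open>y\<close> exceeds that of the envelope at \<open>x\<close> by a
  bounded amount. Averaging over \<open>x\<close> replaces the latter by \<open>n\<close> times the integral.\<close>

lemma birkhoff_le_upper_envelope:
  assumes "periodic f" "dense_orbit a" "\<delta> > 0"
  shows "\<exists>C. \<forall>n y. birkhoff a f n y \<le> real n * (\<integral>x. upper_envelope \<delta> f x \<partial>borel_torus) + C"
proof -
  obtain K where K: "\<And>v. \<exists>k m n :: int. \<bar>k\<bar> \<le> int K \<and> dist (of_int k *\<^sub>R a + (of_int m, of_int n)) v < \<delta>"
    using dense_orbit_uniform[OF assms(2,3)] by blast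
  let ?g = "upper_envelope \<delta> f"
  note g = upper_envelope_bounded[OF assms(3)] upper_envelope_measurable[OF assms(3)] upper_envelope_periodic[OF assms(1)]
  have *: "birkhoff a f n y \<le> birkhoff a ?g n x + 2 * M * K" for n x y
  proof -
    obtain k p q :: int where k: "\<bar>k\<bar> \<le> int K" "dist (of_int k *\<^sub>R a + (of_int p, of_int q)) (y - x) < \<delta>"
      using K by blast
    have "f (y + real i *\<^sub>R a) \<le> ?g (x + of_int k *\<^sub>R a + real i *\<^sub>R a)" for i
    proof -
      have "f (y + real i *\<^sub>R a) \<le> ?g ((x + of_int k *\<^sub>R a + real i *\<^sub>R a) + (of_int p, of_int q))"
        by (rule upper_envelope_ge) (use k(2) in \<open>simp add: dist_norm algebra_simps\<close>)
      then show ?thesis using periodic_int[OF g(3)] by simp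
    qed
    then have "birkhoff a f n y \<le> birkhoff a ?g n (x + of_int k *\<^sub>R a)"
      unfolding birkhoff_def by (rule sum_mono)
    also have "\<dots> \<le> birkhoff a ?g n x + 2 * M * K"
      using birkhoff_shift_int[where f="?g" and M=M and a=a and n=n and x=x, OF g(1) k(1)] by (simp add: abs_le_iff)
    finally show ?thesis .
  qed
  have bb: "\<bar>birkhoff a ?g n x\<bar> \<le> real n * M" for n x
  proof -
    have "\<bar>birkhoff a ?g n x\<bar> \<le> (\<Sum>k<n. M)" unfolding birkhoff_def 
      by (rule order_trans[OF sum_abs sum_mono]) (rule g(1))
    then show ?thesis by simp
  qed
  have "birkhoff a f n y \<le> real n * (\<integral>x. ?g x \<partial>borel_torus) + 2 * M * K" for n y
  proof -
    have i: "integrable borel_torus (birkhoff a ?g n)"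
      by (rule integrable_borel_torus_bounded[OF birkhoff_measurable[OF g(2)] bb])
    have "(\<integral>x. birkhoff a f n y \<partial>borel_torus) \<le> (\<integral>x. birkhoff a ?g n x + 2 * M * K \<partial>borel_torus)"
      by (rule integral_mono) (auto intro: i *)
    also have "\<dots> = (\<integral>x. birkhoff a ?g n x \<partial>borel_torus) + (\<integral>x. 2 * M * K \<partial>borel_torus)"
      by (rule Bochner_Integration.integral_add[OF i]) simp
    finally show ?thesis by (simp add: integral_birkhoff[OF g(2,3,1)] measure_borel_torus)
  qed
  then show ?thesis by blast
qed

lemma equidistribution_upper:
  assumes [measurable]: "f \<in> borel_measurable borel" and "periodic f" "AE x in lborel. isCont f x"
    and "dense_orbit a" "\<epsilon> > 0"
  shows "\<exists>n0. \<forall>n\<ge>n0. \<forall>y. birkhoff a f n y \<le> real n * ((\<integral>x. f x \<partial>borel_torus) + \<epsilon>)"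
proof -
  have "(\<lambda>i. \<integral>x. upper_envelope (1 / Suc i) f x \<partial>borel_torus) \<longlonglongrightarrow> (\<integral>x. f x \<partial>borel_torus)"
  proof (rule integral_dominated_convergence[where w="\<lambda>_. M"])
    show "AE x in borel_torus. (\<lambda>i. upper_envelope (1 / Suc i) f x) \<longlonglongrightarrow> f x"
      using AE_borel_torus[OF assms(3)] by eventually_elim (rule upper_envelope_tendsto)
  qed (use upper_envelope_bounded in auto)
  then have "eventually (\<lambda>i. (\<integral>x. upper_envelope (1 / Suc i) f x \<partial>borel_torus) < (\<integral>x. f x \<partial>borel_torus) + \<epsilon>/2) sequentially"
    by (rule order_tendstoD) (use assms in auto)
  then obtain i where i: "(\<integral>x. upper_envelope (1 / Suc i) f x \<partial>borel_torus) < (\<integral>x. f x \<partial>borel_torus) + \<epsilon>/2"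
    by (auto simp: eventually_sequentially)
  obtain C where C: "\<And>n y. birkhoff a f n y \<le> real n * (\<integral>x. upper_envelope (1 / Suc i) f x \<partial>borel_torus) + C"
    using birkhoff_le_upper_envelope[OF assms(2,4), of "1 / Suc i"] by auto
  obtain n0 :: nat where n0: "C / (\<epsilon>/2) \<le> n0" using real_arch_simple by blast
  have "birkhoff a f n y \<le> real n * ((\<integral>x. f x \<partial>borel_torus) + \<epsilon>)" if "n \<ge> n0" for n y
  proof -
    have "C / (\<epsilon>/2) \<le> real n" using n0 that by linarith
    then have "C \<le> real n * (\<epsilon>/2)" using assms(5) by (simp add: field_simps)
    moreover have "real n * (\<integral>x. upper_envelope (1 / Suc i) f x \<partial>borel_torus) \<le> real n * ((\<integral>x. f x \<partial>borel_torus) + \<epsilon>/2)"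
      using i by (intro mult_left_mono) auto
    ultimately show ?thesis using C[of n y] by (simp add: algebra_simps)
  qed
  then show ?thesis by blast
qed

end

text \<open>Weyl's theorem for Riemann integrable functions, in a form uniform in the starting point. It
  is used for the cocycle and for its horizontal derivative.\<close>

theorem equidistribution:
  fixes f :: "real \<times> real \<Rightarrow> real"
  assumes [measurable]: "f \<in> borel_measurable borel" and "\<And>x. \<bar>f x\<bar> \<le> M" "periodic f" 
    and "AE x in lborel. isCont f x" "dense_orbit a" "\<epsilon> > 0"
  shows "\<exists>n0. \<forall>n\<ge>n0. \<forall>y. \<bar>birkhoff a f n y - real n * (\<integral>x. f x \<partial>borel_torus)\<bar> \<le> real n * \<epsilon>"
proof -
  obtain n1 where n1: "\<And>n y. n\<ge>n1 \<Longrightarrow> birkhoff a f n y \<le> real n * ((\<integral>x. f x \<partial>borel_torus) + \<epsilon>)"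
    using equidistribution_upper[of f M a \<epsilon>] assms by blast
  have "AE x in lborel. isCont (\<lambda>x. - f x) x" using assms(4) by eventually_elim simp
  moreover have "periodic (\<lambda>x. - f x)" using assms(3) by (simp only: periodic_def) blast
  ultimately obtain n2 where n2: "\<And>n y. n\<ge>n2 \<Longrightarrow> birkhoff a (\<lambda>x. - f x) n y \<le> real n * ((\<integral>x. - f x \<partial>borel_torus) + \<epsilon>)"
    using equidistribution_upper[of "\<lambda>x. - f x" M a \<epsilon>] assms by (metis abs_minus_cancel borel_measurable_uminus)
  have "\<bar>birkhoff a f n y - real n * (\<integral>x. f x \<partial>borel_torus)\<bar> \<le> real n * \<epsilon>" if "n \<ge> max n1 n2" for n y
    using n1[of n y] n2[of n y] that by (simp add: birkhoff_def sum_negf algebra_simps abs_le_iff)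
  then show ?thesis by blast
qed

section \<open>Density of orbits and recurrence\<close>

text \<open>Kronecker's theorem for the numbers \<open>\<alpha>\<^sub>1, \<alpha>\<^sub>2, 1\<close>.\<close>

lemma totally_irrational_imp_dense_orbit:
  assumes "totally_irrational \<alpha>"
  shows "dense_orbit \<alpha>"
proof -
  interpret M: Modules.module "(\<lambda>r x. of_int r * x) :: int \<Rightarrow> real \<Rightarrow> real"
    by (simp add: Modules.module.intro distrib_left distrib_right mult.commute)
  have irr: "a = 0 \<and> b = 0 \<and> c = 0" if "of_int a + of_int b * fst \<alpha> + of_int c * snd \<alpha> = 0" for a b c :: int
    using assms[unfolded totally_irrational_def, rule_format, of "of_int a" "of_int b" "of_int c"] that by simp
  define \<theta> :: "nat \<Rightarrow> real" where "\<theta> i = (if i = 0 then fst \<alpha> else if i = 1 then snd \<alpha> else 1)" for i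
  have "fst \<alpha> \<noteq> snd \<alpha>" "fst \<alpha> \<noteq> 1" "snd \<alpha> \<noteq> 1"
    using irr[of 0 1 "-1"] irr[of 1 "-1" 0] irr[of 1 0 "-1"] by auto
  note ne = this this[symmetric]
  have at2: "{..2::nat} = {0,1,2}" by auto
  have inj: "inj_on \<theta> {..2}"
    unfolding at2 by (auto simp: inj_on_def \<theta>_def ne)
  have "M.independent (\<theta> ` {..2})"
  proof -
    have fin: "finite (\<theta> ` {..2})" by simp
    have "u v = 0" if u: "(\<Sum>v\<in>\<theta> ` {..2}. of_int (u v) * v) = 0" and v: "v \<in> \<theta> ` {..2}" for u v
    proof -
      have "(\<Sum>i\<in>{..2}. of_int (u (\<theta> i)) * \<theta> i) = 0"
        using u by (simp add: sum.reindex[OF inj])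
      then have "of_int (u 1) + of_int (u (fst \<alpha>)) * fst \<alpha> + of_int (u (snd \<alpha>)) * snd \<alpha> = 0"
        unfolding at2 by (simp add: \<theta>_def ne algebra_simps)
      from irr[OF this] v show "u v = 0" by (auto simp: at2 \<theta>_def)
    qed
    then show ?thesis
      using M.dependent_finite[OF fin] by metis
  qed
  then have *: "\<exists>k m. \<forall>i<2. \<bar>of_int k * \<theta> i - of_int (m i) - w i\<bar> < \<epsilon>" if "\<epsilon> > 0" for w \<epsilon>
    using Kronecker_thm_2[of \<theta> 2 \<epsilon> w] inj that by (metis \<theta>_def one_neq_zero zero_neq_numeral numeral_eq_one_iff semiring_norm(85))
  show ?thesis unfolding dense_orbit_def
  proof (intro allI impI)
    fix v :: "real \<times> real" and \<delta> :: real assume "\<delta> > 0"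
    then obtain k m where km: "\<forall>i<2. \<bar>of_int k * \<theta> i - of_int (m i) - (if i = 0 then fst v else snd v)\<bar> < \<delta>/2"
      using *[of "\<delta>/2" "\<lambda>i. if i = 0 then fst v else snd v"] by auto
    have "\<bar>of_int k * fst \<alpha> - of_int (m 0) - fst v\<bar> < \<delta>/2" "\<bar>of_int k * snd \<alpha> - of_int (m 1) - snd v\<bar> < \<delta>/2"
      using km[rule_format, of 0] km[rule_format, of 1] by (auto simp: \<theta>_def)
    moreover have "dist (of_int k *\<^sub>R \<alpha> + (of_int (- m 0), of_int (- m 1))) v 
      \<le> \<bar>of_int k * fst \<alpha> - of_int (m 0) - fst v\<bar> + \<bar>of_int k * snd \<alpha> - of_int (m 1) - snd v\<bar>"
      using sqrt_sum_squares_le_sum_abs by (cases \<alpha>; cases v) (simp add: dist_Pair_Pair dist_real_def)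
    ultimately show "\<exists>k m n :: int. dist (of_int k *\<^sub>R \<alpha> + (of_int m, of_int n)) v < \<delta>"
      by (intro exI[of _ k] exI[of _ "- m 0"] exI[of _ "- m 1"]) linarith
  qed
qed

lemma card_le_of_separated:
  fixes v :: "'a \<Rightarrow> real"
  assumes "finite S" "\<And>i j. i \<in> S \<Longrightarrow> j \<in> S \<Longrightarrow> i \<noteq> j \<Longrightarrow> \<bar>v i - v j\<bar> > 1" "\<And>i. i \<in> S \<Longrightarrow> \<bar>v i\<bar> \<le> R" "R \<ge> 0"
  shows "real (card S) \<le> 2 * R + 2"
proof -
  have "inj_on (\<lambda>i. \<lfloor>v i\<rfloor>) S"
  proof (rule inj_onI, rule ccontr)
    fix i j assume "i \<in> S" "j \<in> S" "\<lfloor>v i\<rfloor> = \<lfloor>v j\<rfloor>" "i \<noteq> j"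
    then show False using assms(2)[of i j] by linarith
  qed
  moreover have "(\<lambda>i. \<lfloor>v i\<rfloor>) ` S \<subseteq> {\<lfloor>-R\<rfloor>..\<lfloor>R\<rfloor>}"
    using assms(3) by (force intro!: floor_mono simp: abs_le_iff)
  ultimately have "card S \<le> card {\<lfloor>-R\<rfloor>..\<lfloor>R\<rfloor>}"
    by (intro card_inj_on_le) auto
  then show ?thesis using assms(4) by simp linarith
qed

text \<open>Suppose the set of points of \<open>B\<close> that do not return to \<open>B\<close> at any time \<open>n \<ge> m\<close> with a
  Birkhoff sum of absolute value at most 1 has measure \<open>\<mu> > 0\<close>. A point \<open>y\<close> that is reached from this set at several times \<open>j m\<close>, \<open>j < J\<close>,
  yields as many Birkhoff sums, pairwise more than 1 apart by the cocycle identity, and all bounded by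
  a quantity \<open>o(J)\<close>. The number of such times has average \<open>J \<mu>\<close> over \<open>y\<close>, a contradiction for
  large \<open>J\<close>.\<close>

theorem recurrence:
  fixes \<Phi> :: "real \<times> real \<Rightarrow> real"
  assumes [measurable]: "\<Phi> \<in> borel_measurable borel" and bounded: "\<And>x. \<bar>\<Phi> x\<bar> \<le> M" and "periodic \<Phi>"
    and sublinear: "\<And>\<delta>. \<delta> > 0 \<Longrightarrow> \<exists>n0. \<forall>n\<ge>n0. \<forall>y. \<bar>birkhoff a \<Phi> n y\<bar> \<le> real n * \<delta>"
    and B[measurable]: "Measurable.pred borel B" and "periodic B"
  shows "AE x in lborel. B x \<longrightarrow> (\<forall>m. \<exists>n\<ge>m. B (x + real n *\<^sub>R a) \<and> \<bar>birkhoff a \<Phi> n x\<bar> \<le> 1)"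
proof -
  have "AE x in lborel. \<not> (B x \<and> (\<forall>n\<ge>m. B (x + real n *\<^sub>R a) \<longrightarrow> \<bar>birkhoff a \<Phi> n x\<bar> > 1))" if m: "m \<ge> 1" for m :: nat
  proof -
    define Bad where "Bad x \<longleftrightarrow> B x \<and> (\<forall>n\<ge>m. B (x + real n *\<^sub>R a) \<longrightarrow> \<bar>birkhoff a \<Phi> n x\<bar> > 1)" for x
    note [measurable] = shift_measurable[OF B]
    have Bad[measurable]: "Measurable.pred borel Bad"
      unfolding Bad_def[abs_def] by measurable
    have pBad: "periodic Bad"
      using \<open>periodic B\<close> periodic_birkhoff[OF \<open>periodic \<Phi>\<close>] periodic_shift[OF \<open>periodic B\<close>]
      unfolding periodic_def Bad_def by metis
    define f where "f x = (indicator {x. Bad x} x :: real)" for x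
    have [measurable]: "f \<in> borel_measurable borel"
      unfolding f_def[abs_def] by measurable
    have f: "f \<in> borel_measurable borel" "periodic f" "\<bar>f x\<bar> \<le> 1" for x
      using pBad by (auto simp: f_def periodic_def indicator_def) 
    define \<mu> where "\<mu> = (\<integral>x. f x \<partial>borel_torus)"
    have M: "M \<ge> 0" using bounded[of 0] by linarith
    have main: "real J * \<mu> \<le> 2 * (real n0 * M + real J * real m * \<delta>) + 2"
      if n0: "\<And>n y. n \<ge> n0 \<Longrightarrow> \<bar>birkhoff a \<Phi> n y\<bar> \<le> real n * \<delta>" and "\<delta> > 0" for J n0 \<delta>
    proof -
      have bir: "\<bar>birkhoff a \<Phi> n y\<bar> \<le> real n0 * M + real n * \<delta>" for n y
      proof (cases "n \<ge> n0")
        case True then show ?thesis using n0[of n y] M mult_nonneg_nonneg[of "real n0" M] by linarith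
      next
        case False
        have "\<bar>birkhoff a \<Phi> n y\<bar> \<le> (\<Sum>k<n. M)" unfolding birkhoff_def
          by (rule order_trans[OF sum_abs sum_mono]) (rule bounded)
        also have "\<dots> \<le> real n0 * M" using False M by (simp add: mult_right_mono)
        finally show ?thesis using \<open>\<delta> > 0\<close> by (simp add: add_increasing2)
      qed
      \<comment> \<open>\<open>R\<close> bounds all Birkhoff sums of length at most \<open>J m\<close>: the first term covers the lengths below \<open>n0\<close>.\<close>
      define R where "R = real n0 * M + real J * real m * \<delta>"
      have pt: "(\<Sum>j<J. f (y + real j *\<^sub>R (- real m *\<^sub>R a))) \<le> 2 * R + 2" for y
      proof -
        define S where "S = {j. j < J \<and> Bad (y + real j *\<^sub>R (- real m *\<^sub>R a))}"
        \<comment> \<open>All these sums end at \<open>y\<close>; they start at the points of the backward orbit of \<open>y\<close> under \<open>m a\<close>.\<close>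
        define v where "v j = birkhoff a \<Phi> (j * m) (y + real j *\<^sub>R (- real m *\<^sub>R a))" for j
        have sep: "\<bar>v i - v j\<bar> > 1" if ij: "i \<in> S" "j \<in> S" "i < j" for i j
        proof -
          define x where "x = y + real j *\<^sub>R (- real m *\<^sub>R a)"
          have x: "x + real ((j - i) * m) *\<^sub>R a = y + real i *\<^sub>R (- real m *\<^sub>R a)"
            using \<open>i < j\<close> by (simp add: x_def of_nat_diff algebra_simps)
          have "Bad x" "B (x + real ((j - i) * m) *\<^sub>R a)"
            using ij unfolding x by (auto simp: S_def x_def Bad_def)
          moreover have "(j - i) * m \<ge> m" using \<open>i < j\<close> by (cases "j - i") auto
          ultimately have "\<bar>birkhoff a \<Phi> ((j - i) * m) x\<bar> > 1"
            unfolding Bad_def by blast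
          moreover have "v j = birkhoff a \<Phi> ((j - i) * m + i * m) x"
            using \<open>i < j\<close> by (simp add: v_def x_def distrib_right[symmetric])
          then have "v j = birkhoff a \<Phi> ((j - i) * m) x + v i"
            unfolding birkhoff_add x by (simp add: v_def)
          ultimately show ?thesis by linarith
        qed
        have "real (card S) \<le> 2 * R + 2"
        proof (rule card_le_of_separated[where v=v])
          show "\<bar>v i - v j\<bar> > 1" if "i \<in> S" "j \<in> S" "i \<noteq> j" for i j
            using sep[of i j] sep[of j i] that by (metis abs_minus_commute linorder_neqE_nat)
          show "\<bar>v i\<bar> \<le> R" if "i \<in> S" for i
          proof -
            have "real i * real m * \<delta> \<le> real J * real m * \<delta>"
              using that \<open>\<delta> > 0\<close> by (intro mult_right_mono) (auto simp: S_def)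
            then show ?thesis 
              using bir[of "i * m" "y + real i *\<^sub>R (- real m *\<^sub>R a)"] unfolding v_def R_def by simp
          qed
          show "R \<ge> 0" unfolding R_def using M \<open>\<delta> > 0\<close> by simp
        qed (simp add: S_def)
        moreover have "(\<Sum>j<J. f (y + real j *\<^sub>R (- real m *\<^sub>R a))) = real (card S)"
          unfolding f_def S_def indicator_def by (simp add: sum.If_cases Int_def)
        ultimately show ?thesis by simp
      qed
      have "(\<integral>y. birkhoff (- real m *\<^sub>R a) f J y \<partial>borel_torus) \<le> (\<integral>y. 2 * R + 2 \<partial>borel_torus)"
      proof (rule integral_mono)
        have "\<bar>birkhoff (- real m *\<^sub>R a) f J y\<bar> \<le> (\<Sum>k<J. 1)" for y unfolding birkhoff_def
          by (rule order_trans[OF sum_abs sum_mono]) (rule f)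
        then show "integrable borel_torus (birkhoff (- real m *\<^sub>R a) f J)"
          by (intro integrable_borel_torus_bounded[OF birkhoff_measurable[OF f(1)]])
        show "birkhoff (- real m *\<^sub>R a) f J y \<le> 2 * R + 2" for y
          using pt[of y] unfolding birkhoff_def .
      qed simp
      then show ?thesis
        using integral_birkhoff[OF f] by (simp add: measure_borel_torus R_def \<mu>_def)
    qed
    have small: "\<mu> \<le> 3 * real m * \<delta>" if \<delta>: "\<delta> > 0" for \<delta>
    proof -
      obtain n0 where n0: "\<And>n y. n \<ge> n0 \<Longrightarrow> \<bar>birkhoff a \<Phi> n y\<bar> \<le> real n * \<delta>"
        using sublinear[OF \<delta>] by blast
      obtain J0 :: nat where J0: "(2 * (real n0 * M) + 2) / (real m * \<delta>) \<le> real J0"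
        using real_arch_simple by blast
      define J where "J = max 1 J0"
      have J: "(2 * (real n0 * M) + 2) / (real m * \<delta>) \<le> real J" "J \<ge> 1"
        using J0 by (auto simp: J_def)
      have "2 * (real n0 * M) + 2 \<le> real J * (real m * \<delta>)"
        using J m \<delta> by (simp add: pos_divide_le_eq)
      moreover have "real J * \<mu> \<le> 2 * (real n0 * M + real J * real m * \<delta>) + 2"
        by (rule main[OF _ \<delta>]) (rule n0)
      ultimately have "real J * \<mu> \<le> real J * (3 * real m * \<delta>)"
        by (simp add: algebra_simps)
      then show ?thesis using J(2) by simp
    qed
    have "\<mu> \<le> 0"
    proof (rule field_le_epsilon)
      fix e :: real assume "e > 0"
      then show "\<mu> \<le> 0 + e" using small[of "e / (3 * real m)"] m by simp
    qed
    moreover have i: "integrable borel_torus f" by (rule integrable_borel_torus_bounded[OF f(1,3)])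
    moreover have "\<mu> \<ge> 0" unfolding \<mu>_def by (simp add: f_def)
    ultimately have "AE x in borel_torus. f x = 0"
      unfolding \<mu>_def by (subst integral_nonneg_eq_0_iff_AE[symmetric]) (auto simp: f_def)
    then have "AE x in borel_torus. \<not> Bad x" by eventually_elim (simp add: f_def indicator_def split: if_splits)
    moreover have "periodic (\<lambda>x. \<not> Bad x)" using pBad by (simp add: periodic_def)
    ultimately show ?thesis using AE_lborel_periodic unfolding Bad_def by blast
  qed
  then have "AE x in lborel. \<forall>m\<in>{1..}. \<not> (B x \<and> (\<forall>n\<ge>m. B (x + real n *\<^sub>R a) \<longrightarrow> \<bar>birkhoff a \<Phi> n x\<bar> > 1))"
    by (subst AE_ball_countable) auto
  then show ?thesis
  proof eventually_elim
    case (elim x)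
    show ?case
    proof (intro impI allI)
      fix m assume "B x"
      with elim[rule_format, of "max 1 m"] obtain n where "n \<ge> max 1 m" "B (x + real n *\<^sub>R a)" "\<bar>birkhoff a \<Phi> n x\<bar> \<le> 1"
        by (auto simp: not_less)
      then show "\<exists>n\<ge>m. B (x + real n *\<^sub>R a) \<and> \<bar>birkhoff a \<Phi> n x\<bar> \<le> 1" by auto
    qed
  qed
qed

section \<open>Approximate continuity along horizontal lines\<close>

lemma fmeasurable_interval: "{a..b :: real} \<in> fmeasurable lborel"
  by (rule fmeasurableI) (auto simp: emeasure_bounded_finite[unfolded infinity_ennreal_def])

text \<open>Lebesgue's differentiation theorem for the indicator function of the complement of \<open>A\<close>, with
  windows to the right of the point and of length \<open>c/n\<close>, the scale on which Birkhoff sums of length \<open>n\<close>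
  are sheared.\<close>

lemma density_real:
  fixes A :: "real set"
  assumes [measurable]: "A \<in> sets borel" and "\<eta> > 0" "c > 0"
  shows "AE t in lborel. t \<in> A \<longrightarrow> (\<exists>m. \<forall>n\<ge>m. measure lborel {u. 0 < u \<and> u < c / real n \<and> t + u \<notin> A} \<le> \<eta> * (c / real n))"
proof -
  define f where "f = (indicator (- A) :: real \<Rightarrow> real)"
  have int: "f integrable_on cbox a b" for a b
    unfolding f_def
    by (rule set_borel_integral_eq_integral(1)[unfolded set_integrable_def])
       (rule integrableI_bounded_set_indicator[where B=1];
        use emeasure_bounded_finite[OF bounded_cbox[of a b]] in \<open>auto simp: indicator_def\<close>)
  obtain N where N: "negligible N" 
    and lim: "\<And>x e. \<lbrakk>x \<notin> N; 0 < e\<rbrakk> \<Longrightarrow> \<exists>d>0. \<forall>h. 0 < h \<and> h < d \<longrightarrow>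
       norm (integral (cbox x (x + h *\<^sub>R One)) f /\<^sub>R h ^ DIM(real) - f x) < e"
    using integrable_ccontinuous_explicit[of f] int by metis
  have "N \<in> null_sets lebesgue" using N by (simp add: negligible_iff_null_sets)
  then have "AE t in lebesgue. t \<notin> N" by (rule AE_not_in)
  then have "AE t in lborel. t \<notin> N" by (rule AE_completion_iff[THEN iffD1])
  then show ?thesis
  proof eventually_elim
    case (elim t)
    show ?case
    proof
      assume t: "t \<in> A"
      obtain d where d: "d > 0" "\<And>h. 0 < h \<Longrightarrow> h < d \<Longrightarrow> \<bar>integral {t..t + h} f / h\<bar> < \<eta>"
        using lim[OF elim \<open>\<eta> > 0\<close>] t by (auto simp: f_def divide_inverse_commute)
      obtain m :: nat where m: "c / d < real m" using reals_Archimedean2 by blast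
      have "measure lborel {u. 0 < u \<and> u < c / real n \<and> t + u \<notin> A} \<le> \<eta> * (c / real n)" if "n \<ge> m" for n
      proof -
        have n: "c / d < real n" using m that by linarith
        then have n0: "real n > 0" using \<open>c > 0\<close> d(1) by (smt (verit) divide_pos_pos)
        define h where "h = c / real n"
        have h: "0 < h" "h < d" using n n0 \<open>c > 0\<close> d(1) by (auto simp: h_def field_simps)
        have meas: "{t..t+h} - A \<in> sets borel" by measurable
        have fin: "emeasure lborel ({t..t+h} - A) < \<infinity>"
          by (rule emeasure_bounded_finite) (rule bounded_subset[OF bounded_closed_interval[of t "t+h"]], auto)
        have "((\<lambda>x. indicator ({t..t+h} - A) x :: real) has_integral measure lborel ({t..t+h} - A)) UNIV"
          using has_integral_integral_lborel[OF integrable_real_indicator[OF _ fin]] by simp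
        then have "integral UNIV (\<lambda>x. indicator ({t..t+h} - A) x :: real) = measure lborel ({t..t+h} - A)"
          by (rule integral_unique)
        also have "(\<lambda>x. indicator ({t..t+h} - A) x :: real) = (\<lambda>x. if x \<in> {t..t+h} then f x else 0)"
          by (auto simp: f_def indicator_def)
        finally have I: "integral {t..t+h} f = measure lborel ({t..t+h} - A)"
          unfolding integral_restrict_UNIV .
        have "measure lborel {u. 0 < u \<and> u < h \<and> t + u \<notin> A} = measure (distr lborel borel ((+) t)) ({t<..<t+h} - A)"
          by (subst measure_distr) (auto intro!: arg_cong[where f="measure lborel"])
        also have "\<dots> = measure lborel ({t<..<t+h} - A)" by (simp only: lborel_distr_plus)
        also have "\<dots> \<le> measure lborel ({t..t+h} - A)"
          by (rule measure_mono_fmeasurable) (use fin in \<open>auto simp: fmeasurable_def\<close>)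
        also have "\<dots> \<le> \<eta> * h" using d(2)[OF h] h(1) unfolding I by (simp add: abs_divide field_simps)
        finally show ?thesis by (simp add: h_def)
      qed
      then show "\<exists>m. \<forall>n\<ge>m. measure lborel {u. 0 < u \<and> u < c / real n \<and> t + u \<notin> A} \<le> \<eta> * (c / real n)" by blast
    qed
  qed
qed

lemma measurable_measure_slice:
  assumes "Measurable.pred (borel \<Otimes>\<^sub>M borel) (\<lambda>(x, u). Q x u)"
  shows "(\<lambda>x. measure lborel {u. Q x (u :: real)}) \<in> borel_measurable borel"
proof -
  have "{p \<in> space (borel \<Otimes>\<^sub>M lborel). case p of (x, u) \<Rightarrow> Q x u} \<in> sets (borel \<Otimes>\<^sub>M lborel)"
    using assms by (subst sets_pair_measure_cong[OF refl sets_lborel]) (simp add: pred_def space_pair_measure)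
  from lborel.measurable_emeasure_Pair[OF this]
  have "(\<lambda>x. emeasure lborel {u. Q x u}) \<in> borel_measurable borel"
    by (simp add: vimage_def space_pair_measure)
  then show ?thesis unfolding measure_def by measurable
qed

lemma horizontal_shift_measurable [measurable]:
  "(\<lambda>p :: (real \<times> real) \<times> real. fst p + (snd p, 0)) \<in> borel_measurable (borel \<Otimes>\<^sub>M (borel :: real measure))"
  unfolding borel_prod by (intro borel_measurable_continuous_onI continuous_intros)

text \<open>Horizontal lines are sections of the plane, so the statement on the line passes to the plane
  by Fubini's theorem.\<close>

lemma density_horizontal:
  fixes P :: "real \<times> real \<Rightarrow> bool"
  assumes P: "Measurable.pred borel P" and "\<eta> > 0" "c > 0"
  shows "AE x in lborel. P x \<longrightarrow> (\<exists>m. \<forall>n\<ge>m. measure lborel {u. 0 < u \<and> u < c / real n \<and> \<not> P (x + (u, 0))} \<le> \<eta> * (c / real n))"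
proof -
  define Q where "Q x \<longleftrightarrow> (P x \<longrightarrow> (\<exists>m. \<forall>n\<ge>m. measure lborel {u. 0 < u \<and> u < c / real n \<and> \<not> P (x + (u, 0))} \<le> \<eta> * (c / real n)))" for x
  have [measurable]: "(\<lambda>x. measure lborel {u. 0 < u \<and> u < c / real n \<and> \<not> P (x + (u, 0))}) \<in> borel_measurable borel" for n
    by (rule measurable_measure_slice, unfold split_beta')
       (intro pred_intros_logic measurable_compose[OF horizontal_shift_measurable P]; measurable)
  note P[measurable]
  have [measurable]: "Measurable.pred borel Q" unfolding Q_def[abs_def] by measurable
  have meas: "Measurable.pred (borel \<Otimes>\<^sub>M borel) Q" by (simp add: borel_prod)
  have "AE t in lborel. Q (t, s)" for s
  proof -
    have [measurable]: "Measurable.pred borel (\<lambda>t. P (t, s))"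
      by (rule measurable_compose[OF _ P]) (auto intro!: borel_measurable_continuous_onI continuous_intros)
    have "{t. P (t, s)} \<in> sets borel" by measurable
    from density_real[OF this assms(2,3)] show ?thesis by (simp add: Q_def)
  qed
  then have "AE s in lborel. AE t in lborel. Q (t, s)" by simp
  then have "AE t in lborel. AE s in lborel. Q (t, s)"
    by (subst lborel_pair.AE_commute) (use meas in \<open>auto simp: split_beta' pred_def space_pair_measure cong: sets_pair_measure_cong\<close>)
  then have "AE p in lborel \<Otimes>\<^sub>M lborel. Q p"
    by (intro lborel_pair.AE_pair_measure) (use meas in \<open>auto simp: pred_def space_pair_measure cong: sets_pair_measure_cong\<close>)
  then show ?thesis unfolding lborel_prod Q_def .
qed

text \<open>Rounding down to multiples of \<open>\<epsilon>\<close> partitions the plane into countably many level sets, and the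
  density theorem applies to each of them.\<close>

lemma approximate_continuity:
  fixes f :: "real \<times> real \<Rightarrow> real"
  assumes [measurable]: "f \<in> borel_measurable borel" and "\<epsilon> > 0" "\<eta> > 0" "c > 0"
  shows "AE x in lborel. \<exists>m. \<forall>n\<ge>m. measure lborel {u. 0 < u \<and> u < c / real n \<and> \<not> \<bar>f (x + (u, 0)) - f x\<bar> < \<epsilon>} \<le> \<eta> * (c / real n)"
proof -
  have "AE x in lborel. \<forall>v::int. \<lfloor>f x / \<epsilon>\<rfloor> = v \<longrightarrow> (\<exists>m. \<forall>n\<ge>m. measure lborel {u. 0 < u \<and> u < c / real n \<and> \<not> \<lfloor>f (x + (u, 0)) / \<epsilon>\<rfloor> = v} \<le> \<eta> * (c / real n))"
    unfolding AE_all_countable by (intro allI density_horizontal assms(3,4)) measurable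
  then show ?thesis
  proof eventually_elim
    case (elim x)
    then obtain m where m: "\<And>n. n \<ge> m \<Longrightarrow> 
      measure lborel {u. 0 < u \<and> u < c / real n \<and> \<not> \<lfloor>f (x + (u, 0)) / \<epsilon>\<rfloor> = \<lfloor>f x / \<epsilon>\<rfloor>} \<le> \<eta> * (c / real n)"
      by blast
    have close: "\<bar>f (x + (u, 0)) - f x\<bar> < \<epsilon>" if "\<lfloor>f (x + (u, 0)) / \<epsilon>\<rfloor> = \<lfloor>f x / \<epsilon>\<rfloor>" for u
    proof -
      have "\<bar>f (x + (u, 0)) / \<epsilon> - f x / \<epsilon>\<bar> < 1" using that by linarith
      then show ?thesis using \<open>\<epsilon> > 0\<close> by (simp add: diff_divide_distrib[symmetric] abs_divide)
    qed
    have [measurable]: "(\<lambda>u. f (x + (u, 0))) \<in> borel_measurable borel"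
      by (rule measurable_compose[OF _ assms(1)]) (auto intro!: borel_measurable_continuous_onI continuous_intros)
    have "measure lborel {u. 0 < u \<and> u < c / real n \<and> \<not> \<bar>f (x + (u, 0)) - f x\<bar> < \<epsilon>} 
      \<le> measure lborel {u. 0 < u \<and> u < c / real n \<and> \<not> \<lfloor>f (x + (u, 0)) / \<epsilon>\<rfloor> = \<lfloor>f x / \<epsilon>\<rfloor>}" for n
    proof (rule measure_mono_fmeasurable)
      show "{u. 0 < u \<and> u < c / real n \<and> \<not> \<bar>f (x + (u, 0)) - f x\<bar> < \<epsilon>} \<in> sets lborel"
        by measurable
      show "{u. 0 < u \<and> u < c / real n \<and> \<not> \<lfloor>f (x + (u, 0)) / \<epsilon>\<rfloor> = \<lfloor>f x / \<epsilon>\<rfloor>} \<in> fmeasurable lborel"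
        by (rule fmeasurableI2[of "{0..c / real n}"]) (auto simp: fmeasurable_interval, measurable)
    qed (use close in blast)
    then show ?case using m by (meson order_trans)
  qed
qed

lemma approximate_continuity_family:
  fixes f :: "nat \<Rightarrow> real \<times> real \<Rightarrow> real"
  assumes [measurable]: "\<And>i. f i \<in> borel_measurable borel" and "\<epsilon> > 0" "\<eta> > 0" "c > 0"
  shows "AE x in lborel. \<exists>m. \<forall>n\<ge>m. 
    measure lborel {u. 0 < u \<and> u < c / real n \<and> \<not> (\<forall>i<J. \<bar>f i (x + (u, 0)) - f i x\<bar> < \<epsilon>)} \<le> \<eta> * (c / real n)"
proof -
  have "AE x in lborel. \<forall>i. \<exists>m. \<forall>n\<ge>m. 
     measure lborel {u. 0 < u \<and> u < c / real n \<and> \<not> \<bar>f i (x + (u, 0)) - f i x\<bar> < \<epsilon>} \<le> \<eta> / (J + 1) * (c / real n)"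
    unfolding AE_all_countable by (intro allI approximate_continuity) (use assms in auto)
  then show ?thesis
  proof eventually_elim
    case (elim x)
    then obtain m where m: "\<And>i n. n \<ge> m i \<Longrightarrow>
      measure lborel {u. 0 < u \<and> u < c / real n \<and> \<not> \<bar>f i (x + (u, 0)) - f i x\<bar> < \<epsilon>} \<le> \<eta> / (J + 1) * (c / real n)"
      using choice[OF elim] by blast
    define m0 where "m0 = Max (m ` {..J})"
    have m0: "m i \<le> m0" if "i < J" for i unfolding m0_def using that by (intro Max_ge) auto
    have [measurable]: "(\<lambda>u. f i (x + (u, 0))) \<in> borel_measurable borel" for i
      by (rule measurable_compose[OF _ assms(1)]) (auto intro!: borel_measurable_continuous_onI continuous_intros)
    have "measure lborel {u. 0 < u \<and> u < c / real n \<and> \<not> (\<forall>i<J. \<bar>f i (x + (u, 0)) - f i x\<bar> < \<epsilon>)} \<le> \<eta> * (c / real n)"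
      if n: "n \<ge> m0" for n
    proof -
      define S where "S i = {u. 0 < u \<and> u < c / real n \<and> \<not> \<bar>f i (x + (u, 0)) - f i x\<bar> < \<epsilon>}" for i
      have "S i \<in> fmeasurable lborel" for i
        unfolding S_def by (rule fmeasurableI2[of "{0..c / real n}"]) (auto simp: fmeasurable_interval, measurable)
      then have "measure lborel (\<Union>i<J. S i) \<le> (\<Sum>i<J. measure lborel (S i))"
        by (intro measure_UNION_le) (auto simp: fmeasurable_def)
      also have "\<dots> \<le> (\<Sum>i<J. \<eta> / (J + 1) * (c / real n))"
        unfolding S_def by (rule sum_mono, rule m, rule order_trans[OF m0 n]) simp
      also have "\<dots> = \<eta> * (c / real n) * (J / (J + 1))" by (simp add: ac_simps)
      also have "\<dots> \<le> \<eta> * (c / real n)" using assms by (intro mult_left_le) auto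
      also have "(\<Union>i<J. S i) = {u. 0 < u \<and> u < c / real n \<and> \<not> (\<forall>i<J. \<bar>f i (x + (u, 0)) - f i x\<bar> < \<epsilon>)}"
        by (auto simp: S_def)
      finally show ?thesis .
    qed
    then show ?case by blast
  qed
qed

section \<open>Sheared cocycles\<close>

text \<open>A set \<open>S\<close> and its translate by \<open>- r\<close> together do not fill an interval of length more than twice
  the measure of \<open>S\<close>.\<close>

lemma two_good_points:
  fixes S :: "real set"
  assumes "S \<in> fmeasurable lborel" "2 * measure lborel S < l"
  shows "\<exists>u. s < u \<and> u < s + l \<and> u \<notin> S \<and> u + r \<notin> S"
proof (rule ccontr)
  assume neg: "\<not> ?thesis"
  define S' where "S' = (+) r -` S"
  have [measurable]: "S \<in> sets borel" using assms(1) by (simp add: fmeasurable_def)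
  have S': "S' \<in> sets borel" 
    unfolding S'_def by (rule measurable_sets_borel[of _ borel]) auto
  have e: "emeasure lborel S' = emeasure lborel S"
    unfolding S'_def by (subst (2) lborel_distr_plus[of r, symmetric], subst emeasure_distr) auto
  have fS': "S' \<in> fmeasurable lborel"
    using assms(1) S' by (simp add: fmeasurable_def e)
  have "l > 0" using assms(2) measure_nonneg[of lborel S] by linarith
  have "l = measure lborel {s<..<s+l}" using \<open>l > 0\<close> by simp
  also have "\<dots> \<le> measure lborel (S \<union> S')"
    by (rule measure_mono_fmeasurable[OF _ _ fmeasurable.Un[OF assms(1) fS']])
       (use neg in \<open>auto simp: S'_def add.commute\<close>)
  also have "\<dots> \<le> measure lborel S + measure lborel S'"
    by (rule measure_Un_le) (use assms(1) fS' in \<open>auto simp: fmeasurable_def\<close>)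
  also have "\<dots> = 2 * measure lborel S" by (simp add: measure_def e)
  finally show False using assms(2) by linarith
qed

lemma constant_of_small_periods:
  fixes g :: "real \<Rightarrow> 'a"
  assumes "\<And>z \<tau>. 0 < \<tau> \<Longrightarrow> \<tau> < c \<Longrightarrow> g z = g (z + \<tau> * \<Lambda>)" "c > 0" "\<Lambda> \<noteq> 0"
  shows "g z = g 0"
proof -
  have mult: "g (z + real k * (\<tau> * \<Lambda>)) = g z" if "0 < \<tau>" "\<tau> < c" for z \<tau> k
  proof (induction k)
    case (Suc k)
    then show ?case using assms(1)[OF that, of "z + real k * (\<tau> * \<Lambda>)"] by (simp add: algebra_simps)
  qed simp
  have pos: "g (z + d) = g z" if d: "d / \<Lambda> > 0" for z d
  proof -
    define q where "q = d / \<Lambda>"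
    obtain k :: nat where k: "q / c < real k" using reals_Archimedean2 by blast
    have q: "q > 0" "d = q * \<Lambda>" using d assms(3) by (simp_all add: q_def)
    have k0: "real k > 0" using k divide_pos_pos[OF q(1) \<open>c > 0\<close>] by linarith
    have "g (z + real k * ((q / real k) * \<Lambda>)) = g z"
      by (rule mult) (use q(1) k k0 assms(2) in \<open>auto simp: field_simps\<close>)
    then show ?thesis using k0 by (simp add: q(2))
  qed
  show ?thesis
  proof (cases "z = 0")
    case False
    then have "z / \<Lambda> \<noteq> 0" using assms(3) by simp
    then have "z / \<Lambda> > 0 \<or> (- z) / \<Lambda> > 0" unfolding minus_divide_left[symmetric] by linarith
    then show ?thesis using pos[of z 0] pos[of "-z" z] by auto
  qed simp
qed

text \<open>What the proof uses of the function \<open>\<phi>\<close>: a periodic bounded \<open>\<Phi>\<close> with horizontal derivative \<open>\<Psi>\<close>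
  off the vertical lines over \<open>E1 + \<int>\<close> and the horizontal lines over \<open>E2 + \<int>\<close>, whose Birkhoff sums
  are sublinear while those of \<open>\<Psi>\<close> grow like \<open>n \<Lambda>\<close>. The assumption \<open>separated\<close> says that on a
  horizontal line the discontinuities \<open>e - k a\<^sub>1\<close>, \<open>k < n\<close>, of a Birkhoff sum of length \<open>n\<close> are at mutual
  distance at least \<open>c/n\<close>, and that no two summands jump at the same point.\<close>

locale sheared_cocycle =
  fixes \<Phi> \<Psi> :: "real \<times> real \<Rightarrow> real" and a :: "real \<times> real" and E1 E2 :: "real set" and M c \<Lambda> :: real
  assumes \<Phi>_measurable [measurable]: "\<Phi> \<in> borel_measurable borel"
    and \<Phi>_periodic: "periodic \<Phi>"
    and \<Phi>_bounded: "\<And>x. \<bar>\<Phi> x\<bar> \<le> M" and \<Psi>_bounded: "\<And>x. \<bar>\<Psi> x\<bar> \<le> M"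
    and deriv: "\<And>x. frac (fst x) \<notin> E1 \<Longrightarrow> frac (snd x) \<notin> E2 \<Longrightarrow> 
      ((\<lambda>t. \<Phi> (t, snd x)) has_real_derivative \<Psi> x) (at (fst x))"
    and E2_finite: "finite E2"
    and c_pos: "c > 0"
    and separated: "\<And>n t t' k k'. k < n \<Longrightarrow> k' < n \<Longrightarrow> frac (t + real k * fst a) \<in> E1 \<Longrightarrow> 
      frac (t' + real k' * fst a) \<in> E1 \<Longrightarrow> \<bar>t - t'\<bar> < c / real n \<Longrightarrow> t = t' \<and> k = k'"
    and \<Phi>_sublinear: "\<And>\<delta>. \<delta> > 0 \<Longrightarrow> \<exists>n0. \<forall>n\<ge>n0. \<forall>y. \<bar>birkhoff a \<Phi> n y\<bar> \<le> real n * \<delta>"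
    and \<Psi>_average: "\<And>\<delta>. \<delta> > 0 \<Longrightarrow> \<exists>n0. \<forall>n\<ge>n0. \<forall>y. \<bar>birkhoff a \<Psi> n y - real n * \<Lambda>\<bar> \<le> real n * \<delta>"
    and Lambda_nonzero: "\<Lambda> \<noteq> 0"
begin

lemma M_nonneg: "M \<ge> 0" using \<Phi>_bounded[of 0] by linarith

definition regular_height :: "real \<times> real \<Rightarrow> bool" where
  "regular_height x \<longleftrightarrow> (\<forall>k::nat. frac (snd x + real k * snd a) \<notin> E2)"

lemma AE_regular_height: "AE x in lborel. regular_height x"
  unfolding regular_height_def AE_all_countable by (intro allI AE_frac_notin(2) E2_finite)

text \<open>On a window shorter than \<open>c/n\<close> at most one summand jumps, by at most \<open>2 M\<close>; the other ones are
  Lipschitz and contribute at most \<open>n M u \<le> M c\<close>.\<close>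

lemma birkhoff_increment_bounded:
  assumes "regular_height x" "0 \<le> u" "u < c / real n"
  shows "\<bar>birkhoff a \<Phi> n (x + (u, 0)) - birkhoff a \<Phi> n x\<bar> \<le> 2 * M + M * c"
proof -
  obtain x1 x2 where x: "x = (x1, x2)" by (cases x)
  define S where "S = {k. k < n \<and> (\<exists>t. x1 \<le> t \<and> t \<le> x1 + u \<and> frac (t + real k * fst a) \<in> E1)}"
  have fS: "finite S" by (simp add: S_def)
  have "card S \<le> 1"
  proof (rule card_le_Suc0_iff_eq[OF fS, THEN iffD2, folded One_nat_def], intro ballI)
    fix k k' assume "k \<in> S" "k' \<in> S"
    then obtain t t' where "k < n" "k' < n" "frac (t + real k * fst a) \<in> E1" "frac (t' + real k' * fst a) \<in> E1"
      "x1 \<le> t" "t \<le> x1 + u" "x1 \<le> t'" "t' \<le> x1 + u"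
      unfolding S_def by blast
    moreover from this have "\<bar>t - t'\<bar> < c / real n" using assms(3) by linarith
    ultimately show "k = k'" using separated by blast
  qed
  have term_bd: "\<bar>\<Phi> (x + (u, 0) + real k *\<^sub>R a) - \<Phi> (x + real k *\<^sub>R a)\<bar> \<le> M * u + (if k \<in> S then 2 * M else 0)"
    if k: "k < n" for k
  proof (cases "k \<in> S")
    case True
    have "M * u \<ge> 0" using M_nonneg assms(2) by simp
    with True show ?thesis
      using \<Phi>_bounded[of "x + (u, 0) + real k *\<^sub>R a"] \<Phi>_bounded[of "x + real k *\<^sub>R a"] by simp
  next
    case False
    define y2 where "y2 = x2 + real k * snd a"
    have D: "((\<lambda>t. \<Phi> (t + real k * fst a, y2)) has_real_derivative \<Psi> (t + real k * fst a, y2)) (at t)"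
      if "x1 \<le> t" "t \<le> x1 + u" for t
    proof -
      have "frac (t + real k * fst a) \<notin> E1" using False k that unfolding S_def by blast
      moreover have "frac y2 \<notin> E2" using assms(1) unfolding regular_height_def y2_def x by simp
      ultimately show ?thesis using deriv[of "(t + real k * fst a, y2)"] by (simp add: DERIV_shift)
    qed
    have "norm (\<Phi> (x1 + u + real k * fst a, y2) - \<Phi> (x1 + real k * fst a, y2)) \<le> M * norm (x1 + u - x1)"
    proof (rule field_differentiable_bound[where S="{x1..x1+u}"])
      show "((\<lambda>t. \<Phi> (t + real k * fst a, y2)) has_field_derivative \<Psi> (t + real k * fst a, y2)) (at t within {x1..x1+u})"
        if "t \<in> {x1..x1+u}" for t using D that by (intro DERIV_subset[OF D]) auto
    qed (use \<Psi>_bounded assms(2) in auto)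
    then have "\<bar>\<Phi> (x + (u, 0) + real k *\<^sub>R a) - \<Phi> (x + real k *\<^sub>R a)\<bar> \<le> M * u"
      using assms(2) by (cases a) (simp add: x y2_def add_ac)
    with False show ?thesis by simp
  qed
  have "\<bar>birkhoff a \<Phi> n (x + (u, 0)) - birkhoff a \<Phi> n x\<bar> 
      \<le> (\<Sum>k<n. \<bar>\<Phi> (x + (u, 0) + real k *\<^sub>R a) - \<Phi> (x + real k *\<^sub>R a)\<bar>)"
    unfolding birkhoff_def sum_subtractf[symmetric] by (rule sum_abs)
  also have "\<dots> \<le> (\<Sum>k<n. M * u + (if k \<in> S then 2 * M else 0))"
    by (rule sum_mono) (use term_bd in auto)
  also have "\<dots> = real n * (M * u) + (\<Sum>k<n. if k \<in> S then 2 * M else 0)"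
    by (simp add: sum.distrib)
  also have "(\<Sum>k<n. if k \<in> S then 2 * M else 0) = (\<Sum>k\<in>S. 2 * M)"
    by (rule sum.mono_neutral_cong_right) (auto simp: S_def)
  also have "\<dots> \<le> 2 * M"
    using \<open>card S \<le> 1\<close> M_nonneg by (simp add: mult_left_le_one_le)
  also have "real n * (M * u) \<le> M * c"
  proof -
    have "real n * u \<le> c" using assms(2,3) c_pos by (cases "n = 0") (auto simp: field_simps)
    then show ?thesis using mult_left_mono[OF _ M_nonneg] by (simp add: mult.left_commute)
  qed
  finally show ?thesis by simp
qed

text \<open>The mean value theorem on a segment without discontinuities.\<close>

lemma birkhoff_shear:
  assumes "regular_height x" "n > 0" "u1 < u2"
    and free: "\<And>k t. k < n \<Longrightarrow> fst x + u1 \<le> t \<Longrightarrow> t \<le> fst x + u2 \<Longrightarrow> frac (t + real k * fst a) \<notin> E1"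
    and avg: "\<And>y. \<bar>birkhoff a \<Psi> n y - real n * \<Lambda>\<bar> \<le> real n * \<delta>"
  shows "\<bar>(birkhoff a \<Phi> n (x + (u2, 0)) - birkhoff a \<Phi> n (x + (u1, 0))) - real n * (u2 - u1) * \<Lambda>\<bar> \<le> real n * (u2 - u1) * \<delta>"
proof -
  obtain x1 x2 where x: "x = (x1, x2)" by (cases x)
  have D: "((\<lambda>t. birkhoff a \<Phi> n (t, x2)) has_real_derivative birkhoff a \<Psi> n (t, x2)) (at t)"
    if "x1 + u1 \<le> t" "t \<le> x1 + u2" for t
    unfolding birkhoff_def
  proof (rule DERIV_sum)
    fix k assume "k \<in> {..<n}"
    then have "frac (t + real k * fst a) \<notin> E1" "frac (x2 + real k * snd a) \<notin> E2"
      using free[of k t] that assms(1) by (auto simp: x regular_height_def)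
    then have "((\<lambda>t. \<Phi> (t + real k * fst a, x2 + real k * snd a)) has_real_derivative \<Psi> (t + real k * fst a, x2 + real k * snd a)) (at t)"
      using deriv[of "(t + real k * fst a, x2 + real k * snd a)"] by (simp add: DERIV_shift)
    then show "((\<lambda>t. \<Phi> ((t, x2) + real k *\<^sub>R a)) has_real_derivative \<Psi> ((t, x2) + real k *\<^sub>R a)) (at t)"
      by (cases a) simp
  qed
  obtain \<xi> where "birkhoff a \<Phi> n (x1 + u2, x2) - birkhoff a \<Phi> n (x1 + u1, x2) = (x1 + u2 - (x1 + u1)) * birkhoff a \<Psi> n (\<xi>, x2)"
    using MVT2[of "x1 + u1" "x1 + u2" "\<lambda>t. birkhoff a \<Phi> n (t, x2)" "\<lambda>t. birkhoff a \<Psi> n (t, x2)"] D assms(3) by auto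
  then have "(birkhoff a \<Phi> n (x + (u2, 0)) - birkhoff a \<Phi> n (x + (u1, 0))) - real n * (u2 - u1) * \<Lambda>
     = (u2 - u1) * (birkhoff a \<Psi> n (\<xi>, x2) - real n * \<Lambda>)"
    by (simp add: x algebra_simps)
  also have "\<bar>\<dots>\<bar> \<le> (u2 - u1) * (real n * \<delta>)"
    unfolding abs_mult using assms(3) by (intro mult_mono avg) auto
  finally show ?thesis by (simp add: ac_simps)
qed

text \<open>Two discontinuities in different halves of a window of length \<open>c/n\<close> would be too close.\<close>

lemma free_half:
  assumes "n > 0"
  shows "\<exists>s\<in>{0, c / (2 * real n)}. \<forall>k<n. \<forall>t. x1 + s < t \<longrightarrow> t < x1 + s + c / (2 * real n) \<longrightarrow> frac (t + real k * fst a) \<notin> E1"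
proof (rule ccontr)
  define h where "h = c / (2 * real n)"
  have h: "c / real n = 2 * h" "h > 0" using c_pos assms by (auto simp: h_def)
  assume "\<not> ?thesis"
  then obtain k t k' t' where "k < n" "x1 < t" "t < x1 + h" "frac (t + real k * fst a) \<in> E1"
     "k' < n" "x1 + h < t'" "t' < x1 + h + h" "frac (t' + real k' * fst a) \<in> E1"
    unfolding h_def by auto
  with separated[of k n k' t t'] h show False by auto
qed

end

section \<open>Invariant functions are constant in the fibres\<close>

context sheared_cocycle
begin

context
  \<comment> \<open>An invariant function of the skew product that is Lipschitz in the fibre.\<close>
  fixes F :: "real \<times> real \<Rightarrow> real \<Rightarrow> real" and L :: real
  assumes F_measurable: "case_prod F \<in> borel_measurable (borel \<Otimes>\<^sub>M borel)"
    and F_periodic: "\<And>z. periodic (\<lambda>x. F x z)"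
    and F_lipschitz: "\<And>x z z'. \<bar>F x z - F x z'\<bar> \<le> L * \<bar>z - z'\<bar>"
    and F_invariant: "AE x in lborel. \<forall>z. F (x + a) (z + \<Phi> x) = F x z"
begin

lemma L_nonneg: "L \<ge> 0"
  using order_trans[OF abs_ge_zero F_lipschitz[of 0 1 0]] by simp

lemma continuous_F: "continuous_on UNIV (F x)"
proof (rule lipschitz_on_continuous_on[where L=L], rule lipschitz_onI)
  show "dist (F x z) (F x z') \<le> L * dist z z'" for z z'
    using F_lipschitz[of x z z'] by (simp add: dist_real_def)
qed (rule L_nonneg)

lemma F_section_measurable:
  assumes [measurable]: "g \<in> borel_measurable N" "h \<in> borel_measurable N"
  shows "(\<lambda>y. F (g y) (h y)) \<in> borel_measurable N"
proof -
  have "(\<lambda>y. case_prod F (g y, h y)) \<in> borel_measurable N"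
    by (rule measurable_compose[OF _ F_measurable]) measurable
  then show ?thesis by simp
qed

text \<open>Only rational fibre coordinates are tested, to keep the condition Borel; by continuity in the
  fibre it then holds for all of them.\<close>

definition invariant_at :: "real \<times> real \<Rightarrow> bool" where
  "invariant_at x \<longleftrightarrow> (\<forall>q::rat. F (x + a) (of_rat q + \<Phi> x) = F x (of_rat q))"

lemma invariant_at_iff: "invariant_at x \<longleftrightarrow> (\<forall>z. F (x + a) (z + \<Phi> x) = F x z)"
proof
  assume *: "invariant_at x"
  show "\<forall>z. F (x + a) (z + \<Phi> x) = F x z"
  proof
    fix z
    have "F (x + a) (z + \<Phi> x) - F x z = 0"
    proof (rule continuous_constant_on_closure[where S="\<rat>" and f="\<lambda>z. F (x + a) (z + \<Phi> x) - F x z"])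
      show "continuous_on (closure \<rat>) (\<lambda>z. F (x + a) (z + \<Phi> x) - F x z)"
        by (intro continuous_intros continuous_on_compose2[OF continuous_F] subset_UNIV)
      show "F (x + a) (z + \<Phi> x) - F x z = 0" if "z \<in> \<rat>" for z
        using that * unfolding invariant_at_def by (auto elim!: Rats_cases)
      show "z \<in> closure \<rat>" by (simp add: Rats_closure_real)
    qed
    then show "F (x + a) (z + \<Phi> x) = F x z" by simp
  qed
qed (simp add: invariant_at_def)

definition invariant_orbit :: "real \<times> real \<Rightarrow> bool" where
  "invariant_orbit x \<longleftrightarrow> (\<forall>k::nat. invariant_at (x + real k *\<^sub>R a))"

lemma invariant_at_measurable: "Measurable.pred borel invariant_at"
proof -
  note F_section_measurable [measurable]
  show ?thesis unfolding invariant_at_def[abs_def] by measurable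
qed

lemma invariant_orbit_measurable: "Measurable.pred borel invariant_orbit"
  unfolding invariant_orbit_def[abs_def] 
  by (intro pred_intros_countable shift_measurable invariant_at_measurable)

lemma periodic_invariant_orbit: "periodic invariant_orbit"
proof -
  have p1: "F (fract2 x + y) = F (x + y)" for x y
    using periodic_shift[OF F_periodic, of y] unfolding periodic_def by blast
  have p2: "\<Phi> (fract2 x + y) = \<Phi> (x + y)" for x y
    using periodic_shift[OF \<Phi>_periodic, of y] unfolding periodic_def by blast
  show ?thesis unfolding periodic_def invariant_orbit_def invariant_at_def
    using p1 p2 by (simp add: add.assoc)
qed

lemma AE_invariant_orbit: "AE x in lborel. invariant_orbit x"
  unfolding invariant_orbit_def AE_all_countable
  using F_invariant unfolding invariant_at_iff[symmetric] by (intro allI AE_shift)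

lemma invariant_orbit_birkhoff:
  assumes "invariant_orbit x"
  shows "F (x + real n *\<^sub>R a) (z + birkhoff a \<Phi> n x) = F x z"
proof (induction n arbitrary: z)
  case (Suc n)
  have "invariant_at (x + real n *\<^sub>R a)" using assms unfolding invariant_orbit_def by blast
  then have "F (x + real n *\<^sub>R a + a) ((z + birkhoff a \<Phi> n x) + \<Phi> (x + real n *\<^sub>R a)) = F (x + real n *\<^sub>R a) (z + birkhoff a \<Phi> n x)"
    unfolding invariant_at_iff by blast
  also have "\<dots> = F x z" by (rule Suc)
  finally show ?case by (simp add: birkhoff_def algebra_simps)
qed (simp add: birkhoff_def)

text \<open>The points \<open>net i j\<close> with \<open>j \<le> 2 i \<cdot> net_size i\<close> form a net of the window \<open>[-i, i]\<close> of the fibre,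
  so fine that \<open>F x\<close> varies by at most \<open>1/(i+1)\<close> between neighbours.\<close>

definition net_size :: "nat \<Rightarrow> nat" where
  "net_size i = nat \<lceil>L * real (i + 1)\<rceil> + 1"

definition net :: "nat \<Rightarrow> nat \<Rightarrow> real" where
  "net i j = real j / net_size i - real i"

text \<open>Finitely many functions of \<open>x\<close> that control \<open>F x\<close> on the window \<open>[-i, i]\<close>, together with the
  indicator function of the points with invariant orbit: a point close to a point with invariant orbit
  then has an invariant orbit, too.\<close>

definition observables :: "nat \<Rightarrow> nat \<Rightarrow> real \<times> real \<Rightarrow> real" where
  "observables i j x = (if j = 0 then (if invariant_orbit x then 1 else 0) else F x (net i (j - 1)))"

definition close :: "nat \<Rightarrow> real \<times> real \<Rightarrow> real \<times> real \<Rightarrow> bool" where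
  "close i x y \<longleftrightarrow> (\<forall>j < 2 * i * net_size i + 2. \<bar>observables i j y - observables i j x\<bar> < 1 / real (i + 1))"

text \<open>From the scale \<open>c/m\<close> on, at most one part in 32 of the horizontal window is not close to \<open>x\<close>. The
  constant leaves room for avoiding, at two points \<open>u1\<close> and \<open>u2\<close> of half a window, the bad sets of both
  \<open>x\<close> and \<open>x + n a\<close>.\<close>

definition good :: "nat \<Rightarrow> nat \<Rightarrow> real \<times> real \<Rightarrow> bool" where
  "good i m x \<longleftrightarrow> (\<forall>n\<ge>m. measure lborel {u. 0 < u \<and> u < c / real n \<and> \<not> close i x (x + (u, 0))} \<le> 1/32 * (c / real n))"

lemma observables_measurable: "observables i j \<in> borel_measurable borel"
proof -
  note F_section_measurable [measurable] invariant_orbit_measurable [measurable]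
  show ?thesis unfolding observables_def[abs_def] by measurable
qed

lemma close_measurable: "Measurable.pred (borel \<Otimes>\<^sub>M borel) (\<lambda>(x, u). close i x (x + (u, 0)))"
proof -
  have [measurable]: "(\<lambda>p. observables i j (fst p + (snd p, 0))) \<in> borel_measurable (borel \<Otimes>\<^sub>M (borel :: real measure))" for j
    by (rule measurable_compose[OF horizontal_shift_measurable observables_measurable])
  note [measurable] = observables_measurable
  show ?thesis unfolding close_def split_beta' by measurable
qed

lemma good_measurable: "Measurable.pred borel (good i m)"
proof -
  have [measurable]: "(\<lambda>x. measure lborel {u. 0 < u \<and> u < c / real n \<and> \<not> close i x (x + (u, 0))}) \<in> borel_measurable borel" for n
  proof (rule measurable_measure_slice)
    note [measurable] = close_measurable[of i, unfolded split_beta']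
    show "Measurable.pred (borel \<Otimes>\<^sub>M borel) (\<lambda>(x, u). 0 < u \<and> u < c / real n \<and> \<not> close i x (x + (u, 0)))"
      unfolding split_beta' by measurable
  qed
  show ?thesis unfolding good_def[abs_def] by measurable
qed

lemma periodic_good: "periodic (good i m)"
proof -
  have p: "periodic (observables i j)" for j
    using F_periodic periodic_invariant_orbit unfolding periodic_def observables_def by simp
  have 1: "observables i j (fract2 x + y) = observables i j (x + y)" for x y j
    using periodic_shift[OF p, where a=y] unfolding periodic_def by blast
  have 2: "observables i j (fract2 x) = observables i j x" for x j
    using p unfolding periodic_def by blast
  show ?thesis unfolding periodic_def good_def close_def 1 2 by simp
qed

lemma AE_eventually_good: "AE x in lborel. \<forall>i. \<exists>m. good i m x"
  unfolding AE_all_countable good_def close_def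
  by (intro allI approximate_continuity_family observables_measurable) (use c_pos in auto)

lemma close_invariant_orbit: "close i x y \<Longrightarrow> invariant_orbit x \<Longrightarrow> invariant_orbit y"
proof -
  assume c: "close i x y" and x: "invariant_orbit x"
  from c have "\<bar>observables i 0 y - observables i 0 x\<bar> < 1 / real (i + 1)" unfolding close_def by simp
  also have "\<dots> \<le> 1" by simp
  finally show ?thesis using x by (auto simp: observables_def split: if_splits)
qed

lemma close_F:
  assumes "close i x y" "\<bar>w\<bar> \<le> real i"
  shows "\<bar>F y w - F x w\<bar> \<le> 3 / real (i + 1)"
proof -
  define K where "K = real (net_size i)"
  have K: "K \<ge> 1" "L * real (i + 1) \<le> K" unfolding K_def net_size_def by linarith+
  define j where "j = nat \<lfloor>(w + i) * K\<rfloor>"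
  have wi: "0 \<le> (w + i) * K" "(w + i) * K \<le> 2 * real i * K" using assms(2) K(1) by (auto intro!: mult_right_mono)
  have j: "real j \<le> (w + i) * K" "(w + i) * K \<le> real j + 1" using wi(1) unfolding j_def by linarith+
  have "real j \<le> real (2 * i * net_size i)" using j(1) wi(2) by (simp add: K_def)
  then have "Suc j < 2 * i * net_size i + 2" by linarith
  then have "\<bar>observables i (Suc j) y - observables i (Suc j) x\<bar> < 1 / real (i + 1)"
    using assms(1) unfolding close_def by blast
  then have 1: "\<bar>F y (net i j) - F x (net i j)\<bar> < 1 / real (i + 1)" by (simp add: observables_def)
  have "w - net i j = ((w + i) * K - j) / K" 
    using K(1) unfolding net_def K_def[symmetric] by (simp add: field_simps)
  also have "\<bar>\<dots>\<bar> \<le> 1 / K" unfolding abs_divide using j K(1) by (simp add: divide_right_mono)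
  finally have "\<bar>w - net i j\<bar> \<le> 1 / K" .
  then have "L * \<bar>w - net i j\<bar> \<le> L * (1 / K)" by (rule mult_left_mono[OF _ L_nonneg])
  also have "\<dots> \<le> 1 / real (i + 1)" using K by (simp add: field_simps)
  finally have 2: "L * \<bar>w - net i j\<bar> \<le> 1 / real (i + 1)" .
  have "3 / real (i + 1) = 1 / real (i + 1) + 1 / real (i + 1) + 1 / real (i + 1)" by simp
  then show ?thesis using 1 2 F_lipschitz[of y w "net i j"] F_lipschitz[of x w "net i j"] by linarith
qed

lemma bad_fmeasurable: "{u. 0 < u \<and> u < c / real n \<and> \<not> close i x (x + (u, 0))} \<in> fmeasurable lborel"
proof (rule fmeasurableI2[OF fmeasurable_interval[of 0 "c / real n"]])
  have "(\<lambda>u. (x, u)) \<in> measurable (borel :: real measure) (borel \<Otimes>\<^sub>M borel)" by measurable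
  from measurable_compose[OF this close_measurable[of i]]
  have [measurable]: "Measurable.pred borel (\<lambda>u. close i x (x + (u, 0)))" by simp
  show "{u. 0 < u \<and> u < c / real n \<and> \<not> close i x (x + (u, 0))} \<in> sets lborel" by measurable
qed auto

text \<open>Write \<open>x' = x + n a\<close>, and let \<open>p\<close>, \<open>p\<^sub>1\<close>, \<open>p\<^sub>2\<close> be the Birkhoff sums at \<open>x\<close>, \<open>x + u\<^sub>1\<close>, \<open>x + u\<^sub>2\<close>.
  Then
  \<open>F x z = F x' (z + p) \<approx> F (x' + u\<^sub>1) (z + p) = F (x + u\<^sub>1) (z + p - p\<^sub>1) \<approx> F x (z + p - p\<^sub>1)\<close>
  and, with \<open>w = z + p - p\<^sub>1\<close>,
  \<open>F x w \<approx> F (x + u\<^sub>2) w = F (x' + u\<^sub>2) (w + p\<^sub>2) \<approx> F x' (w + p\<^sub>2) = F x (z + (p\<^sub>2 - p\<^sub>1))\<close>,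
  where \<open>p\<^sub>2 - p\<^sub>1\<close> is nearly \<open>\<tau> \<Lambda>\<close> by \<open>birkhoff_shear\<close>. Comparing two points of the same
  jump-free segment makes the jump between \<open>x\<close> and that segment cancel.\<close>

lemma approximate_period:
  assumes x: "invariant_orbit x" "regular_height x"
    and good: "good i m x" "good i m (x + real n *\<^sub>R a)" and n: "n \<ge> m" "n > 0"
    and return: "\<bar>birkhoff a \<Phi> n x\<bar> \<le> 1"
    and avg: "\<And>y. \<bar>birkhoff a \<Psi> n y - real n * \<Lambda>\<bar> \<le> real n * \<delta>"
    and \<tau>: "0 < \<tau>" "\<tau> < c / 4" and i: "real i \<ge> \<bar>z\<bar> + 1 + 4 * M + 2 * M * c"
  shows "\<bar>F x z - F x (z + \<tau> * \<Lambda>)\<bar> \<le> 12 / real (i + 1) + L * (\<tau> * \<delta>)"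
proof -
  define x' where "x' = x + real n *\<^sub>R a"
  define p where "p = birkhoff a \<Phi> n x"
  define h where "h = c / (2 * real n)"
  have h: "c / real n = 2 * h" "h > 0" using c_pos n(2) by (auto simp: h_def)
  define S where "S = {u. 0 < u \<and> u < c / real n \<and> \<not> close i x (x + (u, 0))} 
     \<union> {u. 0 < u \<and> u < c / real n \<and> \<not> close i x' (x' + (u, 0))}"
  have S: "S \<in> fmeasurable lborel" unfolding S_def by (intro fmeasurable.Un bad_fmeasurable)
  have "measure lborel S \<le> 1/32 * (c / real n) + 1/32 * (c / real n)"
    unfolding S_def 
    by (rule order_trans[OF measure_Un_le add_mono])
       (use good n bad_fmeasurable[of n i x] bad_fmeasurable[of n i x'] in \<open>auto simp: good_def x'_def fmeasurable_def\<close>)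
  then have mS: "2 * measure lborel S < h / 2" using h by linarith
  \<comment> \<open>\<open>s\<close> is the left end of a half of the window in which the Birkhoff sum does not jump.\<close>
  obtain s where s: "s = 0 \<or> s = h" 
    and free: "\<And>k t. k < n \<Longrightarrow> fst x + s < t \<Longrightarrow> t < fst x + s + h \<Longrightarrow> frac (t + real k * fst a) \<notin> E1"
    using free_half[OF n(2), of "fst x"] unfolding h_def by blast
  obtain u1 where u1: "s < u1" "u1 < s + h / 2" "u1 \<notin> S" "u1 + \<tau> / real n \<notin> S"
    using two_good_points[OF S mS] by blast
  define u2 where "u2 = u1 + \<tau> / real n"
  have \<tau>n: "0 < \<tau> / real n" "\<tau> / real n < h / 2"
    using \<tau> n(2) by (auto simp: h_def field_simps)
  have s01: "s \<ge> 0" "s \<le> h" using s h(2) by auto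
  have u: "0 < u1" "u1 < u2" "u2 < s + h" "u2 < c / real n" "u1 < c / real n" "0 < u2"
    using u1 \<tau>n s01 h unfolding u2_def by linarith+
  have cl: "close i x (x + (u1, 0))" "close i x (x + (u2, 0))" "close i x' (x' + (u1, 0))" "close i x' (x' + (u2, 0))"
    using u1(3,4) u unfolding S_def u2_def by auto
  define p1 where "p1 = birkhoff a \<Phi> n (x + (u1, 0))"
  define p2 where "p2 = birkhoff a \<Phi> n (x + (u2, 0))"
  have pp: "\<bar>p\<bar> \<le> 1" "\<bar>p1 - p\<bar> \<le> 2 * M + M * c" "\<bar>p2 - p\<bar> \<le> 2 * M + M * c"
    using return birkhoff_increment_bounded[OF x(2), of _ n] u unfolding p_def p1_def p2_def by auto
  have "\<bar>(p2 - p1) - real n * (u2 - u1) * \<Lambda>\<bar> \<le> real n * (u2 - u1) * \<delta>"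
    unfolding p1_def p2_def
    by (rule birkhoff_shear[OF x(2) n(2) u(2) _ avg]) (use free u u1 in auto)
  then have shear: "\<bar>(p2 - p1) - \<tau> * \<Lambda>\<bar> \<le> \<tau> * \<delta>" using n(2) by (simp add: u2_def)
  have inv: "F (y + real n *\<^sub>R a) (w + birkhoff a \<Phi> n y) = F y w" if "invariant_orbit y" for y w
    by (rule invariant_orbit_birkhoff[OF that])
  have ex: "F x' (w + p) = F x w" for w unfolding x'_def p_def by (rule inv[OF x(1)])
  have e1: "F (x' + (u1, 0)) (w + p1) = F (x + (u1, 0)) w" for w
    using inv[OF close_invariant_orbit[OF cl(1) x(1)], of w] unfolding x'_def p1_def by (simp add: add_ac)
  have e2: "F (x' + (u2, 0)) (w + p2) = F (x + (u2, 0)) w" for w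
    using inv[OF close_invariant_orbit[OF cl(2) x(1)], of w] unfolding x'_def p2_def by (simp add: add_ac)
  have Mc: "0 \<le> M" "0 \<le> M * c" using M_nonneg c_pos by auto
  define w where "w = z + p - p1"
  have a1: "\<bar>F (x' + (u1, 0)) (z + p) - F x' (z + p)\<bar> \<le> 3 / real (i + 1)"
    by (rule close_F[OF cl(3)]) (use pp i Mc in linarith)
  have a2: "\<bar>F (x + (u1, 0)) w - F x w\<bar> \<le> 3 / real (i + 1)"
    by (rule close_F[OF cl(1)]) (use pp i Mc in \<open>unfold w_def, linarith\<close>)
  have a3: "\<bar>F (x + (u2, 0)) w - F x w\<bar> \<le> 3 / real (i + 1)"
    by (rule close_F[OF cl(2)]) (use pp i Mc in \<open>unfold w_def, linarith\<close>)
  have a4: "\<bar>F (x' + (u2, 0)) (w + p2) - F x' (w + p2)\<bar> \<le> 3 / real (i + 1)"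
    by (rule close_F[OF cl(4)]) (use pp i Mc in \<open>unfold w_def, linarith\<close>)
  have b1: "F (x' + (u1, 0)) (z + p) = F (x + (u1, 0)) w" using e1[of w] by (simp add: w_def)
  have b2: "F x' (w + p2) = F x (z + (p2 - p1))" using ex[of "w + p2 - p"] by (simp add: w_def algebra_simps)
  have "\<bar>F x (z + (p2 - p1)) - F x (z + \<tau> * \<Lambda>)\<bar> \<le> L * \<bar>(z + (p2 - p1)) - (z + \<tau> * \<Lambda>)\<bar>" by (rule F_lipschitz)
  also have "\<dots> \<le> L * (\<tau> * \<delta>)" using shear by (intro mult_left_mono L_nonneg) simp
  finally have b3: "\<bar>F x (z + (p2 - p1)) - F x (z + \<tau> * \<Lambda>)\<bar> \<le> L * (\<tau> * \<delta>)" .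
  have "12 / real (i + 1) = 3 / real (i + 1) + 3 / real (i + 1) + 3 / real (i + 1) + 3 / real (i + 1)" by simp
  then show ?thesis using a1 a2 a3 a4 b1 b2 b3 ex[of z] e2[of w] by linarith
qed

text \<open>Almost every \<open>x\<close> is a good point for every window, and by recurrence it returns to the good set at
  arbitrarily late times \<open>n\<close>, so that the error in \<open>approximate_period\<close> becomes arbitrarily small.\<close>

theorem AE_constant_fibre: "AE x in lborel. \<forall>z. F x z = F x 0"
proof -
  have rec: "AE x in lborel. \<forall>i m. good i m x \<longrightarrow> (\<forall>m'. \<exists>n\<ge>m'. good i m (x + real n *\<^sub>R a) \<and> \<bar>birkhoff a \<Phi> n x\<bar> \<le> 1)"
    unfolding AE_all_countable
    by (intro allI recurrence[OF \<Phi>_measurable \<Phi>_bounded \<Phi>_periodic \<Phi>_sublinear good_measurable periodic_good])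
  show ?thesis
    using rec AE_eventually_good AE_invariant_orbit AE_regular_height
  proof eventually_elim
    case (elim x)
    have "F x z = F x (z + \<tau> * \<Lambda>)" if \<tau>: "0 < \<tau>" "\<tau> < c / 4" for z \<tau>
    proof -
      have "\<bar>F x z - F x (z + \<tau> * \<Lambda>)\<bar> \<le> 0"
      proof (rule field_le_epsilon)
        fix e :: real assume e: "e > 0"
        obtain i :: nat where i: "max (\<bar>z\<bar> + 1 + 4 * M + 2 * M * c) (24 / e) \<le> real i" using real_arch_simple by blast
        obtain m where m: "good i m x" using elim(2) by blast
        define \<delta> where "\<delta> = e / (2 * (L * \<tau> + 1))"
        have L\<tau>: "L * \<tau> \<ge> 0" using L_nonneg \<tau> by simp
        have \<delta>: "\<delta> > 0" "L * (\<tau> * \<delta>) \<le> e / 2" using e L\<tau> unfolding \<delta>_def by (auto simp: field_simps)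
        obtain n0 where n0: "\<And>n y. n \<ge> n0 \<Longrightarrow> \<bar>birkhoff a \<Psi> n y - real n * \<Lambda>\<bar> \<le> real n * \<delta>"
          using \<Psi>_average[OF \<delta>(1)] by blast
        obtain n where n: "n \<ge> max (max m n0) 1" "good i m (x + real n *\<^sub>R a)" "\<bar>birkhoff a \<Phi> n x\<bar> \<le> 1"
          using elim(1)[rule_format, OF m, of "max (max m n0) 1"] by blast
        have "\<bar>F x z - F x (z + \<tau> * \<Lambda>)\<bar> \<le> 12 / real (i + 1) + L * (\<tau> * \<delta>)"
          by (rule approximate_period[OF elim(3,4) m n(2) _ _ n(3) n0 \<tau>]) (use n i in auto)
        also have "12 / real (i + 1) \<le> e / 2"
        proof -
          have "24 / e \<le> real (i + 1)" using i by simp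
          then show ?thesis using e by (simp add: field_simps)
        qed
        finally show "\<bar>F x z - F x (z + \<tau> * \<Lambda>)\<bar> \<le> 0 + e" using \<delta>(2) by linarith
      qed
      then show ?thesis by simp
    qed
    then show ?case
      by (intro allI, rule constant_of_small_periods[of "c / 4" "F x" \<Lambda>])
         (assumption | use c_pos Lambda_nonzero in simp)+
  qed
qed

end

end

section \<open>Invariant functions are constant\<close>

lemma integrable_interval: "integrable lborel (indicator {u..v :: real} :: real \<Rightarrow> real)"
  by (rule integrable_real_indicator) (auto simp: emeasure_bounded_finite[unfolded infinity_ennreal_def])

definition integral_over_square :: "real \<Rightarrow> (real \<times> real \<Rightarrow> real) \<Rightarrow> real \<times> real \<Rightarrow> real" where
  "integral_over_square h f x = (\<integral>y. indicator (cbox x (x + (h, h))) y * f y \<partial>lborel)"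

lemma integral_over_square_translate:
  assumes [measurable]: "f \<in> borel_measurable borel"
  shows "integral_over_square h f (x + v) = integral_over_square h (\<lambda>y. f (y + v)) x"
proof -
  have "integral_over_square h f (x + v) = (\<integral>y. indicator (cbox (x + v) (x + v + (h, h))) y * f y \<partial>distr lborel borel ((+) v))"
    unfolding integral_over_square_def lborel_distr_plus ..
  also have "\<dots> = (\<integral>y. indicator (cbox (x + v) (x + v + (h, h))) (v + y) * f (v + y) \<partial>lborel)"
    by (rule integral_distr) (auto intro!: borel_measurable_times)
  also have "(\<lambda>y. indicator (cbox (x + v) (x + v + (h, h))) (v + y) :: real) = indicator (cbox x (x + (h, h)))"
    by (intro ext) (auto simp: indicator_def mem_box algebra_simps)
  finally show ?thesis by (simp add: integral_over_square_def add.commute)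
qed

text \<open>When the square moves, only the points of its boundary, a null set, change status in the limit.\<close>

lemma continuous_integral_over_square:
  assumes [measurable]: "f \<in> borel_measurable borel" and bounded: "\<And>x. \<bar>f x\<bar> \<le> M"
  shows "isCont (integral_over_square h f) x"
proof (rule continuous_at_sequentiallyI)
  fix X assume X: "X \<longlonglongrightarrow> x"
  have box: "y \<in> cbox x (x + (h, h)) \<longleftrightarrow> fst x \<le> fst y \<and> fst y \<le> fst x + h \<and> snd x \<le> snd y \<and> snd y \<le> snd x + h" for x y
    by (cases x; cases y) (auto simp: cbox_Pair_eq)
  have "Bseq X" using X convergent_def convergent_imp_Bseq by blast
  then obtain R where R: "\<And>n. norm (X n) \<le> R" unfolding Bseq_def by blast
  define D where "D = cbox (-(R, R)) ((R, R) + (\<bar>h\<bar>, \<bar>h\<bar>))"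
  have XD: "cbox (X n) (X n + (h, h)) \<subseteq> D" for n
  proof -
    have "\<bar>fst (X n)\<bar> \<le> R" "\<bar>snd (X n)\<bar> \<le> R"
      using R[of n] norm_fst_le[of "fst (X n)" "snd (X n)"] norm_snd_le[of "snd (X n)" "fst (X n)"] by simp_all
    then show ?thesis unfolding D_def by (cases "X n") (auto simp: cbox_Pair_eq)
  qed
  have "(\<lambda>n. \<integral>y. indicator (cbox (X n) (X n + (h, h))) y * f y \<partial>lborel) \<longlonglongrightarrow> (\<integral>y. indicator (cbox x (x + (h, h))) y * f y \<partial>lborel)"
  proof (rule integral_dominated_convergence[where w="\<lambda>y. indicator D y * M"])
    show "integrable lborel (\<lambda>y. indicator D y * M)"
      unfolding D_def by (intro integrable_mult_left) (rule integrable_real_indicator, auto simp: emeasure_lborel_cbox_finite[unfolded infinity_ennreal_def])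
    show "AE y in lborel. norm (indicator (cbox (X n) (X n + (h, h))) y * f y) \<le> indicator D y * M" for n
      using XD[of n] bounded order_trans[OF abs_ge_zero bounded] by (intro AE_I2) (auto simp: indicator_def abs_mult)
    show "AE y in lborel. (\<lambda>n. indicator (cbox (X n) (X n + (h, h))) y * f y) \<longlonglongrightarrow> indicator (cbox x (x + (h, h))) y * f y"
      using AE_coordinate_neq(1)[of "fst x"] AE_coordinate_neq(1)[of "fst x + h"] AE_coordinate_neq(2)[of "snd x"] AE_coordinate_neq(2)[of "snd x + h"]
    proof eventually_elim
      case (elim y)
      have stable: "eventually (\<lambda>n. (u n \<le> c) = (l \<le> c)) sequentially" if "u \<longlonglongrightarrow> l" "l \<noteq> c" for u :: "nat \<Rightarrow> real" and l c
      proof (cases "l < c")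
        case True then show ?thesis using order_tendstoD(2)[OF that(1) True] by (auto elim: eventually_mono)
      next
        case False 
        then have "c < l" using that(2) by simp
        from order_tendstoD(1)[OF that(1) this] this show ?thesis by (auto elim!: eventually_mono)
      qed
      have c: "(\<lambda>n. fst (X n)) \<longlonglongrightarrow> fst x" "(\<lambda>n. snd (X n)) \<longlonglongrightarrow> snd x"
        using X by (auto intro: tendsto_fst tendsto_snd)
      have c': "(\<lambda>n. - (fst (X n) + h)) \<longlonglongrightarrow> - (fst x + h)" "(\<lambda>n. - (snd (X n) + h)) \<longlonglongrightarrow> - (snd x + h)"
        by (intro tendsto_intros c)+
      have ne: "- (fst x + h) \<noteq> - fst y" "- (snd x + h) \<noteq> - snd y" using elim by auto
      have "eventually (\<lambda>n. (y \<in> cbox (X n) (X n + (h, h))) = (y \<in> cbox x (x + (h, h)))) sequentially"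
        using stable[OF c(1) elim(1)[symmetric]] stable[OF c(2) elim(3)[symmetric]] stable[OF c'(1) ne(1)] stable[OF c'(2) ne(2)]
        by eventually_elim (simp only: box neg_le_iff_le)
      then show ?case by (intro tendsto_eventually) (auto elim!: eventually_mono simp: indicator_def)
    qed
  qed (auto intro!: borel_measurable_times)
  then show "(\<lambda>n. integral_over_square h f (X n)) \<longlonglongrightarrow> integral_over_square h f x" unfolding integral_over_square_def .
qed

text \<open>Integrals over squares are continuous, periodic and invariant under the rotation, hence
  constant as its orbits are dense.\<close>

lemma integral_over_square_constant:
  assumes [measurable]: "f \<in> borel_measurable borel" and bounded: "\<And>x. \<bar>f x\<bar> \<le> M" and "periodic f"
    and inv: "AE x in lborel. f (x + a) = f x" and "dense_orbit a"
  shows "integral_over_square h f x = integral_over_square h f 0"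
proof -
  have meas_shift [measurable]: "(\<lambda>y. f (y + v)) \<in> borel_measurable borel" for v by (rule shift_measurable) simp
  have step: "integral_over_square h f (x + a) = integral_over_square h f x" for x
    unfolding integral_over_square_translate[OF assms(1)] unfolding integral_over_square_def
    by (rule integral_cong_AE) (use inv in \<open>auto intro!: borel_measurable_times\<close>)
  have per: "integral_over_square h f (x + (of_int m, of_int n)) = integral_over_square h f x" for x m n
    unfolding integral_over_square_translate[OF assms(1)] periodic_int[OF assms(3)] ..
  have nat: "integral_over_square h f (x + real k *\<^sub>R a) = integral_over_square h f x" for x k
  proof (induction k)
    case (Suc k)
    then show ?case using step[of "x + real k *\<^sub>R a"] by (simp add: algebra_simps)
  qed simp
  have int: "integral_over_square h f (of_int k *\<^sub>R a) = integral_over_square h f 0" for k :: int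
  proof (cases "k \<ge> 0")
    case True then show ?thesis using nat[of 0 "nat k"] by simp
  next
    case False then show ?thesis using nat[of "of_int k *\<^sub>R a" "nat (-k)"] by simp
  qed
  show ?thesis
  proof (rule ccontr)
    assume ne: "integral_over_square h f x \<noteq> integral_over_square h f 0"
    then obtain d where d: "d > 0" "\<And>y. dist y x < d \<Longrightarrow> dist (integral_over_square h f y) (integral_over_square h f x) < dist (integral_over_square h f 0) (integral_over_square h f x)"
      using continuous_integral_over_square[OF assms(1,2), where h=h and x=x] unfolding continuous_at_eps_delta
      by (metis zero_less_dist_iff)
    obtain k m n :: int where "dist (of_int k *\<^sub>R a + (of_int m, of_int n)) x < d"
      using assms(5) d(1) unfolding dense_orbit_def by blast
    from d(2)[OF this] show False by (simp add: per int)
  qed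
qed

context sheared_cocycle
begin

text \<open>The integral of \<open>f\<close> over a cube at \<open>(x, z)\<close> is the integral over a square at \<open>x\<close> of the fibre
  integral \<open>F h y z\<close>. The latter does not depend on \<open>z\<close> by \<open>AE_constant_fibre\<close> and is then
  invariant under the rotation, so the cube integral depends on \<open>h\<close> only. By Lebesgue's
  differentiation theorem these integrals determine \<open>f\<close> almost everywhere.\<close>

theorem invariant_function_constant:
  fixes f :: "(real \<times> real) \<times> real \<Rightarrow> real"
  assumes f_measurable: "f \<in> borel_measurable borel" and bounded: "\<And>p. \<bar>f p\<bar> \<le> 1"
    and periodic: "\<And>z. periodic (\<lambda>x. f (x, z))"
    and invariant: "AE x in lborel. AE z in lborel. f (x + a, z + \<Phi> x) = f (x, z)"
    and dense: "dense_orbit a"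
  shows "\<exists>\<kappa>. AE p in lborel. f p = \<kappa>"
proof -
  have f_meas': "f \<in> borel_measurable (borel \<Otimes>\<^sub>M borel)" unfolding borel_prod by (rule f_measurable)
  have f_sec: "(\<lambda>y. f (g y, k y)) \<in> borel_measurable N"
    if "g \<in> borel_measurable N" "k \<in> borel_measurable N" for g k and N :: "'b measure"
    by (rule measurable_compose[OF measurable_Pair[OF that] f_meas'])
  have f_fib: "(\<lambda>w. f (x, w)) \<in> borel_measurable lborel" for x
    by (rule f_sec) simp_all
  \<comment> \<open>The fibre integral over an interval of length \<open>h\<close> is invariant because translations of the fibre commute with the skew product.\<close>
  define F where "F h x z = (\<integral>w. indicator {z..z+h} w * f (x, w) \<partial>lborel)" for h x z
  define C where "C h x = F h x 0" for h x
  have f_ind: "(\<lambda>w. indicator {u..v} w * f (x, w)) \<in> borel_measurable lborel" for u v x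
    by (intro borel_measurable_times borel_measurable_indicator) (simp, rule f_fib)
  have int_sec: "integrable lborel (\<lambda>w. indicator {u..v} w * f (x, w))" for u v x
  proof (rule Bochner_Integration.integrable_bound[OF integrable_interval])
    show "AE w in lborel. norm (indicator {u..v} w * f (x, w)) \<le> norm (indicator {u..v} w :: real)"
      using bounded by (auto simp: indicator_def)
  qed (rule f_ind)
  have F_meas: "case_prod (F h) \<in> borel_measurable (borel \<Otimes>\<^sub>M borel)" for h
  proof -
    have *: "indicator {snd p..snd p+h} w = (if snd p \<le> w \<and> w \<le> snd p + h then 1 else 0 :: real)" for p :: "(real \<times> real) \<times> real" and w
      by (simp add: indicator_def)
    have 1: "(\<lambda>q. f (fst (fst q), snd q)) \<in> borel_measurable ((borel \<Otimes>\<^sub>M borel) \<Otimes>\<^sub>M lborel)"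
      by (rule f_sec) (rule measurable_compose[OF measurable_fst measurable_fst], rule measurable_snd'', simp)
    have 2: "(\<lambda>q. if snd (fst q) \<le> snd q \<and> snd q \<le> snd (fst q) + h then 1 else 0 :: real)
        \<in> borel_measurable (((borel :: (real \<times> real) measure) \<Otimes>\<^sub>M borel) \<Otimes>\<^sub>M lborel)"
      by measurable
    show ?thesis unfolding F_def split_beta' *
      by (rule lborel.borel_measurable_lebesgue_integral) (use borel_measurable_times[OF 2 1] in \<open>simp only: split_beta'\<close>)
  qed
  have F_meas1 [measurable]: "(\<lambda>x. F h x z) \<in> borel_measurable borel" for h z
    using measurable_compose[OF measurable_Pair[OF measurable_ident measurable_const] F_meas, of z h] by simp
  have F_lip: "\<bar>F h x z - F h x z'\<bar> \<le> 2 * \<bar>z - z'\<bar>" if h: "h > 0" for h x z z'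
  proof -
    have *: "\<bar>F h x z - F h x z'\<bar> \<le> 2 * (z' - z)" if "z \<le> z'" for z z'
    proof -
      have i: "integrable lborel (\<lambda>w. indicator {z..z'} w + indicator {z+h..z'+h} w :: real)"
        by (intro Bochner_Integration.integrable_add integrable_interval)
      have "\<bar>F h x z - F h x z'\<bar> = \<bar>\<integral>w. indicator {z..z+h} w * f (x, w) - indicator {z'..z'+h} w * f (x, w) \<partial>lborel\<bar>"
        unfolding F_def by (subst Bochner_Integration.integral_diff[OF int_sec int_sec]) simp
      also have "\<dots> \<le> (\<integral>w. indicator {z..z'} w + indicator {z+h..z'+h} w \<partial>lborel)"
      proof (rule integral_abs_bound_integral[OF Bochner_Integration.integrable_diff[OF int_sec int_sec] i])
        show "\<bar>indicator {z..z+h} w * f (x, w) - indicator {z'..z'+h} w * f (x, w)\<bar> \<le> indicator {z..z'} w + indicator {z+h..z'+h} w" for w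
          using bounded[of "(x, w)"] that by (auto simp: indicator_def)
      qed
      also have "\<dots> = 2 * (z' - z)"
        using that by (subst Bochner_Integration.integral_add[OF integrable_interval integrable_interval]) simp
      finally show ?thesis .
    qed
    show ?thesis using *[of z z'] *[of z' z] by (cases "z \<le> z'") (auto simp: abs_minus_commute)
  qed
  have F_inv: "AE x in lborel. \<forall>z. F h (x + a) (z + \<Phi> x) = F h x z" for h
    using invariant
  proof eventually_elim
    case (elim x)
    show ?case
    proof
      fix z
      have "F h (x + a) (z + \<Phi> x) = (\<integral>w. indicator {z + \<Phi> x..z + \<Phi> x + h} (\<Phi> x + 1 * w) * f (x + a, \<Phi> x + 1 * w) \<partial>lborel)"
        unfolding F_def by (subst lborel_integral_real_affine[where c=1 and t="\<Phi> x"]) (simp_all only: scaleR_one abs_one one_neq_zero not_False_eq_True)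
      also have "\<dots> = (\<integral>w. indicator {z..z+h} w * f (x, w) \<partial>lborel)"
      proof (rule integral_cong_AE)
        show "(\<lambda>w. indicator {z + \<Phi> x..z + \<Phi> x + h} (\<Phi> x + 1 * w) * f (x + a, \<Phi> x + 1 * w)) \<in> borel_measurable lborel"
          by (intro borel_measurable_times f_sec) simp_all
        show "(\<lambda>w. indicator {z..z+h} w * f (x, w)) \<in> borel_measurable lborel"
          by (rule f_ind)
        show "AE w in lborel. indicator {z + \<Phi> x..z + \<Phi> x + h} (\<Phi> x + 1 * w) * f (x + a, \<Phi> x + 1 * w) = indicator {z..z+h} w * f (x, w)"
          using elim by eventually_elim (simp add: indicator_def add.commute)
      qed
      finally show "F h (x + a) (z + \<Phi> x) = F h x z" by (simp add: F_def)
    qed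
  qed
  have F_per: "periodic (\<lambda>x. F h x z)" for h z
    using periodic unfolding periodic_def F_def by simp
  have F_const: "AE x in lborel. \<forall>z. F h x z = C h x" if "h > 0" for h
    unfolding C_def by (rule AE_constant_fibre[OF F_meas F_per F_lip[OF that] F_inv])
  have C_inv: "AE x in lborel. C h (x + a) = C h x" if "h > 0" for h
    using F_inv[of h] AE_shift[OF F_const[OF that], of a]
  proof eventually_elim
    case (elim x)
    have "C h (x + a) = F h (x + a) (0 + \<Phi> x)" using elim(2) by simp
    also have "\<dots> = F h x 0" using elim(1) by blast
    finally show ?case by (simp add: C_def)
  qed
  have C_bd: "\<bar>C h x\<bar> \<le> h" if "h > 0" for h x
  proof -
    have "\<bar>C h x\<bar> \<le> (\<integral>w. indicator {0..0+h} w \<partial>lborel)"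
      unfolding C_def F_def
      by (rule integral_abs_bound_integral[OF int_sec integrable_interval]) (use bounded in \<open>auto simp: indicator_def\<close>)
    then show ?thesis using that by simp
  qed
  have C_square: "integral_over_square h (C h) x = integral_over_square h (C h) 0" if "h > 0" for h x
    by (rule integral_over_square_constant[OF _ C_bd[OF that] _ C_inv[OF that] dense]) 
       (use F_per in \<open>auto simp: C_def\<close>)
  have one: "(\<Sum>b\<in>Basis. b) = ((1 :: real, 1 :: real), 1 :: real)"
    by (rule euclidean_eqI) (auto simp: inner_sum_left inner_Basis Basis_prod_def)
  have cube_integrable: "set_integrable lborel (cbox q r) f" for q r
    unfolding set_integrable_def
    by (rule integrableI_bounded_set_indicator[where B=1])
       (use bounded f_measurable emeasure_bounded_finite[OF bounded_cbox[of q r]] in auto)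
  have cube: "integral (cbox p (p + h *\<^sub>R One)) f = integral_over_square h (C h) 0" if h: "h > 0" for p h
  proof -
    obtain x z where p: "p = (x, z)" by (cases p)
    have box: "cbox p (p + h *\<^sub>R One) = cbox x (x + (h, h)) \<times> {z..z+h}"
      unfolding one p by (auto simp: cbox_Pair_eq)
    have "integral (cbox p (p + h *\<^sub>R One)) f = (\<integral>q. indicator (cbox p (p + h *\<^sub>R One)) q * f q \<partial>lborel)"
      using set_borel_integral_eq_integral(2)[OF cube_integrable[of p "p + h *\<^sub>R One"]] by (simp add: set_lebesgue_integral_def)
    also have "\<dots> = (\<integral>q. indicator (cbox x (x + (h, h)) \<times> {z..z+h}) q * f q \<partial>(lborel \<Otimes>\<^sub>M lborel))"
      unfolding box lborel_prod ..
    also have "\<dots> = (\<integral>y. (\<integral>w. indicator (cbox x (x + (h, h)) \<times> {z..z+h}) (y, w) * f (y, w) \<partial>lborel) \<partial>lborel)"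
    proof (rule lborel_pair.integral_fst'[symmetric])
      show "integrable (lborel \<Otimes>\<^sub>M lborel) (\<lambda>q. indicator (cbox x (x + (h, h)) \<times> {z..z+h}) q * f q)"
        using cube_integrable[of p "p + h *\<^sub>R One"] unfolding lborel_prod box set_integrable_def by simp
    qed
    also have "\<dots> = (\<integral>y. indicator (cbox x (x + (h, h))) y * F h y z \<partial>lborel)"
      unfolding F_def by (simp add: indicator_times mult.assoc)
    also have "\<dots> = integral_over_square h (C h) x"
      unfolding integral_over_square_def
      by (rule integral_cong_AE) (use F_const[OF h] in \<open>auto intro!: borel_measurable_times elim!: eventually_mono simp: C_def\<close>)
    finally show ?thesis using C_square[OF h] by simp
  qed
  have "f integrable_on cbox q r" for q r
    using set_borel_integral_eq_integral(1)[OF cube_integrable] .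
  then obtain N where N: "negligible N" 
    and lim: "\<And>x e. \<lbrakk>x \<notin> N; 0 < e\<rbrakk> \<Longrightarrow> \<exists>d>0. \<forall>h. 0 < h \<and> h < d \<longrightarrow>
       norm (integral (cbox x (x + h *\<^sub>R One)) f /\<^sub>R h ^ DIM((real \<times> real) \<times> real) - f x) < e"
    using integrable_ccontinuous_explicit[of f] by metis
  have eq: "f p = f q" if "p \<notin> N" "q \<notin> N" for p q
  proof -
    have "\<bar>f p - f q\<bar> \<le> 0"
    proof (rule field_le_epsilon)
      fix e :: real assume "e > 0"
      then have "e / 2 > 0" by simp
      from lim[OF that(1) this] lim[OF that(2) this] obtain d1 d2 where 
        d: "d1 > 0" "\<And>h. 0 < h \<Longrightarrow> h < d1 \<Longrightarrow> norm (integral_over_square h (C h) 0 /\<^sub>R h ^ DIM((real \<times> real) \<times> real) - f p) < e/2"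
           "d2 > 0" "\<And>h. 0 < h \<Longrightarrow> h < d2 \<Longrightarrow> norm (integral_over_square h (C h) 0 /\<^sub>R h ^ DIM((real \<times> real) \<times> real) - f q) < e/2"
        using cube by metis
      define h where "h = min d1 d2 / 2"
      have "0 < h" "h < d1" "h < d2" using d(1,3) by (auto simp: h_def)
      then show "\<bar>f p - f q\<bar> \<le> 0 + e" using d(2)[of h] d(4)[of h] unfolding real_norm_def by linarith
    qed
    then show ?thesis by simp
  qed
  obtain p0 where p0: "p0 \<notin> N" using N non_negligible_UNIV by (metis UNIV_eq_I)
  have "AE p in lebesgue. p \<notin> N" using N by (intro AE_not_in) (simp add: negligible_iff_null_sets)
  then have "AE p in lborel. p \<notin> N" by (rule AE_completion_iff[THEN iffD1])
  then have "AE p in lborel. f p = f p0" by eventually_elim (rule eq[OF _ p0])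
  then show ?thesis by blast
qed

end

section \<open>Functions of the class are sheared cocycles\<close>

lemma finite_positive_lower_bound:
  assumes "finite S" "\<And>x. x \<in> S \<Longrightarrow> (0::real) < x"
  shows "\<exists>c>0. \<forall>x\<in>S. c \<le> x"
  using assms
proof (induction S)
  case (insert x S)
  then obtain c where "c > 0" "\<forall>y\<in>S. c \<le> y" by auto
  then show ?case using insert.prems[of x] by (intro exI[of _ "min c x"]) auto
qed (auto intro: exI[of _ 1])

lemma subdivision_bounds:
  assumes "subdivision r \<beta>" "j \<le> r"
  shows "0 \<le> \<beta> j" "\<beta> j \<le> 1"
proof -
  have "0 \<le> \<beta> j \<and> \<beta> j \<le> 1"
  proof (cases "j = 0 \<or> j = r")
    case True then show ?thesis using assms unfolding subdivision_def by auto
  next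
    case False
    then have j: "j \<in> {1..r-1}" using assms(2) by auto
    then have "1 \<in> {1..r-1}" "r - 1 \<in> {1..r-1}" by auto
    with j have "\<beta> 1 \<le> \<beta> j" "\<beta> j \<le> \<beta> (r-1)"
      using assms(1) unfolding subdivision_def by (auto simp: strict_mono_on_leD)
    then show ?thesis using assms(1) unfolding subdivision_def by auto
  qed
  then show "0 \<le> \<beta> j" "\<beta> j \<le> 1" by auto
qed

text \<open>The excluded points are taken modulo 1, so that \<open>0 = \<beta> 0\<close> is excluded through \<open>\<beta> r = 1\<close>.\<close>

lemma subdivision_cover:
  assumes "subdivision r \<beta>" "0 \<le> t" "t < 1" "t \<notin> (\<lambda>j. frac (\<beta> j)) ` {1..r}"
  shows "\<exists>j<r. \<beta> j < t \<and> t < \<beta> (Suc j)"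
proof -
  have r: "r \<ge> 1" "\<beta> 0 = 0" "\<beta> r = 1" using assms(1) unfolding subdivision_def by auto
  define j where "j = Max {j. j < r \<and> \<beta> j \<le> t}"
  have "finite {j. j < r \<and> \<beta> j \<le> t}" "{j. j < r \<and> \<beta> j \<le> t} \<noteq> {}" using r assms(2) by (auto intro!: exI[of _ 0])
  then have j: "j < r" "\<beta> j \<le> t" and max: "\<And>i. i < r \<Longrightarrow> \<beta> i \<le> t \<Longrightarrow> i \<le> j"
    unfolding j_def using Max_in[of "{j. j < r \<and> \<beta> j \<le> t}"] Max_ge[of "{j. j < r \<and> \<beta> j \<le> t}"] by auto
  have "t < \<beta> (Suc j)"
  proof (cases "Suc j = r")
    case True then show ?thesis using r assms by simp
  next
    case False then show ?thesis using max[of "Suc j"] j by force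
  qed
  moreover have "\<beta> j \<noteq> t"
  proof
    assume "\<beta> j = t"
    have "t = frac (\<beta> (if j = 0 then r else j))"
      using \<open>\<beta> j = t\<close> r assms(2,3) by (auto simp: frac_eq)
    moreover have "(if j = 0 then r else j) \<in> {1..r}" using j r by auto
    ultimately show False using assms(4) by blast
  qed
  ultimately show ?thesis using j by (intro exI[of _ j]) auto
qed

text \<open>Two break points \<open>t\<close>, \<open>t'\<close> differ by \<open>\<beta> j - \<beta> j' - (k - k') \<theta>\<close> modulo 1. For \<open>k \<noteq> k'\<close> the
  Diophantine hypothesis bounds this from below by a multiple of \<open>1/\<bar>k - k'\<bar> \<ge> 1/n\<close>. For \<open>k = k'\<close>
  the difference, if not zero, is one of the differences of break points modulo 1 and thus at least a
  positive constant. The case \<open>j = j'\<close> of the hypothesis, that \<open>\<theta>\<close> is badly approximable, separates the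
  translates of a single break point.\<close>

lemma Bad_Z_separated:
  fixes \<beta> :: "nat \<Rightarrow> real"
  assumes "\<And>j j'. j \<in> {1..r} \<Longrightarrow> j' \<in> {1..r} \<Longrightarrow> \<beta> j - \<beta> j' \<in> Bad_Z \<theta>"
  defines "E \<equiv> (\<lambda>j. frac (\<beta> j)) ` {1..r}"
  shows "\<exists>c>0. \<forall>n t t'. \<forall>k<n. \<forall>k'<n. frac (t + real k * \<theta>) \<in> E \<longrightarrow> frac (t' + real k' * \<theta>) \<in> E \<longrightarrow>
    \<bar>t - t'\<bar> < c / real n \<longrightarrow> t = t' \<and> k = k'"
proof -
  have "\<forall>p \<in> {1..r} \<times> {1..r}. \<exists>c>0. \<forall>q :: int. q \<noteq> 0 \<longrightarrow> infdist (of_int q * \<theta> - (\<beta> (fst p) - \<beta> (snd p))) \<int> \<ge> c / of_int \<bar>q\<bar>"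
    using assms(1) unfolding Bad_Z_def by auto
  from bchoice[OF this] obtain b where b0: "\<forall>p \<in> {1..r} \<times> {1..r}. b p > 0 \<and>
      (\<forall>q :: int. q \<noteq> 0 \<longrightarrow> infdist (of_int q * \<theta> - (\<beta> (fst p) - \<beta> (snd p))) \<int> \<ge> b p / of_int \<bar>q\<bar>)"
    by (elim exE)
  have b: "b p > 0" "q \<noteq> 0 \<Longrightarrow> infdist (of_int q * \<theta> - (\<beta> (fst p) - \<beta> (snd p))) \<int> \<ge> b p / of_int \<bar>q\<bar>"
    if "p \<in> {1..r} \<times> {1..r}" for p and q :: int
    using bspec[OF b0 that] by blast+
  have fE: "finite E" unfolding E_def by simp
  define G where "G = {(e, e'). e \<in> E \<and> e' \<in> E \<and> e \<noteq> e'}"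
  have "finite G" unfolding G_def by (rule finite_subset[of _ "E \<times> E"]) (use fE in auto)
  define S where "S = insert 1 (b ` ({1..r} \<times> {1..r}) \<union> (\<lambda>(e, e'). \<bar>e - e'\<bar>) ` G \<union> (\<lambda>(e, e'). 1 - \<bar>e - e'\<bar>) ` G)"
  have E01: "0 \<le> e" "e < 1" if "e \<in> E" for e using that unfolding E_def by (auto simp: frac_lt_1)
  have "\<exists>c>0. \<forall>x\<in>S. c \<le> x"
  proof (rule finite_positive_lower_bound)
    show "finite S" unfolding S_def using \<open>finite G\<close> by auto
    show "0 < x" if "x \<in> S" for x
      using that b(1) E01 unfolding S_def G_def by (force simp: abs_if)
  qed
  then obtain c where c: "c > 0" "\<And>x. x \<in> S \<Longrightarrow> c \<le> x" by blast
  have "t = t' \<and> k = k'" if k: "k < n" "k' < n" and e: "frac (t + real k * \<theta>) \<in> E" "frac (t' + real k' * \<theta>) \<in> E" 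
    and d: "\<bar>t - t'\<bar> < c / real n" for n t t' k k'
  proof -
    have n: "real n \<ge> 1" using k by simp
    have cn: "c / real n \<le> c" using c(1) n by (simp add: field_simps)
    show ?thesis
    proof (cases "k = k'")
      case True
      define e1 e2 where "e1 = frac (t + real k * \<theta>)" and "e2 = frac (t' + real k' * \<theta>)"
      define m where "m = \<lfloor>t + real k * \<theta>\<rfloor> - \<lfloor>t' + real k' * \<theta>\<rfloor>"
      have tt: "t - t' = e1 - e2 + of_int m" unfolding e1_def e2_def m_def frac_def using True by simp
      have ee: "e1 \<in> E" "e2 \<in> E" using e by (auto simp: e1_def e2_def)
      note bb = E01[OF ee(1)] E01[OF ee(2)]
      have "c \<le> 1" using c(2)[of 1] unfolding S_def by simp
      have "e1 = e2"
      proof (rule ccontr)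
        assume "e1 \<noteq> e2"
        then have "(e1, e2) \<in> G" using ee by (simp add: G_def)
        then have "c \<le> \<bar>e1 - e2\<bar>" "c \<le> 1 - \<bar>e1 - e2\<bar>"
          by (auto intro!: c(2) simp: S_def intro: rev_image_eqI)
        moreover consider "m = 0" | "of_int m \<ge> (1::real)" | "of_int m \<le> (-1::real)" by linarith
        then have "\<bar>t - t'\<bar> \<ge> min \<bar>e1 - e2\<bar> (1 - \<bar>e1 - e2\<bar>)" by cases (auto simp: tt)
        ultimately show False using d cn by linarith
      qed
      moreover have "m = 0"
      proof (rule ccontr)
        assume "m \<noteq> 0"
        then have "\<bar>of_int m :: real\<bar> \<ge> 1" by linarith
        then show False using tt \<open>e1 = e2\<close> d cn \<open>c \<le> 1\<close> by simp
      qed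
      ultimately show ?thesis using tt True by simp
    next
      case False
      obtain j j' where j: "j \<in> {1..r}" "frac (t + real k * \<theta>) = frac (\<beta> j)" "j' \<in> {1..r}" "frac (t' + real k' * \<theta>) = frac (\<beta> j')"
        using e unfolding E_def by auto
      define q where "q = int k - int k'"
      define m where "m = \<lfloor>t + real k * \<theta>\<rfloor> - \<lfloor>\<beta> j\<rfloor> - \<lfloor>t' + real k' * \<theta>\<rfloor> + \<lfloor>\<beta> j'\<rfloor>"
      have q: "q \<noteq> 0" "\<bar>q\<bar> < int n" using False k by (auto simp: q_def)
      have "b (j, j') / of_int \<bar>q\<bar> \<le> infdist (of_int q * \<theta> - (\<beta> j - \<beta> j')) \<int>"
        using b(2)[of "(j, j')" q] j q by simp
      also have "\<dots> \<le> dist (of_int q * \<theta> - (\<beta> j - \<beta> j')) (of_int m)" by (rule infdist_le) simp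
      also have "of_int q * \<theta> - (\<beta> j - \<beta> j') - of_int m = t' - t"
        using j(2,4) unfolding frac_def q_def m_def by (simp add: algebra_simps)
      then have "dist (of_int q * \<theta> - (\<beta> j - \<beta> j')) (of_int m) = \<bar>t - t'\<bar>" by (simp add: dist_real_def abs_minus_commute)
      finally have 1: "b (j, j') / of_int \<bar>q\<bar> \<le> \<bar>t - t'\<bar>" .
      have "c \<le> b (j, j')" using j by (intro c(2)) (auto simp: S_def)
      then have "c / real n \<le> b (j, j') / of_int \<bar>q\<bar>"
        using q c(1) by (intro frac_le) auto
      with 1 d show ?thesis by linarith
    qed
  qed
  then show ?thesis using c(1) by blast
qed

text \<open>The periodic extension of the restriction of \<open>g\<close> to \<open>\<Omega>\<close>, with the value 0 elsewhere. It makes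
  a function that is arbitrary off the open rectangles Borel and bounded, at the cost of a null set.\<close>

definition lift_on :: "(real \<times> real) set \<Rightarrow> (real \<times> real \<Rightarrow> real) \<Rightarrow> real \<times> real \<Rightarrow> real" where
  "lift_on \<Omega> g x = (if fract2 x \<in> \<Omega> then g (fract2 x) else 0)"

lemma fract2_fract2 [simp]: "fract2 (fract2 x) = fract2 x"
  by (simp add: fract2_id)

lemma periodic_lift_on: "periodic (lift_on \<Omega> g)"
  by (simp add: periodic_def lift_on_def)

lemma lift_on_measurable:
  assumes "open \<Omega>" "continuous_on \<Omega> g"
  shows "lift_on \<Omega> g \<in> borel_measurable borel"
proof -
  have ext: "(\<lambda>x. if x \<in> \<Omega> then g x else 0) \<in> borel_measurable borel"
    by (rule borel_measurable_continuous_on_if) (use assms in auto)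
  show ?thesis unfolding lift_on_def[abs_def] using measurable_compose[OF fract2_measurable ext] by simp
qed

definition regular_domain :: "nat \<Rightarrow> nat \<Rightarrow> (nat \<Rightarrow> real) \<Rightarrow> (nat \<Rightarrow> real) \<Rightarrow> (real \<times> real) set" where
  "regular_domain r1 r2 \<beta>1 \<beta>2 = (\<Union>j<r1. \<Union>j'<r2. rectangle \<beta>1 \<beta>2 j j')"

definition break_points :: "nat \<Rightarrow> (nat \<Rightarrow> real) \<Rightarrow> real set" where
  "break_points r \<beta> = (\<lambda>j. frac (\<beta> j)) ` {1..r}"

context
  fixes r1 r2 :: nat and \<beta>1 \<beta>2 :: "nat \<Rightarrow> real"
  assumes s1: "subdivision r1 \<beta>1" and s2: "subdivision r2 \<beta>2"
begin

lemma open_rectangle: "open (rectangle \<beta>1 \<beta>2 j j')"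
  unfolding rectangle_def by (simp add: open_Times)

lemma open_regular_domain: "open (regular_domain r1 r2 \<beta>1 \<beta>2)"
  unfolding regular_domain_def by (intro open_UN ballI open_rectangle)

lemma regular_point:
  assumes "frac (fst x) \<notin> break_points r1 \<beta>1" "frac (snd x) \<notin> break_points r2 \<beta>2"
  obtains j j' where "j < r1" "j' < r2" "fract2 x \<in> rectangle \<beta>1 \<beta>2 j j'"
proof -
  obtain j j' where "j < r1" "\<beta>1 j < frac (fst x) \<and> frac (fst x) < \<beta>1 (Suc j)" "j' < r2" "\<beta>2 j' < frac (snd x) \<and> frac (snd x) < \<beta>2 (Suc j')"
    using subdivision_cover[OF s1 frac_ge_0 frac_lt_1, of "fst x"] subdivision_cover[OF s2 frac_ge_0 frac_lt_1, of "snd x"]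
      assms unfolding break_points_def by blast
  then show ?thesis by (intro that[of j j']) (auto simp: rectangle_def fract2_def)
qed

lemma fract2_near:
  assumes "fract2 x \<in> rectangle \<beta>1 \<beta>2 j j'" "j < r1" "j' < r2"
    and y: "y - (x - fract2 x) \<in> rectangle \<beta>1 \<beta>2 j j'"
  shows "fract2 y = y - (x - fract2 x)"
proof -
  have x: "x - fract2 x = (of_int \<lfloor>fst x\<rfloor>, of_int \<lfloor>snd x\<rfloor>)" by (cases x) (simp add: fract2_def frac_def)
  have "rectangle \<beta>1 \<beta>2 j j' \<subseteq> torus_domain"
    using subdivision_bounds[OF s1, of j] subdivision_bounds[OF s1, of "Suc j"] subdivision_bounds[OF s2, of j'] subdivision_bounds[OF s2, of "Suc j'"] assms(2,3)
    unfolding rectangle_def torus_domain_def by auto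
  with y have "y - (x - fract2 x) \<in> torus_domain" by blast
  then have "fract2 (y - (x - fract2 x)) = y - (x - fract2 x)" by (rule fract2_id)
  moreover have "fract2 (y - (x - fract2 x)) = fract2 y" unfolding x
    using fract2_add_int[of y "- \<lfloor>fst x\<rfloor>" "- \<lfloor>snd x\<rfloor>"] by (cases y) simp
  ultimately show ?thesis by simp
qed

lemma lift_on_eq:
  assumes "fract2 x \<in> rectangle \<beta>1 \<beta>2 j j'" "j < r1" "j' < r2" "y - (x - fract2 x) \<in> rectangle \<beta>1 \<beta>2 j j'"
  shows "lift_on (regular_domain r1 r2 \<beta>1 \<beta>2) g y = g (y - (x - fract2 x))"
  using assms unfolding lift_on_def fract2_near[OF assms(1-4)] regular_domain_def by auto

lemma isCont_lift_on:
  assumes x: "frac (fst x) \<notin> break_points r1 \<beta>1" "frac (snd x) \<notin> break_points r2 \<beta>2"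
    and g: "\<And>j j'. j < r1 \<Longrightarrow> j' < r2 \<Longrightarrow> continuous_on (rectangle \<beta>1 \<beta>2 j j') g"
  shows "isCont (lift_on (regular_domain r1 r2 \<beta>1 \<beta>2) g) x"
proof -
  obtain j j' where j: "j < r1" "j' < r2" "fract2 x \<in> rectangle \<beta>1 \<beta>2 j j'" using regular_point[OF x] .
  let ?R = "rectangle \<beta>1 \<beta>2 j j'"
  have cont: "isCont (\<lambda>y. y - (x - fract2 x)) x" by (intro continuous_intros)
  have "isCont (\<lambda>y. g (y - (x - fract2 x))) x"
    by (rule isCont_o2[OF cont]) (use g[OF j(1,2)] j(3) open_rectangle in \<open>auto simp: continuous_on_eq_continuous_at\<close>)
  have "eventually (\<lambda>y. y - (x - fract2 x) \<in> ?R) (nhds x)"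
  proof -
    have "open ((\<lambda>y. y - (x - fract2 x)) -` ?R)" by (intro open_vimage open_rectangle continuous_intros)
    from eventually_nhds_in_open[OF this, of x] j(3) show ?thesis by simp
  qed
  then have "eventually (\<lambda>y. g (y - (x - fract2 x)) = lift_on (regular_domain r1 r2 \<beta>1 \<beta>2) g y) (nhds x)"
    by eventually_elim (use lift_on_eq[OF j(3,1,2)] in auto)
  from isCont_cong[OF this] \<open>isCont (\<lambda>y. g (y - (x - fract2 x))) x\<close> show ?thesis by simp
qed

lemma AE_regular: "AE x in lborel. frac (fst x) \<notin> break_points r1 \<beta>1 \<and> frac (snd x) \<notin> break_points r2 \<beta>2"
  using AE_frac_notin(1)[of "break_points r1 \<beta>1" 0] AE_frac_notin(2)[of "break_points r2 \<beta>2" 0]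
  by (simp add: break_points_def)

lemma AE_lift_on: "AE x in lborel. x \<in> torus_domain \<longrightarrow> lift_on (regular_domain r1 r2 \<beta>1 \<beta>2) g x = g x"
  using AE_regular
proof eventually_elim
  case (elim x)
  then obtain j j' where "j < r1" "j' < r2" "fract2 x \<in> rectangle \<beta>1 \<beta>2 j j'" using regular_point[of x] by metis
  then show ?case by (auto simp: lift_on_def fract2_id regular_domain_def)
qed

lemma lift_on_bounded:
  assumes g: "\<And>j j'. j < r1 \<Longrightarrow> j' < r2 \<Longrightarrow> continuous_up_to_closure (rectangle \<beta>1 \<beta>2 j j') g"
  shows "\<exists>M. \<forall>x. \<bar>lift_on (regular_domain r1 r2 \<beta>1 \<beta>2) g x\<bar> \<le> M"
proof -
  have "bounded (g ` rectangle \<beta>1 \<beta>2 j j')" if jj: "j < r1" "j' < r2" for j j'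
  proof -
    obtain h where h: "continuous_on (closure (rectangle \<beta>1 \<beta>2 j j')) h" "\<And>p. p \<in> rectangle \<beta>1 \<beta>2 j j' \<Longrightarrow> h p = g p"
      using g[OF jj] unfolding continuous_up_to_closure_def by auto
    have "bounded (rectangle \<beta>1 \<beta>2 j j')" unfolding rectangle_def 
      by (intro bounded_Times bounded_subset[OF bounded_closed_interval greaterThanLessThan_subseteq_atLeastAtMost_iff[THEN iffD2]]) auto
    then have "compact (closure (rectangle \<beta>1 \<beta>2 j j'))" by simp
    then have "bounded (h ` closure (rectangle \<beta>1 \<beta>2 j j'))" using h(1) by (intro compact_imp_bounded compact_continuous_image)
    then show ?thesis
      by (rule bounded_subset) (use h(2) closure_subset in \<open>force simp: image_iff\<close>)
  qed
  then have "bounded (g ` (regular_domain r1 r2 \<beta>1 \<beta>2))" unfolding regular_domain_def image_UN by (intro bounded_UN) auto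
  then obtain M where M: "\<And>x. x \<in> (regular_domain r1 r2 \<beta>1 \<beta>2) \<Longrightarrow> \<bar>g x\<bar> \<le> M" unfolding bounded_iff by auto
  have "\<bar>lift_on (regular_domain r1 r2 \<beta>1 \<beta>2) g x\<bar> \<le> \<bar>M\<bar>" for x
    using M[of "fract2 x"] by (auto simp: lift_on_def)
  then show ?thesis by blast
qed

lemma continuous_on_regular_domain:
  assumes "\<And>j j'. j < r1 \<Longrightarrow> j' < r2 \<Longrightarrow> continuous_on (rectangle \<beta>1 \<beta>2 j j') g"
  shows "continuous_on (regular_domain r1 r2 \<beta>1 \<beta>2) g"
  unfolding regular_domain_def 
  by (intro continuous_on_open_UN open_UN ballI open_rectangle assms) auto

text \<open>Near a point over a rectangle the lift is a translate of \<open>\<phi>\<close>.\<close>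

lemma lift_on_deriv:
  assumes x: "frac (fst x) \<notin> break_points r1 \<beta>1" "frac (snd x) \<notin> break_points r2 \<beta>2"
    and \<phi>: "\<And>j j' p. j < r1 \<Longrightarrow> j' < r2 \<Longrightarrow> p \<in> rectangle \<beta>1 \<beta>2 j j' \<Longrightarrow> (\<lambda>t. \<phi> (t, snd p)) field_differentiable at (fst p)"
  shows "((\<lambda>t. lift_on (regular_domain r1 r2 \<beta>1 \<beta>2) \<phi> (t, snd x)) has_real_derivative lift_on (regular_domain r1 r2 \<beta>1 \<beta>2) (partial1 \<phi>) x) (at (fst x))"
proof -
  obtain j j' where j: "j < r1" "j' < r2" "fract2 x \<in> rectangle \<beta>1 \<beta>2 j j'" using regular_point[OF x] .
  define m where "m = real_of_int \<lfloor>fst x\<rfloor>"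
  have f: "fract2 x = (fst x - m, frac (snd x))" by (simp add: fract2_def frac_def m_def)
  have "((\<lambda>t. \<phi> (t, snd (fract2 x))) has_real_derivative partial1 \<phi> (fract2 x)) (at (fst (fract2 x)))"
    unfolding partial1_def using \<phi>[OF j] by (simp add: DERIV_deriv_iff_field_differentiable)
  then have "((\<lambda>t. \<phi> (t, frac (snd x))) has_real_derivative partial1 \<phi> (fract2 x)) (at (fst x + (- m)))"
    by (simp add: f)
  then have D: "((\<lambda>t. \<phi> (t + (- m), frac (snd x))) has_real_derivative partial1 \<phi> (fract2 x)) (at (fst x))"
    unfolding DERIV_shift .
  have "lift_on (regular_domain r1 r2 \<beta>1 \<beta>2) (partial1 \<phi>) x = partial1 \<phi> (fract2 x)"
    using lift_on_eq[OF j(3,1,2), of x] j(3) by simp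
  moreover have "((\<lambda>t. lift_on (regular_domain r1 r2 \<beta>1 \<beta>2) \<phi> (t, snd x)) has_real_derivative partial1 \<phi> (fract2 x)) (at (fst x))"
  proof (rule has_field_derivative_transform_within_open[OF D])
    show "open {m + \<beta>1 j<..<m + \<beta>1 (Suc j)}" by simp
    show "fst x \<in> {m + \<beta>1 j<..<m + \<beta>1 (Suc j)}" using j(3) by (auto simp: f rectangle_def)
    fix t assume t: "t \<in> {m + \<beta>1 j<..<m + \<beta>1 (Suc j)}"
    have y: "(t, snd x) - (x - fract2 x) = (t + (- m), frac (snd x))"
      by (rule prod_eqI) (simp_all add: f)
    show "\<phi> (t + (- m), frac (snd x)) = lift_on (regular_domain r1 r2 \<beta>1 \<beta>2) \<phi> (t, snd x)"
      using t j(3) lift_on_eq[OF j(3,1,2), of "(t, snd x)" \<phi>] unfolding y by (auto simp: rectangle_def f)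
  qed
  ultimately show ?thesis by simp
qed

end

lemma integral_torus_eq:
  fixes f g :: "real \<times> real \<Rightarrow> real"
  assumes "f \<in> borel_measurable torus" and [measurable]: "g \<in> borel_measurable borel"
    and "AE x in lborel. x \<in> torus_domain \<longrightarrow> g x = f x"
  shows "(\<integral>x. f x \<partial>torus) = (\<integral>x. g x \<partial>borel_torus)"
proof -
  have D: "torus_domain \<inter> space lebesgue \<in> sets lebesgue" by simp
  have f: "(\<lambda>x. indicator torus_domain x *\<^sub>R f x) \<in> borel_measurable lebesgue"
    using assms(1) unfolding torus_def by (subst (asm) borel_measurable_restrict_space_iff[OF D])
  have g: "(\<lambda>x. indicator torus_domain x *\<^sub>R g x) \<in> borel_measurable lborel" by measurable
  have "(\<integral>x. f x \<partial>torus) = (\<integral>x. indicator torus_domain x *\<^sub>R f x \<partial>lebesgue)"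
    unfolding torus_def by (rule integral_restrict_space[OF D])
  also have "\<dots> = (\<integral>x. indicator torus_domain x *\<^sub>R g x \<partial>lebesgue)"
    by (rule integral_cong_AE[OF f measurable_completion[OF g]])
       (use AE_completion[OF assms(3)] in \<open>auto elim!: eventually_mono simp: indicator_def\<close>)
  also have "\<dots> = (\<integral>x. indicator torus_domain x *\<^sub>R g x \<partial>lborel)"
    by (rule integral_completion[OF g])
  also have "\<dots> = (\<integral>x. g x \<partial>borel_torus)"
    unfolding borel_torus_def by (rule integral_restrict_space[symmetric]) simp
  finally show ?thesis .
qed

theorem F1_sheared_cocycle:
  assumes \<phi>: "\<phi> \<in> F1_with r1 \<beta>1 r2 \<beta>2" and "lambda1 \<phi> \<noteq> 0" and "totally_irrational \<alpha>"
    and bad: "\<And>j j'. j \<in> {1..r1} \<Longrightarrow> j' \<in> {1..r1} \<Longrightarrow> \<beta>1 j - \<beta>1 j' \<in> Bad_Z (fst \<alpha>)"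
  shows "\<exists>\<Phi> \<Psi> E1 E2 M c. sheared_cocycle \<Phi> \<Psi> \<alpha> E1 E2 M c (lambda1 \<phi>) \<and> (AE x in lborel. x \<in> torus_domain \<longrightarrow> \<Phi> x = \<phi> x)"
proof -
  have s: "subdivision r1 \<beta>1" "subdivision r2 \<beta>2" and int: "integrable torus \<phi>" and zero: "(\<integral>x. \<phi> x \<partial>torus) = 0"
    and diff: "\<And>j j' p. j < r1 \<Longrightarrow> j' < r2 \<Longrightarrow> p \<in> rectangle \<beta>1 \<beta>2 j j' \<Longrightarrow> (\<lambda>t. \<phi> (t, snd p)) field_differentiable at (fst p)"
    and c1: "\<And>j j'. j < r1 \<Longrightarrow> j' < r2 \<Longrightarrow> continuous_up_to_closure (rectangle \<beta>1 \<beta>2 j j') \<phi>"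
    and c2: "\<And>j j'. j < r1 \<Longrightarrow> j' < r2 \<Longrightarrow> continuous_up_to_closure (rectangle \<beta>1 \<beta>2 j j') (partial1 \<phi>)"
    using \<phi> unfolding F1_with_def by auto
  define \<Omega> where "\<Omega> = regular_domain r1 r2 \<beta>1 \<beta>2"
  define E1 where "E1 = break_points r1 \<beta>1"
  define E2 where "E2 = break_points r2 \<beta>2"
  define \<Phi> where "\<Phi> = lift_on \<Omega> \<phi>"
  define \<Psi> where "\<Psi> = lift_on \<Omega> (partial1 \<phi>)"
  have cc: "continuous_on (rectangle \<beta>1 \<beta>2 j j') \<phi>" "continuous_on (rectangle \<beta>1 \<beta>2 j j') (partial1 \<phi>)" if "j < r1" "j' < r2" for j j'
    using c1[OF that] c2[OF that] unfolding continuous_up_to_closure_def by auto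
  obtain M1 where M1: "\<And>x. \<bar>\<Phi> x\<bar> \<le> M1" using lift_on_bounded[OF s c1] unfolding \<Phi>_def \<Omega>_def by blast
  obtain M2 where M2: "\<And>x. \<bar>\<Psi> x\<bar> \<le> M2" using lift_on_bounded[OF s c2] unfolding \<Psi>_def \<Omega>_def by blast
  have meas: "\<Phi> \<in> borel_measurable borel" "\<Psi> \<in> borel_measurable borel"
    unfolding \<Phi>_def \<Psi>_def \<Omega>_def
    by (intro lift_on_measurable open_regular_domain[OF s] continuous_on_regular_domain[OF s] cc; assumption)+
  have per: "periodic \<Phi>" "periodic \<Psi>" unfolding \<Phi>_def \<Psi>_def by (rule periodic_lift_on)+
  have AEeq: "AE x in lborel. x \<in> torus_domain \<longrightarrow> \<Phi> x = \<phi> x" "AE x in lborel. x \<in> torus_domain \<longrightarrow> \<Psi> x = partial1 \<phi> x"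
    unfolding \<Phi>_def \<Psi>_def \<Omega>_def by (rule AE_lift_on[OF s])+
  have cont: "AE x in lborel. isCont \<Phi> x" "AE x in lborel. isCont \<Psi> x"
    unfolding \<Phi>_def \<Psi>_def \<Omega>_def
    by (rule eventually_mono[OF AE_regular[OF s]], rule isCont_lift_on[OF s], use cc in blast, use cc in blast, use cc in blast)+
  have dense: "dense_orbit \<alpha>" by (rule totally_irrational_imp_dense_orbit) fact
  \<comment> \<open>The integral of a function that is not integrable is 0 by convention.\<close>
  have "integrable torus (partial1 \<phi>)"
    using \<open>lambda1 \<phi> \<noteq> 0\<close> not_integrable_integral_eq unfolding lambda1_def by blast
  then have I: "(\<integral>x. \<Phi> x \<partial>borel_torus) = 0" "(\<integral>x. \<Psi> x \<partial>borel_torus) = lambda1 \<phi>"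
    using integral_torus_eq[OF _ meas(1) AEeq(1)] integral_torus_eq[OF _ meas(2) AEeq(2)] int zero
    unfolding lambda1_def by (auto simp: borel_measurable_integrable)
  have "\<exists>c>0. \<forall>n t t'. \<forall>k<n. \<forall>k'<n. frac (t + real k * fst \<alpha>) \<in> E1 \<longrightarrow> frac (t' + real k' * fst \<alpha>) \<in> E1 \<longrightarrow>
      \<bar>t - t'\<bar> < c / real n \<longrightarrow> t = t' \<and> k = k'"
    unfolding E1_def break_points_def by (rule Bad_Z_separated[OF bad])
  then obtain c where c: "c > 0" and sep: "\<forall>n t t'. \<forall>k<n. \<forall>k'<n. frac (t + real k * fst \<alpha>) \<in> E1 \<longrightarrow> frac (t' + real k' * fst \<alpha>) \<in> E1 \<longrightarrow>
      \<bar>t - t'\<bar> < c / real n \<longrightarrow> t = t' \<and> k = k'"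
    by (elim exE conjE)
  have "sheared_cocycle \<Phi> \<Psi> \<alpha> E1 E2 (max M1 M2) c (lambda1 \<phi>)"
  proof
    show "\<bar>\<Phi> x\<bar> \<le> max M1 M2" "\<bar>\<Psi> x\<bar> \<le> max M1 M2" for x using M1[of x] M2[of x] by auto
    show "((\<lambda>t. \<Phi> (t, snd x)) has_real_derivative \<Psi> x) (at (fst x))" if "frac (fst x) \<notin> E1" "frac (snd x) \<notin> E2" for x
      using lift_on_deriv[OF s, of x \<phi>] that diff unfolding \<Phi>_def \<Psi>_def \<Omega>_def E1_def E2_def by blast
    show "finite E2" unfolding E2_def break_points_def by simp
    show "\<exists>n0. \<forall>n\<ge>n0. \<forall>y. \<bar>birkhoff \<alpha> \<Phi> n y\<bar> \<le> real n * \<delta>" if "\<delta> > 0" for \<delta>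
      using equidistribution[OF meas(1) M1 per(1) cont(1) dense that] by (simp add: I)
    show "\<exists>n0. \<forall>n\<ge>n0. \<forall>y. \<bar>birkhoff \<alpha> \<Psi> n y - real n * lambda1 \<phi>\<bar> \<le> real n * \<delta>" if "\<delta> > 0" for \<delta>
      using equidistribution[OF meas(2) M2 per(2) cont(2) dense that] by (simp add: I)
    show "t = t' \<and> k = k'" if "k < n" "k' < n" "frac (t + real k * fst \<alpha>) \<in> E1" "frac (t' + real k' * fst \<alpha>) \<in> E1"
      "\<bar>t - t'\<bar> < c / real n" for n t t' k k'
      by (rule sep[rule_format, OF that])
  qed (fact meas per c assms)+
  with AEeq(1) show ?thesis by blast
qed

section \<open>Completed measures and conclusion\<close>

text \<open>Completing a factor of a product does not lead out of the completed product. Consequently the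
  sets of the skew product agree with Borel sets up to null sets, although \<open>torus\<close> is already complete.\<close>

lemma completion_pair_measure_fst:
  fixes M1 :: "'a measure" and M2 :: "'b measure"
  assumes "sigma_finite_measure M1" "sigma_finite_measure M2"
  shows "sets (completion M1 \<Otimes>\<^sub>M M2) \<subseteq> sets (completion (M1 \<Otimes>\<^sub>M M2))" (is "sets ?P \<subseteq> sets ?Q")
    and "A \<in> sets (completion M1 \<Otimes>\<^sub>M M2) \<Longrightarrow> emeasure (completion M1 \<Otimes>\<^sub>M M2) A = emeasure (completion (M1 \<Otimes>\<^sub>M M2)) A"
proof -
  interpret M1: sigma_finite_measure M1 by fact
  interpret M2: sigma_finite_measure M2 by fact
  have strip: "\<exists>N. N \<in> null_sets (M1 \<Otimes>\<^sub>M M2) \<and> X \<times> Y = (S \<times> Y) \<union> ((X \<times> Y) \<inter> N)"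
    if "X = S \<union> K" "K \<subseteq> K'" "K' \<in> null_sets M1" "Y \<in> sets M2" for X S K K' Y
  proof (intro exI conjI)
    show "K' \<times> Y \<in> null_sets (M1 \<Otimes>\<^sub>M M2)"
      using that by (auto simp: null_sets_def M2.emeasure_pair_measure_Times)
    show "X \<times> Y = (S \<times> Y) \<union> ((X \<times> Y) \<inter> (K' \<times> Y))" using that by auto
  qed
  have rect: "X \<times> Y \<in> sets ?Q \<and> emeasure ?Q (X \<times> Y) = emeasure (completion M1) X * emeasure M2 Y"
    if X: "X \<in> sets (completion M1)" and Y: "Y \<in> sets M2" for X Y
  proof -
    obtain S K K' where S: "X = S \<union> K" "K \<subseteq> K'" "K' \<in> null_sets M1" "S \<in> sets M1"
      using X by (rule sets_completionE)
    obtain N where N: "N \<in> null_sets (M1 \<Otimes>\<^sub>M M2)" "X \<times> Y = (S \<times> Y) \<union> ((X \<times> Y) \<inter> N)"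
      using strip[OF S(1-3) Y] by blast
    have SY: "S \<times> Y \<in> sets ?Q" using S(4) Y by simp
    have null: "(X \<times> Y) \<inter> N \<in> null_sets ?Q" using N(1) by (auto simp: null_sets_completion_iff2)
    have "K \<in> null_sets (completion M1)" using S by (auto simp: null_sets_completion_iff2)
    then have "emeasure (completion M1) X = emeasure (completion M1) S"
      unfolding S(1) by (intro emeasure_Un_null_set) (use S(4) in auto)
    moreover have "emeasure ?Q (X \<times> Y) = emeasure ?Q (S \<times> Y)"
      by (subst N(2), rule emeasure_Un_null_set[OF SY null])
    moreover have "emeasure ?Q (S \<times> Y) = emeasure M1 S * emeasure M2 Y"
      using S(4) Y by (simp add: M2.emeasure_pair_measure_Times)
    moreover have "X \<times> Y \<in> sets ?Q"
      by (subst N(2)) (use SY null in \<open>auto simp: null_sets_def intro!: sets.Un\<close>)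
    ultimately show ?thesis using S(4) by simp
  qed
  have id: "(\<lambda>p. p) \<in> measurable ?Q ?P"
  proof (rule measurable_pair_measureI)
    show "(\<lambda>p. p) \<in> space ?Q \<rightarrow> space (completion M1) \<times> space M2" by (simp add: space_pair_measure)
    show "(\<lambda>p. p) -` (X \<times> Y) \<inter> space ?Q \<in> sets ?Q" if "X \<in> sets (completion M1)" "Y \<in> sets M2" for X Y
      using rect[OF that] by (auto intro: sets.Int)
  qed
  show sub: "sets ?P \<subseteq> sets ?Q"
  proof
    fix A assume A: "A \<in> sets ?P"
    have "A \<subseteq> space ?Q" using sets.sets_into_space[OF A] by (simp add: space_pair_measure)
    then show "A \<in> sets ?Q" using measurable_sets[OF id A] by (simp add: Int_absorb2)
  qed
  have sf: "sigma_finite_measure (completion M1)"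
  proof
    from M1.sigma_finite_countable obtain \<A> where \<A>: "countable \<A>" "\<A> \<subseteq> sets M1" "\<Union>\<A> = space M1" "\<forall>a\<in>\<A>. emeasure M1 a \<noteq> \<infinity>"
      by blast
    then show "\<exists>A. countable A \<and> A \<subseteq> sets (completion M1) \<and> \<Union> A = space (completion M1) \<and> (\<forall>a\<in>A. emeasure (completion M1) a \<noteq> \<infinity>)"
      by (intro exI[of _ \<A>]) (auto simp: subset_eq)
  qed
  have "?P = distr ?Q ?P (\<lambda>p. p)"
  proof (rule pair_measure_eqI[OF sf assms(2)])
    fix X Y assume XY: "X \<in> sets (completion M1)" "Y \<in> sets M2"
    have "(\<lambda>p. p) -` (X \<times> Y) \<inter> space ?Q = X \<times> Y"
      using sets.sets_into_space[OF XY(1)] sets.sets_into_space[OF XY(2)] by (auto simp: space_pair_measure)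
    then show "emeasure (completion M1) X * emeasure M2 Y = emeasure (distr ?Q ?P (\<lambda>p. p)) (X \<times> Y)"
      using rect[OF XY] by (subst emeasure_distr[OF id]) (auto simp: XY)
  qed simp
  then have "emeasure ?P A = emeasure (distr ?Q ?P (\<lambda>p. p)) A" by simp
  moreover assume A: "A \<in> sets ?P"
  moreover have "A \<subseteq> space ?Q" using sets.sets_into_space[OF A] by (simp add: space_pair_measure)
  ultimately show "emeasure ?P A = emeasure ?Q A" by (simp only: emeasure_distr[OF id A]) (simp add: Int_absorb2)
qed

text \<open>A set of the completion differs from a measurable set by part of a null set, and preimages of
  null sets are null sets.\<close>

lemma measure_preserving_completion:
  assumes T: "T \<in> measurable N N" and "distr N N T = N"
  shows "measure_preserving (completion N) T"
proof -
  have em: "emeasure N (T -` S \<inter> space N) = emeasure N S" if "S \<in> sets N" for S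
    using emeasure_distr[OF T that] assms(2) by simp
  have *: "T -` A \<inter> space N \<in> sets (completion N) \<and> emeasure (completion N) (T -` A \<inter> space N) = emeasure (completion N) A"
    if A: "A \<in> sets (completion N)" for A
  proof -
    obtain S K K' where S: "A = S \<union> K" "K \<subseteq> K'" "K' \<in> null_sets N" "S \<in> sets N"
      using A by (rule sets_completionE)
    have K: "K \<in> null_sets (completion N)" using S by (auto simp: null_sets_completion_iff2)
    have "T -` K' \<inter> space N \<in> null_sets N" using S(3) em[of K'] measurable_sets[OF T, of K'] by (auto simp: null_sets_def)
    then have TK: "T -` K \<inter> space N \<in> null_sets (completion N)" 
      unfolding null_sets_completion_iff2 by (rule bexI[rotated]) (use S(2) in auto)
    have TS: "T -` S \<inter> space N \<in> sets N" by (rule measurable_sets[OF T S(4)])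
    have eq: "T -` A \<inter> space N = (T -` S \<inter> space N) \<union> (T -` K \<inter> space N)" unfolding S(1) by auto
    have "emeasure (completion N) (T -` A \<inter> space N) = emeasure N (T -` S \<inter> space N)"
      unfolding eq using TS TK by (subst emeasure_Un_null_set) auto
    also have "\<dots> = emeasure N S" by (rule em[OF S(4)])
    also have "\<dots> = emeasure (completion N) A"
      unfolding S(1) using S(4) K by (subst emeasure_Un_null_set) auto
    finally have "emeasure (completion N) (T -` A \<inter> space N) = emeasure (completion N) A" .
    moreover have "T -` A \<inter> space N \<in> sets (completion N)"
      unfolding eq using TS TK by (intro sets.Un) (auto simp: null_sets_def)
    ultimately show ?thesis by blast
  qed
  then show ?thesis unfolding measure_preserving_def
    using measurable_space[OF T] by (auto simp: measurable_def simp del: emeasure_completion)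
qed

lemma torus_eq_completion: "torus = completion borel_torus"
proof (rule measure_eqI)
  have D: "torus_domain \<in> sets lborel" by simp
  show sets: "sets torus = sets (completion borel_torus)"
  proof
    show "sets torus \<subseteq> sets (completion borel_torus)"
    proof
      fix A assume "A \<in> sets torus"
      then have A: "A \<subseteq> torus_domain" "A \<in> sets lebesgue" unfolding torus_def by (auto simp: sets_restrict_space_iff)
      then obtain S K K' where S: "A = S \<union> K" "K \<subseteq> K'" "K' \<in> null_sets lborel" "S \<in> sets lborel"
        by (elim sets_completionE)
      show "A \<in> sets (completion borel_torus)"
      proof (rule sets_completionI)
        show "A = S \<union> K" by fact
        show "K \<subseteq> K' \<inter> torus_domain" using S A by auto
        have "K' \<inter> torus_domain \<in> null_sets lborel" using S(3) by (intro null_set_Int2) auto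
        then show "K' \<inter> torus_domain \<in> null_sets borel_torus"
          unfolding borel_torus_def by (subst null_sets_restrict_space) auto
        show "S \<in> sets borel_torus" unfolding borel_torus_def using S A by (subst sets_restrict_space_iff) auto
      qed
    qed
    show "sets (completion borel_torus) \<subseteq> sets torus"
    proof
      fix A assume "A \<in> sets (completion borel_torus)"
      then obtain S K K' where S: "A = S \<union> K" "K \<subseteq> K'" "K' \<in> null_sets borel_torus" "S \<in> sets borel_torus"
        by (rule sets_completionE)
      have "K' \<in> null_sets lborel" "K' \<subseteq> torus_domain" using S(3) unfolding borel_torus_def by (auto simp: null_sets_restrict_space)
      moreover have "S \<in> sets lborel" "S \<subseteq> torus_domain" using S(4) unfolding borel_torus_def by (auto simp: sets_restrict_space_iff)
      ultimately have "A \<in> sets lebesgue" "A \<subseteq> torus_domain"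
        using sets_completionI[OF S(1,2)] S(1,2) by auto
      then show "A \<in> sets torus" unfolding torus_def by (subst sets_restrict_space_iff) auto
    qed
  qed
  fix A assume A: "A \<in> sets torus"
  then obtain S K K' where S: "A = S \<union> K" "K \<subseteq> K'" "K' \<in> null_sets borel_torus" "S \<in> sets borel_torus"
    unfolding sets by (elim sets_completionE)
  have K': "K' \<in> null_sets lborel" using S(3) unfolding borel_torus_def by (auto simp: null_sets_restrict_space)
  have S': "S \<in> sets lborel" "S \<subseteq> torus_domain" using S(4) unfolding borel_torus_def by (auto simp: sets_restrict_space_iff)
  have "emeasure torus A = emeasure lebesgue A"
    unfolding torus_def using A sets.sets_into_space[OF A] by (subst emeasure_restrict_space) (auto simp: torus_def)
  also have "\<dots> = emeasure lebesgue S" unfolding S(1)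
    by (rule emeasure_Un_null_set) (use S' K' S(2) in \<open>auto simp: null_sets_completion_iff2\<close>)
  also have "\<dots> = emeasure borel_torus S" using S' unfolding borel_torus_def by (simp add: emeasure_restrict_space)
  also have "\<dots> = emeasure (completion borel_torus) A" unfolding S(1)
    by (subst emeasure_Un_null_set) (use S in \<open>auto simp: null_sets_completion_iff2\<close>)
  finally show "emeasure torus A = emeasure (completion borel_torus) A" .
qed

lemma measure_preserving_rotation: "measure_preserving torus (rotation \<alpha>)"
  unfolding torus_eq_completion
  by (rule measure_preserving_completion[OF rotation_measurable_borel_torus distr_rotation])

lemma sigma_finite_torus: "sigma_finite_measure torus"
proof -
  have D: "torus_domain \<in> sets borel_torus" using sets.top[of borel_torus] by simp
  have "emeasure torus (space torus) = 1"
    unfolding torus_eq_completion using D by (simp add: emeasure_borel_torus)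
  then interpret finite_measure torus by (intro finite_measureI) simp
  show ?thesis by unfold_locales
qed

text \<open>Over each point of the base the fibre is translated, and the base is rotated.\<close>

lemma skew_product_preserves:
  assumes [measurable]: "\<phi> \<in> borel_measurable torus"
  shows "skew_product \<phi> \<alpha> \<in> measurable (torus \<Otimes>\<^sub>M lborel) (torus \<Otimes>\<^sub>M lborel)" (is ?meas)
    and "distr (torus \<Otimes>\<^sub>M lborel) (torus \<Otimes>\<^sub>M lborel) (skew_product \<phi> \<alpha>) = torus \<Otimes>\<^sub>M lborel"
proof -
  have rot [measurable]: "rotation \<alpha> \<in> measurable torus torus"
    using measure_preserving_rotation unfolding measure_preserving_def by blast
  have eq: "skew_product \<phi> \<alpha> = (\<lambda>p. (rotation \<alpha> (fst p), snd p + \<phi> (fst p)))"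
    by (auto simp: skew_product_def)
  show meas: ?meas unfolding eq by measurable
  have "torus \<Otimes>\<^sub>M lborel = distr (torus \<Otimes>\<^sub>M lborel) (torus \<Otimes>\<^sub>M lborel) (skew_product \<phi> \<alpha>)"
  proof (rule pair_measure_eqI[OF sigma_finite_torus lborel.sigma_finite_measure_axioms])
    fix X :: "(real \<times> real) set" and Y :: "real set" assume XY: "X \<in> sets torus" "Y \<in> sets lborel"
    have pre: "skew_product \<phi> \<alpha> -` (X \<times> Y) \<inter> space (torus \<Otimes>\<^sub>M lborel) \<in> sets (torus \<Otimes>\<^sub>M lborel)"
      by (rule measurable_sets[OF meas]) (use XY in auto)
    have slice: "emeasure lborel (Pair x -` (skew_product \<phi> \<alpha> -` (X \<times> Y) \<inter> space (torus \<Otimes>\<^sub>M lborel)))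
        = emeasure lborel Y * indicator (rotation \<alpha> -` X \<inter> space torus) x" if x: "x \<in> space torus" for x
    proof (cases "rotation \<alpha> x \<in> X")
      case True
      have "Pair x -` (skew_product \<phi> \<alpha> -` (X \<times> Y) \<inter> space (torus \<Otimes>\<^sub>M lborel)) = (+) (\<phi> x) -` Y \<inter> space lborel"
        using True x by (auto simp: skew_product_def space_pair_measure add.commute)
      also have "emeasure lborel \<dots> = emeasure (distr lborel borel ((+) (\<phi> x))) Y"
        using XY(2) by (subst emeasure_distr) auto
      also have "\<dots> = emeasure lborel Y" by (simp only: lborel_distr_plus)
      finally show ?thesis using True x by simp
    next
      case False
      then have "Pair x -` (skew_product \<phi> \<alpha> -` (X \<times> Y) \<inter> space (torus \<Otimes>\<^sub>M lborel)) = {}"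
        by (auto simp: skew_product_def)
      then show ?thesis using False by simp
    qed
    have rX: "rotation \<alpha> -` X \<inter> space torus \<in> sets torus" by (rule measurable_sets[OF rot XY(1)])
    have "emeasure (distr (torus \<Otimes>\<^sub>M lborel) (torus \<Otimes>\<^sub>M lborel) (skew_product \<phi> \<alpha>)) (X \<times> Y)
      = emeasure (torus \<Otimes>\<^sub>M lborel) (skew_product \<phi> \<alpha> -` (X \<times> Y) \<inter> space (torus \<Otimes>\<^sub>M lborel))"
      by (rule emeasure_distr[OF meas]) (use XY in auto)
    also have "\<dots> = (\<integral>\<^sup>+x. emeasure lborel (Pair x -` (skew_product \<phi> \<alpha> -` (X \<times> Y) \<inter> space (torus \<Otimes>\<^sub>M lborel))) \<partial>torus)"
      by (rule lborel.emeasure_pair_measure_alt[OF pre])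
    also have "\<dots> = (\<integral>\<^sup>+x. emeasure lborel Y * indicator (rotation \<alpha> -` X \<inter> space torus) x \<partial>torus)"
      by (rule nn_integral_cong) (rule slice)
    also have "\<dots> = emeasure lborel Y * emeasure torus (rotation \<alpha> -` X \<inter> space torus)"
      by (rule nn_integral_cmult_indicator[OF rX])
    also have "emeasure torus (rotation \<alpha> -` X \<inter> space torus) = emeasure torus X"
      using measure_preserving_rotation XY(1) unfolding measure_preserving_def by blast
    finally show "emeasure torus X * emeasure lborel Y = emeasure (distr (torus \<Otimes>\<^sub>M lborel) (torus \<Otimes>\<^sub>M lborel) (skew_product \<phi> \<alpha>)) (X \<times> Y)"
      by (simp add: mult.commute)
  qed simp
  then show "distr (torus \<Otimes>\<^sub>M lborel) (torus \<Otimes>\<^sub>M lborel) (skew_product \<phi> \<alpha>) = torus \<Otimes>\<^sub>M lborel" by simp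
qed

interpretation torus_lborel: pair_sigma_finite torus lborel
  by (intro pair_sigma_finite.intro sigma_finite_torus lborel.sigma_finite_measure_axioms)

interpretation borel_torus_lborel: pair_sigma_finite borel_torus lborel
  by (intro pair_sigma_finite.intro borel_torus.sigma_finite_measure_axioms lborel.sigma_finite_measure_axioms)

lemma AE_borel_torus_lborelI:
  assumes "AE p in lborel. Q p" "{p \<in> space (borel_torus \<Otimes>\<^sub>M lborel). Q p} \<in> sets (borel_torus \<Otimes>\<^sub>M lborel)"
  shows "AE p in borel_torus \<Otimes>\<^sub>M lborel. Q p"
proof (rule borel_torus_lborel.AE_pair_measure[OF assms(2)])
  have "AE p in lborel \<Otimes>\<^sub>M lborel. Q p" using assms(1) unfolding lborel_prod .
  then have "AE x in lborel. AE z in lborel. Q (x, z)" by (rule lborel_pair.AE_pair)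
  then show "AE x in borel_torus. AE z in lborel. Q (x, z)" by (rule AE_borel_torus)
qed

lemma null_sets_borel_torus_torus:
  assumes "Z \<in> null_sets (borel_torus \<Otimes>\<^sub>M lborel)"
  shows "Z \<in> null_sets (torus \<Otimes>\<^sub>M lborel)"
proof -
  have "(\<lambda>p. p) \<in> measurable (torus \<Otimes>\<^sub>M lborel) (borel_torus \<Otimes>\<^sub>M lborel)"
  proof -
    have "(\<lambda>x. x) \<in> measurable torus borel_torus" unfolding torus_eq_completion by (rule measurable_completion) simp
    then have "(\<lambda>p. (fst p, snd p)) \<in> measurable (torus \<Otimes>\<^sub>M lborel) (borel_torus \<Otimes>\<^sub>M lborel)"
      by (intro measurable_Pair measurable_snd) (rule measurable_compose[OF measurable_fst])
    then show ?thesis by simp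
  qed
  moreover have Z: "Z \<in> sets (borel_torus \<Otimes>\<^sub>M lborel)" using assms by auto
  moreover have sub: "Z \<subseteq> space (torus \<Otimes>\<^sub>M lborel)" 
    using sets.sets_into_space[OF Z] by (simp add: torus_eq_completion space_pair_measure)
  ultimately have "(\<lambda>p. p) -` Z \<inter> space (torus \<Otimes>\<^sub>M lborel) \<in> sets (torus \<Otimes>\<^sub>M lborel)" 
    by (intro measurable_sets)
  then have "Z \<in> sets (torus \<Otimes>\<^sub>M lborel)" using sub by (simp add: Int_absorb2)
  moreover from this have "emeasure (torus \<Otimes>\<^sub>M lborel) Z = emeasure (completion (borel_torus \<Otimes>\<^sub>M lborel)) Z"
    unfolding torus_eq_completion
    by (intro completion_pair_measure_fst(2) borel_torus.sigma_finite_measure_axioms lborel.sigma_finite_measure_axioms)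
  ultimately show ?thesis using assms Z by (auto simp: null_sets_def)
qed

text \<open>An invariant set is replaced by a Borel set \<open>B\<close> that differs from it only inside a null set \<open>Z\<close>;
  the indicator function of \<open>B\<close> is then invariant almost everywhere, hence almost everywhere constant.\<close>

theorem theorem3p5:
  fixes \<phi> :: "real \<times> real \<Rightarrow> real" and \<alpha> :: "real \<times> real"
    and r1 r2 :: nat and \<beta>1 \<beta>2 :: "nat \<Rightarrow> real"
  assumes "\<phi> \<in> F1_with r1 \<beta>1 r2 \<beta>2"
    and "lambda1 \<phi> \<noteq> 0"
    and "totally_irrational \<alpha>"
    and "\<And>j j'. j \<in> {1..r1} \<Longrightarrow> j' \<in> {1..r1} \<Longrightarrow> \<beta>1 j - \<beta>1 j' \<in> Bad_Z (fst \<alpha>)"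
  shows "ergodic_cocycle \<phi> \<alpha>"
proof -
  define T where "T = skew_product \<phi> \<alpha>"
  define P :: "((real \<times> real) \<times> real) measure" where "P = torus \<Otimes>\<^sub>M lborel"
  define N :: "((real \<times> real) \<times> real) measure" where "N = borel_torus \<Otimes>\<^sub>M lborel"
  have \<phi>: "\<phi> \<in> borel_measurable torus" using assms(1) unfolding F1_with_def by auto
  have T: "T \<in> measurable P P" "distr P P T = P" unfolding T_def P_def by (rule skew_product_preserves[OF \<phi>])+
  have dom: "space P = torus_domain \<times> UNIV" "space N = torus_domain \<times> UNIV" 
    by (auto simp: P_def N_def space_pair_measure torus_eq_completion)
  obtain \<Phi> \<Psi> E1 E2 M c where sc: "sheared_cocycle \<Phi> \<Psi> \<alpha> E1 E2 M c (lambda1 \<phi>)" 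
    and \<Phi>\<phi>: "AE x in lborel. x \<in> torus_domain \<longrightarrow> \<Phi> x = \<phi> x"
    using F1_sheared_cocycle[OF assms] by blast
  interpret sheared_cocycle \<Phi> \<Psi> \<alpha> E1 E2 M c "lambda1 \<phi>" by (rule sc)
  have "A \<in> null_sets (completion P) \<or> space (completion P) - A \<in> null_sets (completion P)"
    if A: "A \<in> sets (completion P)" and inv: "T -` A \<inter> space (completion P) = A" for A
  proof -
    obtain S K K' where S: "A = S \<union> K" "K \<subseteq> K'" "K' \<in> null_sets P" "S \<in> sets P"
      using A by (rule sets_completionE)
    have sub: "sets P \<subseteq> sets (completion N)"
      unfolding P_def N_def torus_eq_completion
      by (rule completion_pair_measure_fst(1)[OF borel_torus.sigma_finite_measure_axioms lborel.sigma_finite_measure_axioms])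
    have em: "emeasure P X = emeasure (completion N) X" if "X \<in> sets P" for X
      using that unfolding P_def N_def torus_eq_completion
      by (rule completion_pair_measure_fst(2)[OF borel_torus.sigma_finite_measure_axioms lborel.sigma_finite_measure_axioms])
    obtain B K2 K2' where B: "S = B \<union> K2" "K2 \<subseteq> K2'" "K2' \<in> null_sets N" "B \<in> sets N"
      using subsetD[OF sub S(4)] by (rule sets_completionE)
    have "K' \<in> null_sets (completion N)" using S(3) sub em[of K'] by (auto simp: null_sets_def simp del: emeasure_completion)
    then obtain K3 where K3: "K' \<subseteq> K3" "K3 \<in> null_sets N" by (auto simp: null_sets_completion_iff2)
    define Z where "Z = K2' \<union> K3"
    have Z: "Z \<in> null_sets N" using B K3 by (auto simp: Z_def)
    have AB: "p \<in> A \<longleftrightarrow> p \<in> B" if "p \<notin> Z" for p using that S B K3 by (auto simp: Z_def)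
    have ZP: "Z \<in> null_sets P" using null_sets_borel_torus_torus Z unfolding N_def P_def by blast
    have z1: "AE p in P. p \<notin> Z" by (rule AE_not_in[OF ZP])
    then have "AE p in distr P P T. p \<notin> Z" by (simp only: T(2))
    then have "AE p in P. T p \<notin> Z" by (rule AE_distrD[OF T(1)])
    with z1 have "AE p in torus \<Otimes>\<^sub>M lborel. p \<notin> Z \<and> T p \<notin> Z" unfolding P_def by simp
    then have "AE x in torus. AE z in lborel. (x, z) \<notin> Z \<and> T (x, z) \<notin> Z" by (rule torus_lborel.AE_pair)
    then have zz: "AE x in borel_torus. AE z in lborel. (x, z) \<notin> Z \<and> T (x, z) \<notin> Z"
      unfolding torus_eq_completion by (rule AE_completion_iff[THEN iffD1])
    define f where "f p = (indicator B (fract2 (fst p), snd p) :: real)" for p :: "(real \<times> real) \<times> real"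
    have fr: "fract2 \<in> measurable borel borel_torus"
      unfolding borel_torus_def by (rule measurable_restrict_space2) auto
    have "(\<lambda>p. (fract2 (fst p), snd p)) \<in> measurable (borel \<Otimes>\<^sub>M borel) N"
      unfolding N_def by (intro measurable_Pair measurable_compose[OF measurable_fst fr]) simp
    then have f: "f \<in> borel_measurable borel"
      unfolding f_def[abs_def] using B(4) 
      by (intro borel_measurable_indicator' ) (auto simp: borel_prod)
    have f1: "\<bar>f p\<bar> \<le> 1" for p by (simp add: f_def indicator_def)
    have fper: "periodic (\<lambda>x. f (x, z))" for z by (simp add: periodic_def f_def)
    have finv: "AE x in lborel. AE z in lborel. f (x + \<alpha>, z + \<Phi> x) = f (x, z)"
    proof (rule AE_lborel_periodic)
      show "AE x in borel_torus. AE z in lborel. f (x + \<alpha>, z + \<Phi> x) = f (x, z)"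
        using zz \<Phi>\<phi>[folded AE_borel_torus_iff] AE_space
      proof eventually_elim
        case (elim x)
        from elim(1) show ?case
        proof eventually_elim
          case (elim z)
          note z = this
          have x: "x \<in> torus_domain" using \<open>x \<in> space borel_torus\<close> by simp
          have Txz: "T (x, z) = (fract2 (x + \<alpha>), z + \<Phi> x)" 
            using \<open>\<Phi> x = \<phi> x\<close> by (simp add: T_def skew_product_def rotation_eq)
          have "(x, z) \<in> A \<longleftrightarrow> T (x, z) \<in> A" using inv x dom(1) by auto
          then have "(x, z) \<in> B \<longleftrightarrow> T (x, z) \<in> B" using AB z by blast
          then show ?case using x by (simp add: f_def Txz fract2_id indicator_def)
        qed
      qed
      show "periodic (\<lambda>x. AE z in lborel. f (x + \<alpha>, z + \<Phi> x) = f (x, z))"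
      proof -
        have "f (fract2 x + \<alpha>, w) = f (x + \<alpha>, w)" "f (fract2 x, w) = f (x, w)" "\<Phi> (fract2 x) = \<Phi> x" for x w
          using \<Phi>_periodic by (simp_all add: f_def fract2_add periodic_def)
        then show ?thesis unfolding periodic_def by simp
      qed
    qed
    obtain \<kappa> where \<kappa>: "AE p in lborel. f p = \<kappa>"
      using invariant_function_constant[OF f f1 fper finv totally_irrational_imp_dense_orbit[OF assms(3)]] by blast
    have fB: "f p = indicator B p" if "p \<in> space N" for p
      using that dom(2) by (cases p) (auto simp: f_def fract2_id)
    have "AE p in N. f p = \<kappa>"
      unfolding N_def
    proof (rule AE_borel_torus_lborelI[OF \<kappa>])
      have "{p \<in> space N. f p = \<kappa>} = {p \<in> space N. indicator B p = \<kappa>}" using fB by auto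
      also have "\<dots> \<in> sets N" using B(4) by measurable
      finally show "{p \<in> space (borel_torus \<Otimes>\<^sub>M lborel). f p = \<kappa>} \<in> sets (borel_torus \<Otimes>\<^sub>M lborel)" unfolding N_def .
    qed
    then have const: "AE p in N. (p \<in> A) = (\<kappa> = 1)"
      using AE_not_in[OF Z] AE_space
    proof eventually_elim
      case (elim p)
      then have "indicator B p = \<kappa>" using fB by simp
      then show ?case using AB[of p] elim(2) by (auto simp: indicator_def split: if_splits)
    qed
    then obtain N0 where N0: "{p \<in> space N. \<not> ((p \<in> A) = (\<kappa> = 1))} \<subseteq> N0" "N0 \<in> null_sets N"
      by (auto elim: AE_E simp: null_sets_def)
    have N0P: "N0 \<in> null_sets P" using null_sets_borel_torus_torus N0(2) unfolding N_def P_def by blast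
    have AP: "A \<subseteq> space N" using sets.sets_into_space[OF A] dom by simp
    show ?thesis
    proof (cases "\<kappa> = 1")
      case True
      then have "space (completion P) - A \<subseteq> N0" using N0(1) dom by auto
      then show ?thesis using N0P by (auto simp: null_sets_completion_iff2)
    next
      case False
      then have "A \<subseteq> N0" using N0(1) AP by auto
      then show ?thesis using N0P by (auto simp: null_sets_completion_iff2)
    qed
  qed
  moreover have "measure_preserving (completion P) T" by (rule measure_preserving_completion[OF T])
  ultimately show ?thesis unfolding ergodic_cocycle_def ergodic_def T_def P_def by blast
qed

end
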